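(* Let $p_0$ be an odd prime, $p$ a power of $p_0$, and $R(x) = 2x^p + x$. Suppose there exist $\alpha \in \mathbb{F}_p^\times \setminus \{-1\}$, with $\beta := -(\alpha(\alpha+1))^{-1}$, and elements $\xi, \zeta \in \mathbb{F}_{p^d}^\times$ with $\xi^{p-1} = \alpha$ and $\zeta^{p-1} = \beta$, where $d = \mathrm{lcm}(d_1, d_2)$ with $d_1, d_2$ the orders of $\alpha, \beta$ in $\mathbb{F}_p^\times$, such that $d \equiv 0 \pmod 4$ and $\beta^{d/2} = -1$. Let $r \geq 1$ be a multiple of $d$, and let $\overline{C}_{R,r}$ be the smooth projective compactification of the affine curve $z^{p^r} - z = xR(x)$ over $\mathbb{F}_{p_0}$. Then $\overline{C}_{R,r}$ is not $\mathbb{F}_{p_0^k}$-maximal for any integer $k \geq 1$.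
   Context: $\mathbb{F}$ is an algebraic closure of $\mathbb{F}_{p_0}$. A geometrically connected smooth projective curve $C$ of genus $g$ over $\mathbb{F}_{p_0}$ is $\mathbb{F}_Q$-maximal if $|C(\mathbb{F}_Q)| = Q + 1 + 2gQ^{1/2}$. *)

theory Defs
  imports
    "HOL-Algebra.Algebraic_Closure_Type"
    "HOL-Library.FuncSet"
    "HOL-Library.Extended_Nat"
    "HOL-Library.Cardinality"
begin

section \<open>Finite subfields of the algebraic closure\<close>

text \<open>For \<open>'a\<close> a field with \<open>p\<^sub>0\<close> elements, the type \<open>'a alg_closure\<close> is an algebraic closure of
  \<open>\<bbbF>\<^bsub>p\<^sub>0\<^esub>\<close>; if \<open>q\<close> is a power of \<open>p\<^sub>0\<close> then the following is its unique subfield with \<open>q\<close> elements.\<close>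

definition Fq :: "nat \<Rightarrow> 'a::field alg_closure set" where
  "Fq q = {a. a ^ q = a}"

definition mult_order :: "'b::field \<Rightarrow> nat" where
  "mult_order a = (LEAST n. n > 0 \<and> a ^ n = 1)"

section \<open>The smooth projective curve of a function field\<close>

text \<open>A smooth projective curve over a perfect field \<open>k\<close> (here the type \<open>'a\<close>) is given by its function
  field \<open>K\<close> (here the type \<open>'k\<close>), which contains \<open>k\<close> by means of a ring homomorphism
  \<open>\<iota> :: 'a \<Rightarrow> 'k\<close>. Its closed points are the valuation rings of \<open>K/k\<close>, each of them being the
  local ring of the curve at the point.\<close>

definition field_embedding :: "('a::field \<Rightarrow> 'k::field) \<Rightarrow> bool" where
  "field_embedding \<iota> \<longleftrightarrow>
     \<iota> 1 = 1 \<and> (\<forall>a b. \<iota> (a + b) = \<iota> a + \<iota> b) \<and> (\<forall>a b. \<iota> (a * b) = \<iota> a * \<iota> b)"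

definition closed_points :: "('a::field \<Rightarrow> 'k::field) \<Rightarrow> 'k set set" where
  "closed_points \<iota> = {\<O>. range \<iota> \<subset> \<O> \<and> \<O> \<subset> UNIV \<and>
     (\<forall>a\<in>\<O>. \<forall>b\<in>\<O>. a - b \<in> \<O> \<and> a * b \<in> \<O>) \<and> (\<forall>a. a \<in> \<O> \<or> inverse a \<in> \<O>)}"

definition unit_set :: "'k::field set \<Rightarrow> 'k set" where
  "unit_set \<O> = {a \<in> \<O>. a \<noteq> 0 \<and> inverse a \<in> \<O>}"

definition max_ideal :: "'k::field set \<Rightarrow> 'k set" where
  "max_ideal \<O> = \<O> - unit_set \<O>"

text \<open>The normalised discrete valuation with valuation ring \<open>\<O>\<close>, at \<open>a \<noteq> 0\<close>.\<close>

definition ord_at :: "'k::field set \<Rightarrow> 'k \<Rightarrow> int" where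
  "ord_at \<O> a = (THE n. \<exists>t u. max_ideal \<O> = (\<lambda>b. t * b) ` \<O> \<and> u \<in> unit_set \<O> \<and> a = t powi n * u)"

text \<open>For \<open>k\<close>-subspaces \<open>W \<subseteq> V\<close> of \<open>K\<close>: \<open>B\<close> represents a finite \<open>k\<close>-basis of \<open>V/W\<close>.\<close>

definition basis_mod :: "('a::field \<Rightarrow> 'k::field) \<Rightarrow> 'k set \<Rightarrow> 'k set \<Rightarrow> 'k set \<Rightarrow> bool" where
  "basis_mod \<iota> W V B \<longleftrightarrow> finite B \<and> B \<subseteq> V \<and>
     (\<forall>v\<in>V. \<exists>!c. c \<in> extensional B \<and> v - (\<Sum>b\<in>B. \<iota> (c b) * b) \<in> W)"

definition dim_mod :: "('a::field \<Rightarrow> 'k::field) \<Rightarrow> 'k set \<Rightarrow> 'k set \<Rightarrow> nat" where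
  "dim_mod \<iota> W V = (THE n. \<exists>B. basis_mod \<iota> W V B \<and> card B = n)"

text \<open>The degree of the residue field over \<open>k\<close>.\<close>

definition point_degree :: "('a::field \<Rightarrow> 'k::field) \<Rightarrow> 'k set \<Rightarrow> nat" where
  "point_degree \<iota> \<O> = dim_mod \<iota> (max_ideal \<O>) \<O>"

definition divisors :: "('a::field \<Rightarrow> 'k::field) \<Rightarrow> ('k set \<Rightarrow> int) set" where
  "divisors \<iota> = {D. finite {P. D P \<noteq> 0} \<and> {P. D P \<noteq> 0} \<subseteq> closed_points \<iota>}"

definition divisor_degree :: "('a::field \<Rightarrow> 'k::field) \<Rightarrow> ('k set \<Rightarrow> int) \<Rightarrow> int" where
  "divisor_degree \<iota> D = (\<Sum>P\<in>{P. D P \<noteq> 0}. D P * int (point_degree \<iota> P))"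

definition riemann_roch_space :: "('a::field \<Rightarrow> 'k::field) \<Rightarrow> ('k set \<Rightarrow> int) \<Rightarrow> 'k set" where
  "riemann_roch_space \<iota> D = {a. a = 0 \<or> (\<forall>P\<in>closed_points \<iota>. ord_at P a + D P \<ge> 0)}"

definition ell :: "('a::field \<Rightarrow> 'k::field) \<Rightarrow> ('k set \<Rightarrow> int) \<Rightarrow> nat" where
  "ell \<iota> D = dim_mod \<iota> {0} (riemann_roch_space \<iota> D)"

text \<open>The genus is the maximum of \<open>deg D + 1 - \<ell>(D)\<close>, for \<open>k\<close> algebraically closed in \<open>K\<close> (that is, for a
  geometrically connected curve). The maximum is finite by Riemann's theorem, and truncating at \<open>0\<close>
  is harmless because \<open>D = 0\<close> contributes \<open>0\<close>.\<close>

definition genus :: "('a::field \<Rightarrow> 'k::field) \<Rightarrow> enat" where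
  "genus \<iota> = (SUP D\<in>divisors \<iota>. enat (nat (divisor_degree \<iota> D + 1 - int (ell \<iota> D))))"

text \<open>The points with values in \<open>\<bbbF>\<^sub>Q\<close>: a morphism \<open>Spec \<bbbF>\<^sub>Q \<rightarrow> C\<close> over \<open>k\<close> is a closed point together with a
  \<open>k\<close>-homomorphism from its residue field to \<open>\<bbbF>\<^sub>Q\<close>, that is, a homomorphism from its local ring to \<open>\<bbbF>\<^sub>Q\<close>
  which kills the maximal ideal. (The generic point has no such homomorphism, as \<open>K\<close> is not
  algebraic over \<open>k\<close>.)\<close>

definition rational_points ::
    "('a::field \<Rightarrow> 'k::field) \<Rightarrow> nat \<Rightarrow> ('k set \<times> ('k \<Rightarrow> 'a alg_closure)) set" where
  "rational_points \<iota> Q = {(\<O>, \<phi>). \<O> \<in> closed_points \<iota> \<and> \<phi> \<in> \<O> \<rightarrow>\<^sub>E Fq Q \<and>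
     (\<forall>c. \<phi> (\<iota> c) = to_ac c) \<and>
     (\<forall>a\<in>\<O>. \<forall>b\<in>\<O>. \<phi> (a + b) = \<phi> a + \<phi> b \<and> \<phi> (a * b) = \<phi> a * \<phi> b) \<and>
     (\<forall>a\<in>max_ideal \<O>. \<phi> a = 0)}"

definition maximal_curve :: "('a::field \<Rightarrow> 'k::field) \<Rightarrow> nat \<Rightarrow> bool" where
  "maximal_curve \<iota> Q \<longleftrightarrow> (\<exists>g. genus \<iota> = enat g \<and>
     real (card (rational_points \<iota> Q)) = real Q + 1 + 2 * real g * sqrt (real Q))"

section \<open>Function fields of affine plane curves\<close>

text \<open>Bivariate polynomials are elements of \<open>k[X][Z]\<close>, where \<open>Z\<close> is the outer variable.\<close>

definition eval2 :: "('a::field \<Rightarrow> 'k::field) \<Rightarrow> 'a poly poly \<Rightarrow> 'k \<Rightarrow> 'k \<Rightarrow> 'k" where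
  "eval2 \<iota> g x z = poly (map_poly (\<lambda>h. poly (map_poly \<iota> h) x) g) z"

text \<open>\<open>K\<close> is the field of fractions of \<open>k[X, Z]/(f)\<close>, where \<open>x\<close> and \<open>z\<close> are the classes of \<open>X\<close> and \<open>Z\<close>.
  If the affine curve \<open>f = 0\<close> is smooth, the curve with function field \<open>K\<close> is its smooth
  projective compactification.\<close>

definition plane_curve_function_field ::
    "('a::field \<Rightarrow> 'k::field) \<Rightarrow> 'a poly poly \<Rightarrow> 'k \<Rightarrow> 'k \<Rightarrow> bool" where
  "plane_curve_function_field \<iota> f x z \<longleftrightarrow> field_embedding \<iota> \<and>
     (\<forall>g. eval2 \<iota> g x z = 0 \<longleftrightarrow> f dvd g) \<and>
     (\<forall>a. \<exists>g h. eval2 \<iota> h x z \<noteq> 0 \<and> a = eval2 \<iota> g x z / eval2 \<iota> h x z)"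

text \<open>The equation \<open>Z\<^sup>q - Z = X R(X)\<close>.\<close>

definition artin_schreier_poly :: "'a::field poly \<Rightarrow> nat \<Rightarrow> 'a poly poly" where
  "artin_schreier_poly R q = monom 1 q - monom 1 1 - [:monom 1 1 * R:]"

end

theory Submission
  imports Defs "HOL-Number_Theory.Residues" "HOL-Computational_Algebra.Computational_Algebra"
begin

text \<open>Put \<open>q = p\<^sup>r\<close>, \<open>Q = p\<^sub>0\<^sup>k\<close> and \<open>f = 2X\<^sup>p\<^sup>+\<^sup>1 + X\<^sup>2\<close>. The functions without poles outside the point at infinity are
  the polynomials in \<open>x\<close> and \<open>z\<close>, and their pole orders form the semigroup generated by \<open>q\<close> and \<open>p + 1\<close>;
  hence the genus is at least \<open>(q - 1)p/2\<close>. For a nontrivial additive character \<open>\<psi>\<close> of \<open>\<bbbF>\<^sub>Q\<close>, invariant under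
  Frobenius, the number of affine points is the sum of \<open>S(c) = \<Sum>\<^sub>a \<psi>(c f(a))\<close> over the \<open>c \<in> \<bbbF>\<^sub>Q\<close> with \<open>c\<^sup>q = c\<close>.
  Here \<open>S(0) = Q\<close> and \<open>\<bar>S(c)\<bar> \<le> p\<surd>Q\<close> for \<open>c \<noteq> 0\<close>, so a maximal curve needs \<open>\<bbbF>\<^sub>q \<subseteq> \<bbbF>\<^sub>Q\<close>, and thus \<open>4 dvd k\<close>,
  together with \<open>S(1) = p\<surd>Q\<close>. But either \<open>\<bar>S(1)\<bar> \<le> \<surd>Q\<close>, or \<open>S(1)\<close> is the quadratic Gauss sum of \<open>\<bbbF>\<^sub>Q\<close> times a
  sum of at most \<open>p\<close> roots of unity, one of which is \<open>1\<close>; the Gauss sum being \<open>-\<surd>Q\<close> for \<open>4 dvd k\<close>, the real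
  part of \<open>S(1)\<close> is smaller than \<open>p\<surd>Q\<close>.\<close>

section \<open>Homomorphisms and valuation rings\<close>

text \<open>Inequalities suffice: a larger genus only raises the number of points that maximality
  demands, so a lower bound for the genus and an upper bound for the number of points are
  contradictory as soon as one of them is strict. The obstacle is that the curve is the set of all
  valuation rings of a function field, with discreteness nowhere built in, while the genus takes
  orders at every one of them. So each ring has to be identified: a ring containing \<open>x\<close>
  is a localisation of \<open>k[x, z]\<close> at a nonzero prime, and a ring without
  \<open>x\<close> is the one defined by the pole order. In place of a Jacobian criterion,
  discreteness comes from Frobenius: for a suitable power \<open>M\<close> of \<open>q\<close>, some
  power map is the identity on \<open>k[x, z]\<close> modulo \<open>x^M - x\<close>, so this
  quotient has no nilpotents and \<open>x^M - x\<close> is a local parameter wherever it vanishes.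
  The divisibility of \<open>k\<close> by 4 starts at \<open>d\<close>: 4 divides \<open>d\<close>,
  \<open>d\<close> divides \<open>r\<close>, and a field with \<open>q\<close> elements inside one
  with \<open>Q\<close> elements forces \<open>m * r\<close> to divide \<open>k\<close>. That
  \<open>r\<close> is even also gives \<open>(p + 1) dvd (q - 1)\<close>, on which the analysis at
  infinity rests.\<close>

locale comm_hom =
  fixes \<phi> :: "'b::comm_ring_1 \<Rightarrow> 'c::comm_ring_1"
  assumes hom_add: "\<phi> (a + b) = \<phi> a + \<phi> b"
    and hom_mult: "\<phi> (a * b) = \<phi> a * \<phi> b"
    and hom_1: "\<phi> 1 = 1"
begin

lemma hom_0: "\<phi> 0 = 0"
  using hom_add[of 0 0] by simp

lemma hom_minus: "\<phi> (- a) = - \<phi> a"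
  using hom_add[of a "- a"] by (simp add: hom_0 eq_neg_iff_add_eq_0 add.commute)

lemma hom_diff: "\<phi> (a - b) = \<phi> a - \<phi> b"
  using hom_add[of a "- b"] by (simp add: hom_minus)

lemma hom_power: "\<phi> (a ^ n) = \<phi> a ^ n"
  by (induction n) (simp_all add: hom_1 hom_mult)

lemma hom_sum: "\<phi> (\<Sum>i\<in>I. g i) = (\<Sum>i\<in>I. \<phi> (g i))"
  by (induction I rule: infinite_finite_induct) (simp_all add: hom_0 hom_add)

lemma hom_of_nat: "\<phi> (of_nat n) = of_nat n"
  by (induction n) (simp_all add: hom_0 hom_1 hom_add)

lemma hom_numeral: "\<phi> (numeral n) = numeral n"
  using hom_of_nat[of "numeral n"] by simp

lemma poly_map_hom_pCons: "poly (map_poly \<phi> (pCons a h)) v = \<phi> a + v * poly (map_poly \<phi> h) v"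
  by (simp add: map_poly_pCons hom_0)

lemma poly_map_hom_add:
  "poly (map_poly \<phi> (g + h)) v = poly (map_poly \<phi> g) v + poly (map_poly \<phi> h) v"
  by (induction g h rule: poly_induct2)
    (simp_all add: poly_map_hom_pCons hom_0 hom_add algebra_simps)

lemma poly_map_hom_smult: "poly (map_poly \<phi> (smult a h)) v = \<phi> a * poly (map_poly \<phi> h) v"
  by (induction h) (simp_all add: poly_map_hom_pCons hom_0 hom_mult algebra_simps)

lemma poly_map_hom_mult:
  "poly (map_poly \<phi> (g * h)) v = poly (map_poly \<phi> g) v * poly (map_poly \<phi> h) v"
  by (induction g)
    (simp_all add: poly_map_hom_pCons poly_map_hom_add poly_map_hom_smult hom_0 algebra_simps)

lemma comm_hom_poly_map: "comm_hom (\<lambda>h. poly (map_poly \<phi> h) v)"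
proof
  show "poly (map_poly \<phi> 1) v = 1"
    using poly_map_hom_pCons[of 1 0 v] by (simp add: hom_1 one_pCons)
qed (simp_all add: poly_map_hom_add poly_map_hom_mult)

lemma poly_map_hom_const: "poly (map_poly \<phi> [:a:]) v = \<phi> a"
  by (simp add: poly_map_hom_pCons hom_0)

lemma poly_map_hom_monom: "poly (map_poly \<phi> (monom a n)) v = \<phi> a * v ^ n"
  by (simp add: map_poly_monom hom_0 poly_monom)

end

lemma field_embedding_comm_hom: "field_embedding \<iota> \<Longrightarrow> comm_hom \<iota>"
  by (simp add: field_embedding_def comm_hom_def)

locale closed_point =
  fixes \<iota> :: "'a::field \<Rightarrow> 'k::field" and \<O> :: "'k set"
  assumes embedding: "field_embedding \<iota>" and closed: "\<O> \<in> closed_points \<iota>"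
begin

lemma range_subset: "\<iota> c \<in> \<O>"
  and proper: "\<O> \<noteq> UNIV"
  and diff_closed: "a \<in> \<O> \<Longrightarrow> b \<in> \<O> \<Longrightarrow> a - b \<in> \<O>"
  and mult_closed: "a \<in> \<O> \<Longrightarrow> b \<in> \<O> \<Longrightarrow> a * b \<in> \<O>"
  and inverse_cases: "a \<in> \<O> \<or> inverse a \<in> \<O>"
  using closed by (auto simp: closed_points_def)

lemma zero_closed: "0 \<in> \<O>"
  using diff_closed[OF range_subset[of 0] range_subset[of 0]] by simp

lemma one_closed: "1 \<in> \<O>"
  using range_subset[of 1] embedding by (simp add: field_embedding_def)

lemma minus_closed: "a \<in> \<O> \<Longrightarrow> - a \<in> \<O>"
  using diff_closed[OF zero_closed] by simp

lemma add_closed: "a \<in> \<O> \<Longrightarrow> b \<in> \<O> \<Longrightarrow> a + b \<in> \<O>"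
  using diff_closed[of a "- b"] minus_closed[of b] by simp

lemma power_closed: "a \<in> \<O> \<Longrightarrow> a ^ n \<in> \<O>"
  by (induction n) (simp_all add: one_closed mult_closed)

lemma max_ideal_iff: "a \<in> max_ideal \<O> \<longleftrightarrow> a \<in> \<O> \<and> (a = 0 \<or> inverse a \<notin> \<O>)"
  by (auto simp: max_ideal_def unit_set_def)

lemma unit_iff: "a \<in> unit_set \<O> \<longleftrightarrow> a \<in> \<O> \<and> a \<notin> max_ideal \<O>"
  by (auto simp: max_ideal_def unit_set_def)

lemma unit_nonzero: "a \<in> unit_set \<O> \<Longrightarrow> a \<noteq> 0"
  by (auto simp: unit_set_def)

lemma unit_mult: "a \<in> unit_set \<O> \<Longrightarrow> b \<in> unit_set \<O> \<Longrightarrow> a * b \<in> unit_set \<O>"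
  by (auto simp: unit_set_def mult_closed)

lemma unit_inverse: "a \<in> unit_set \<O> \<Longrightarrow> inverse a \<in> unit_set \<O>"
  by (auto simp: unit_set_def)

lemma unit_power: "a \<in> unit_set \<O> \<Longrightarrow> a ^ n \<in> unit_set \<O>"
  by (auto simp: unit_set_def power_closed simp flip: power_inverse)

lemma max_ideal_mult: assumes "a \<in> max_ideal \<O>" "b \<in> \<O>" shows "a * b \<in> max_ideal \<O>"
proof (rule ccontr)
  assume *: "a * b \<notin> max_ideal \<O>"
  with assms have ab: "a * b \<noteq> 0" "inverse (a * b) \<in> \<O>"
    by (auto simp: max_ideal_iff mult_closed)
  hence "b * inverse (a * b) = inverse a" by (simp add: field_simps)
  moreover have "b * inverse (a * b) \<in> \<O>" using assms(2) ab(2) by (rule mult_closed)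
  ultimately have "inverse a \<in> \<O>" by (simp only:)
  thus False using assms(1) ab(1) by (auto simp: max_ideal_iff)
qed

lemma max_ideal_zero: "0 \<in> max_ideal \<O>"
  by (simp add: max_ideal_iff zero_closed)

text \<open>One of \<open>a / b\<close> and \<open>b / a\<close> lies in the valuation ring, so the
  sum is one of the summands times an element of the ring.\<close>

lemma max_ideal_add: assumes "a \<in> max_ideal \<O>" "b \<in> max_ideal \<O>" shows "a + b \<in> max_ideal \<O>"
proof -
  have *: "a + b \<in> max_ideal \<O>" if "a \<in> max_ideal \<O>" "b \<in> max_ideal \<O>" "b \<noteq> 0" "a / b \<in> \<O>" for a b
  proof -
    have "b * (a / b + 1) \<in> max_ideal \<O>"
      using that by (intro max_ideal_mult add_closed one_closed)
    with that(3) show ?thesis by (simp add: distrib_left)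
  qed
  show ?thesis
    using *[of a b] *[of b a] assms inverse_cases[of "a / b"]
    by (cases "a = 0"; cases "b = 0") (auto simp: add.commute)
qed

lemma max_ideal_minus: "a \<in> max_ideal \<O> \<Longrightarrow> - a \<in> max_ideal \<O>"
  using max_ideal_mult[of a "- 1"] minus_closed[OF one_closed] by simp

lemma max_ideal_diff: "a \<in> max_ideal \<O> \<Longrightarrow> b \<in> max_ideal \<O> \<Longrightarrow> a - b \<in> max_ideal \<O>"
  using max_ideal_add[OF _ max_ideal_minus, of a b] by simp

lemma one_notin_max_ideal: "1 \<notin> max_ideal \<O>"
  by (simp add: max_ideal_iff one_closed)

lemma max_ideal_subset: "a \<in> max_ideal \<O> \<Longrightarrow> a \<in> \<O>"
  by (simp add: max_ideal_iff)

lemma max_ideal_prime: "a \<in> \<O> \<Longrightarrow> b \<in> \<O> \<Longrightarrow> a * b \<in> max_ideal \<O> \<Longrightarrow> a \<in> max_ideal \<O> \<or> b \<in> max_ideal \<O>"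
  using unit_mult[of a b] by (auto simp: unit_iff)

lemma max_ideal_power: "a \<in> \<O> \<Longrightarrow> a ^ n \<in> max_ideal \<O> \<Longrightarrow> a \<in> max_ideal \<O>"
  using unit_power[of a n] by (auto simp: unit_iff)

lemma notin_imp_inverse: "a \<notin> \<O> \<Longrightarrow> inverse a \<in> max_ideal \<O>"
  using inverse_cases[of a] by (auto simp: max_ideal_iff)

lemma unit_plus_max_ideal: "a \<in> unit_set \<O> \<Longrightarrow> b \<in> max_ideal \<O> \<Longrightarrow> a + b \<in> unit_set \<O>"
  using max_ideal_diff[of "a + b" b] by (auto simp: unit_iff add_closed max_ideal_subset)

end

text \<open>\<open>closed_points\<close> asks only for valuation rings. The assumption
  \<open>decomp\<close> expresses discreteness, on which \<open>ord_at\<close> relies; it is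
  established separately for the affine points and for the point at infinity.\<close>

locale local_parameter = closed_point +
  fixes t
  assumes t_max: "t \<in> max_ideal \<O>" and t_nonzero: "t \<noteq> 0"
    and decomp: "a \<noteq> 0 \<Longrightarrow> \<exists>n u. u \<in> unit_set \<O> \<and> a = t powi n * u"
begin

lemma powi_max_ideal: assumes "n > 0" shows "t powi n \<in> max_ideal \<O>"
proof -
  obtain m where "n = int (Suc m)" using assms by (metis pos_int_cases gr0_conv_Suc)
  hence "t powi n = t * t ^ m" by (simp only: power_int_of_nat power_Suc)
  thus ?thesis using max_ideal_mult[OF t_max power_closed[OF max_ideal_subset[OF t_max]]] by simp
qed

lemma powi_mult_unit_iff:
  assumes "u \<in> unit_set \<O>"
  shows "t powi n * u \<in> \<O> \<longleftrightarrow> n \<ge> 0" "t powi n * u \<in> max_ideal \<O> \<longleftrightarrow> n > 0"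
    "t powi n * u \<in> unit_set \<O> \<longleftrightarrow> n = 0"
proof -
  have pos: "t powi n * u \<in> max_ideal \<O>" if "n > 0" "u \<in> unit_set \<O>" for n u
    using that powi_max_ideal max_ideal_mult by (auto simp: unit_set_def)
  have neg: "t powi n * u \<notin> \<O>" if "n < 0"
  proof
    assume "t powi n * u \<in> \<O>"
    moreover have "t powi (-n) * inverse u \<in> max_ideal \<O>"
      using that assms by (intro pos unit_inverse) auto
    hence "inverse (t powi n * u) \<in> max_ideal \<O>" by (simp add: power_int_minus)
    moreover have "t powi n * u \<noteq> 0"
      using t_nonzero unit_nonzero[OF assms] by simp
    ultimately show False
      unfolding max_ideal_iff inverse_inverse_eq inverse_nonzero_iff_nonzero by blast
  qed
  have zero: "t powi n * u \<in> unit_set \<O>" if "n = 0" using that assms by simp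
  show "t powi n * u \<in> \<O> \<longleftrightarrow> n \<ge> 0" "t powi n * u \<in> max_ideal \<O> \<longleftrightarrow> n > 0"
    "t powi n * u \<in> unit_set \<O> \<longleftrightarrow> n = 0"
    using pos[OF _ assms, of n] neg zero
    by (cases n "0::int" rule: linorder_cases; auto simp: unit_iff dest: max_ideal_subset)+
qed

lemma max_ideal_eq: "max_ideal \<O> = (\<lambda>b. t * b) ` \<O>"
proof (intro equalityI subsetI)
  fix a assume a: "a \<in> max_ideal \<O>"
  show "a \<in> (\<lambda>b. t * b) ` \<O>"
  proof (cases "a = 0")
    case True thus ?thesis using zero_closed by force
  next
    case False
    then obtain n u where u: "u \<in> unit_set \<O>" "a = t powi n * u" using decomp by blast
    with a have "n > 0" by (simp add: powi_mult_unit_iff)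
    hence "t powi (n - 1) * u \<in> \<O>" by (simp add: powi_mult_unit_iff u)
    moreover have "t powi n = t * t powi (n - 1)" 
      using t_nonzero power_int_add[of t 1 "n - 1"] by simp
    hence "a = t * (t powi (n - 1) * u)" using u by simp
    ultimately show ?thesis by blast
  qed
qed (use max_ideal_mult t_max in auto)

text \<open>\<open>ord_at\<close> quantifies over all generators of the maximal ideal. Two
  generators differ by a unit factor, so the exponent does not depend on the choice.\<close>

lemma ord_at_eq:
  assumes u: "u \<in> unit_set \<O>"
  shows "ord_at \<O> (t powi n * u) = n"
  unfolding ord_at_def
proof (rule the_equality)
  show "\<exists>s v. max_ideal \<O> = (\<lambda>b. s * b) ` \<O> \<and> v \<in> unit_set \<O> \<and> t powi n * u = s powi n * v"
    using max_ideal_eq u by blast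
next
  fix m assume "\<exists>s v. max_ideal \<O> = (\<lambda>b. s * b) ` \<O> \<and> v \<in> unit_set \<O> \<and> t powi n * u = s powi m * v"
  then obtain s v where s: "max_ideal \<O> = (\<lambda>b. s * b) ` \<O>" and v: "v \<in> unit_set \<O>"
    and eq: "t powi n * u = s powi m * v" by blast
  from s t_max obtain b where b: "b \<in> \<O>" "t = s * b" by auto
  from s max_ideal_eq one_closed have "s \<in> (\<lambda>b. t * b) ` \<O>" by force
  then obtain c where c: "c \<in> \<O>" "s = t * c" by auto
  have bc: "c * b = 1" using b c t_nonzero by (metis mult.assoc mult_cancel_left1)
  hence "c \<noteq> 0" "inverse c = b" by (auto simp: inverse_unique)
  hence cu: "c \<in> unit_set \<O>" using b c by (simp add: unit_set_def)
  have "c powi m \<in> unit_set \<O>"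
    using cu unit_inverse[OF cu] by (auto simp: power_int_def intro: unit_power)
  hence w: "c powi m * v * inverse u \<in> unit_set \<O>" using v u by (intro unit_mult unit_inverse)
  have u0: "u \<noteq> 0" using u by (rule unit_nonzero)
  have e: "t powi n * u = t powi m * (c powi m * v)"
    using eq by (simp add: c power_int_mult_distrib mult.assoc)
  hence "t powi m * (c powi m * v) * inverse u = t powi n * (u * inverse u)"
    by (simp only: e[symmetric] mult.assoc)
  hence "t powi (m - n) * (c powi m * v * inverse u) = 1"
    using t_nonzero u0 unfolding power_int_diff[OF disjI1[OF t_nonzero]]
    by (simp add: divide_simps mult.assoc)
  moreover have "1 \<in> unit_set \<O>" using one_notin_max_ideal one_closed by (simp add: unit_iff)
  ultimately have "m - n = 0" using powi_mult_unit_iff(3)[OF w] by metis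
  thus "m = n" by simp
qed

lemma ord_at_nonneg_iff: "a \<noteq> 0 \<Longrightarrow> ord_at \<O> a \<ge> 0 \<longleftrightarrow> a \<in> \<O>"
  using decomp[of a] by (auto simp: ord_at_eq powi_mult_unit_iff)

end

section \<open>The affine coordinate ring\<close>

lemma of_nat_power_CHAR_power:
  assumes "prime CHAR('b::comm_ring_1)"
  shows "(of_nat n :: 'b) ^ (CHAR('b) ^ j) = of_nat n"
proof (induction n)
  case 0
  have "CHAR('b) ^ j \<noteq> 0" using assms by auto
  thus ?case by (simp only: of_nat_0 power_0_left if_False)
next
  case (Suc n)
  have "(of_nat n + 1 :: 'b) ^ (CHAR('b) ^ j) = of_nat n ^ (CHAR('b) ^ j) + 1 ^ (CHAR('b) ^ j)"
    by (rule freshmans_dream'[OF assms refl])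
  with Suc show ?case by (simp add: add.commute)
qed

lemma diff_power_CHAR_power:
  fixes a b :: "'b::comm_ring_1"
  assumes "prime CHAR('b)"
  shows "(a - b) ^ (CHAR('b) ^ j) = a ^ (CHAR('b) ^ j) - b ^ (CHAR('b) ^ j)"
  using freshmans_dream'[OF assms refl, of "a - b" b j] by (simp add: algebra_simps)

lemma CHAR_eq_prime_CARD:
  assumes "CARD('a::field) = l" "prime l"
  shows "CHAR('a) = l"
proof -
  have "CHAR('a) dvd l" using CHAR_dvd_CARD[where 'a = 'a] assms by simp
  moreover have "CHAR('a) \<noteq> 1" using CHAR_not_1' by auto
  ultimately show ?thesis using assms(2) by (auto simp: prime_nat_iff)
qed

lemma inj_on_of_nat_CHAR: "inj_on (of_nat :: nat \<Rightarrow> 'b::comm_ring_1) {..<CHAR('b)}"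
  by (auto simp: inj_on_def of_nat_eq_iff_cong_CHAR cong_def)

lemma prime_CARD_of_nat:
  assumes "CARD('a::field) = l" "prime l"
  obtains n where "(c :: 'a) = of_nat n"
proof -
  have fin: "finite (UNIV :: 'a set)"
    using assms card_ge_0_finite[of "UNIV :: 'a set"] prime_gt_0_nat[OF assms(2)] by simp
  have "inj_on (of_nat :: nat \<Rightarrow> 'a) {..<l}"
    using inj_on_of_nat_CHAR[where 'b = 'a] unfolding CHAR_eq_prime_CARD[OF assms] .
  hence "card ((of_nat :: nat \<Rightarrow> 'a) ` {..<l}) = l" by (simp add: card_image)
  hence "(of_nat :: nat \<Rightarrow> 'a) ` {..<l} = UNIV"
    using assms(1) fin by (intro card_subset_eq) simp_all
  thus ?thesis using that by blast
qed

lemma CHAR_comm_hom: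
  assumes "comm_hom (\<phi> :: 'b::field \<Rightarrow> 'c::field)"
  shows "CHAR('c) = CHAR('b)"
proof -
  interpret comm_hom \<phi> by fact
  have "\<phi> a = 0 \<longleftrightarrow> a = 0" for a
    using hom_mult[of a "inverse a"] by (cases "a = 0") (auto simp: hom_0 hom_1)
  hence "(of_nat n :: 'c) = 0 \<longleftrightarrow> (of_nat n :: 'b) = 0" for n
    using hom_of_nat[of n] by metis
  hence "CHAR('b) dvd n \<longleftrightarrow> CHAR('c) dvd n" for n
    by (simp add: of_nat_eq_0_iff_char_dvd)
  thus ?thesis using dvd_antisym dvd_refl by metis
qed

lemma finite_polys_degree_less:
  assumes "finite (UNIV :: 'a::zero set)"
  shows "finite {h :: 'a poly. h = 0 \<or> degree h < n}"
proof -
  have "{h :: 'a poly. h = 0 \<or> degree h < n} \<subseteq> Poly ` {l. set l \<subseteq> UNIV \<and> length l \<le> n}"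
  proof
    fix h :: "'a poly" assume "h \<in> {h. h = 0 \<or> degree h < n}"
    hence "length (coeffs h) \<le> n" by (cases "h = 0") (auto simp: length_coeffs_degree)
    thus "h \<in> Poly ` {l. set l \<subseteq> UNIV \<and> length l \<le> n}"
      by (intro image_eqI[of _ _ "coeffs h"]) auto
  qed
  thus ?thesis using finite_lists_length_le[OF assms] finite_subset by blast
qed

text \<open>The polynomial \<open>F\<close> stays arbitrary up to the study of infinity: the
  derivative of the equation with respect to Z is -1, so the affine curve is smooth whatever the
  right-hand side is.\<close>

locale artin_schreier_curve =
  fixes \<iota> :: "'a::field \<Rightarrow> 'k::field" and p\<^sub>0 e q :: nat and F :: "'a poly" and x z :: 'k
  assumes prime_p0: "prime p\<^sub>0" and CARD_base: "CARD('a) = p\<^sub>0"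
    and e_pos: "e > 0" and q_eq: "q = p\<^sub>0 ^ e"
    and function_field: "plane_curve_function_field \<iota> (monom 1 q - monom 1 1 - [:F:]) x z"
begin

definition eqn :: "'a poly poly" where "eqn = monom 1 q - monom 1 1 - [:F:]"

definition ev :: "'a poly poly \<Rightarrow> 'k" where "ev g = eval2 \<iota> g x z"

definition hx :: "'a poly \<Rightarrow> 'k" where "hx h = poly (map_poly \<iota> h) x"

text \<open>The affine coordinate ring k[x, z] inside its field of fractions.\<close>

definition A :: "'k set" where "A = range ev"

lemma embedding: "field_embedding \<iota>"
  using function_field by (simp add: plane_curve_function_field_def)

sublocale iota: comm_hom \<iota>
  using embedding by (rule field_embedding_comm_hom)

sublocale hx: comm_hom hx
  unfolding hx_def by (rule iota.comm_hom_poly_map)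

lemma ev_alt: "ev g = poly (map_poly hx g) z"
  unfolding ev_def eval2_def hx_def ..

sublocale ev: comm_hom ev
  unfolding ev_alt by (rule hx.comm_hom_poly_map)

lemma ev_const [simp]: "ev [:h:] = hx h"
  by (simp add: ev_alt hx.poly_map_hom_const)

lemma hx_const [simp]: "hx [:c:] = \<iota> c"
  by (simp add: hx_def iota.poly_map_hom_const)

lemma hx_monom: "hx (monom c n) = \<iota> c * x ^ n"
  by (simp add: hx_def iota.poly_map_hom_monom)

lemma ev_monom: "ev (monom h n) = hx h * z ^ n"
  by (simp add: ev_alt hx.poly_map_hom_monom)

lemma ev_smult: "ev (smult h g) = hx h * ev g"
  by (simp add: ev_alt hx.poly_map_hom_smult)

lemma hx_pCons: "hx (pCons c h) = \<iota> c + x * hx h"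
  by (simp add: hx_def iota.poly_map_hom_pCons)

lemma ev_pCons: "ev (pCons h g) = hx h + z * ev g"
  by (simp add: ev_alt hx.poly_map_hom_pCons)

lemma ev_eq_0_iff: "ev g = 0 \<longleftrightarrow> eqn dvd g"
  using function_field unfolding plane_curve_function_field_def ev_def eqn_def by blast

lemma fraction: "\<exists>g h. ev h \<noteq> 0 \<and> a = ev g / ev h"
  using function_field unfolding plane_curve_function_field_def ev_def by blast

lemma CHAR_base: "CHAR('a) = p\<^sub>0"
  using CARD_base prime_p0 by (rule CHAR_eq_prime_CARD)

lemma CHAR_K: "CHAR('k) = p\<^sub>0"
  using CHAR_comm_hom[OF iota.comm_hom_axioms] CHAR_base by simp

lemma finite_base: "finite (UNIV :: 'a set)"
  using CARD_base prime_gt_0_nat[OF prime_p0] card_ge_0_finite[of "UNIV :: 'a set"] by simp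

lemma iota_power: "\<iota> c ^ (p\<^sub>0 ^ j) = \<iota> c"
proof -
  obtain n where "c = of_nat n" using prime_CARD_of_nat[OF CARD_base prime_p0] .
  thus ?thesis using of_nat_power_CHAR_power[where 'b = 'k, of n j] prime_p0
    by (simp add: iota.hom_of_nat CHAR_K)
qed

lemma power_add_K: "((a :: 'k) + b) ^ (p\<^sub>0 ^ j) = a ^ (p\<^sub>0 ^ j) + b ^ (p\<^sub>0 ^ j)"
  using freshmans_dream'[where 'a = 'k, of _ j a b] prime_p0 by (simp add: CHAR_K)

lemma power_diff_K: "((a :: 'k) - b) ^ (p\<^sub>0 ^ j) = a ^ (p\<^sub>0 ^ j) - b ^ (p\<^sub>0 ^ j)"
  using diff_power_CHAR_power[where 'b = 'k, of a b j] prime_p0 by (simp add: CHAR_K)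

lemma q_gt_1: "q > 1"
  using e_pos prime_gt_1_nat[OF prime_p0] unfolding q_eq by (intro one_less_power)

lemma degree_eqn: "degree eqn = q" and coeff_eqn: "coeff eqn q = 1"
proof -
  have "degree (monom (1 :: 'a poly) 1 + [:F:]) < q"
    using degree_add_le[of "monom (1 :: 'a poly) 1" 1 "[:F:]"] q_gt_1 degree_monom_le[of "1 :: 'a poly" 1]
    by simp
  hence *: "degree (- (monom (1 :: 'a poly) 1 + [:F:])) < degree (monom (1 :: 'a poly) q)"
    by (simp only: degree_minus degree_monom_eq one_neq_zero not_False_eq_True)
  have "eqn = - (monom 1 1 + [:F:]) + monom 1 q" by (simp add: eqn_def)
  thus "degree eqn = q" using degree_add_eq_right[OF *] by (simp add: degree_monom_eq)
  show "coeff eqn q = 1" using q_gt_1 by (simp add: eqn_def coeff_pCons split: nat.splits)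
qed

lemma eqn_nonzero: "eqn \<noteq> 0"
  using coeff_eqn by auto

lemma degree_multiple_eqn: assumes "eqn dvd g" "g \<noteq> 0" shows "degree g \<ge> q"
proof -
  obtain s where "g = eqn * s" using assms(1) by (rule dvdE)
  with assms(2) have "degree g = degree eqn + degree s" by (simp add: degree_mult_eq)
  thus ?thesis by (simp add: degree_eqn)
qed

text \<open>The multiples of \<open>eqn\<close> are the kernel of \<open>ev\<close>, whose values
  lie in a field.\<close>

lemma eqn_prime: "eqn dvd g * h \<Longrightarrow> eqn dvd g \<or> eqn dvd h"
  by (simp add: ev.hom_mult flip: ev_eq_0_iff)

text \<open>The powers of z below the q-th are independent over k[x], because a nonzero multiple of
  \<open>eqn\<close> has degree at least \<open>q\<close> in Z.\<close>

lemma ev_inj: assumes "degree g < q" "degree h < q" "ev g = ev h" shows "g = h"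
  using degree_multiple_eqn[of "g - h"] assms degree_diff_le_max[of g h]
  by (fastforce simp: ev.hom_diff simp flip: ev_eq_0_iff)

lemma hx_eq_0_iff [simp]: "hx h = 0 \<longleftrightarrow> h = 0"
proof
  assume "hx h = 0"
  hence "ev [:h:] = ev 0" by (simp add: ev.hom_0)
  hence "[:h:] = 0" by (rule ev_inj[rotated -1]) (use q_gt_1 in auto)
  thus "h = 0" by simp
qed (simp add: hx.hom_0)

lemma ev_reduced_exists: "\<exists>g'. degree g' < q \<and> ev g' = ev g"
proof -
  \<comment> \<open>The leading coefficient of \<open>eqn\<close> is 1, so this pseudo-division is
    an ordinary division with remainder.\<close>
  obtain s r where sr: "pseudo_divmod g eqn = (s, r)" by (cases "pseudo_divmod g eqn")
  have "g = eqn * s + r" "r = 0 \<or> degree r < q"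
    using pseudo_divmod[OF eqn_nonzero sr] by (simp_all only: degree_eqn coeff_eqn power_one smult_1_left) 
  moreover have "ev (eqn * s) = 0" by (simp only: ev_eq_0_iff dvd_triv_left)
  ultimately have "ev r = ev g" "degree r < q" using q_gt_1 by (auto simp: ev.hom_add)
  thus ?thesis by blast
qed

lemma A_add: "a \<in> A \<Longrightarrow> b \<in> A \<Longrightarrow> a + b \<in> A"
  by (auto simp: A_def simp flip: ev.hom_add)

lemma A_mult: "a \<in> A \<Longrightarrow> b \<in> A \<Longrightarrow> a * b \<in> A"
  by (auto simp: A_def simp flip: ev.hom_mult)

lemma A_diff: "a \<in> A \<Longrightarrow> b \<in> A \<Longrightarrow> a - b \<in> A"
  by (auto simp: A_def simp flip: ev.hom_diff)

lemma A_power: "a \<in> A \<Longrightarrow> a ^ n \<in> A"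
  by (auto simp: A_def simp flip: ev.hom_power)

lemma hx_in_A: "hx h \<in> A"
  using ev_const[of h] unfolding A_def by (metis rangeI)

lemma iota_in_A: "\<iota> c \<in> A"
  using hx_in_A[of "[:c:]"] by simp

lemma one_in_A: "1 \<in> A"
  using iota_in_A[of 1] by (simp add: iota.hom_1)

lemma zero_in_A: "0 \<in> A"
  using iota_in_A[of 0] by (simp add: iota.hom_0)

lemma x_in_A: "x \<in> A"
  using hx_in_A[of "monom 1 1"] by (simp add: hx_monom iota.hom_1)

lemma z_in_A: "z \<in> A"
  using rangeI[of ev "monom 1 1"] by (simp add: A_def ev_monom hx.hom_1)

lemma A_subring:
  assumes "\<And>c. \<iota> c \<in> S" "x \<in> S" "z \<in> S" "\<And>a b. a \<in> S \<Longrightarrow> b \<in> S \<Longrightarrow> a + b \<in> S"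
    "\<And>a b. a \<in> S \<Longrightarrow> b \<in> S \<Longrightarrow> a * b \<in> S"
  shows "A \<subseteq> S"
proof -
  have 0: "0 \<in> S" using assms(1)[of 0] by (simp add: iota.hom_0)
  have 1: "hx h \<in> S" for h
    by (induction h) (auto simp: hx_pCons hx.hom_0 0 intro!: assms)
  have "ev g \<in> S" for g
    by (induction g) (auto simp: ev_pCons ev.hom_0 0 1 intro!: assms)
  thus ?thesis unfolding A_def by blast
qed

lemma z_power_q: "z ^ q = z + hx F"
proof -
  have "ev eqn = 0" by (simp add: ev_eq_0_iff)
  thus ?thesis by (simp add: eqn_def ev.hom_diff ev.hom_add ev_monom hx.hom_1 algebra_simps)
qed

text \<open>Euclid's algorithm over \<open>k(X)\<close>, applied to \<open>g\<close> and the prime element \<open>eqn\<close>.\<close>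

lemma ex_norm:
  assumes "y \<in> A" "y \<noteq> 0"
  shows "\<exists>y'\<in>A. \<exists>h. h \<noteq> 0 \<and> y * y' = hx h"
proof -
  obtain g where g: "y = ev g" using assms(1) unfolding A_def by blast
  with assms(2) have ndvd: "\<not> eqn dvd g" by (simp flip: ev_eq_0_iff)
  \<comment> \<open>An element of least degree in Z in the ideal generated by \<open>g\<close> and
    \<open>eqn\<close> plays the part of their greatest common divisor over k(X).\<close>
  define I where "I = {r. r \<noteq> 0 \<and> (\<exists>u v. r = g * u + eqn * v)}"
  have "g = g * 1 + eqn * 0" "g \<noteq> 0" using ndvd by auto
  hence "g \<in> I" unfolding I_def by blast
  then obtain r where r: "r \<in> I" and min: "\<And>s. s \<in> I \<Longrightarrow> degree r \<le> degree s"
    using ex_has_least_nat[of "\<lambda>r. r \<in> I" g degree] by blast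
  from r obtain u v where uv: "r = g * u + eqn * v" and r0: "r \<noteq> 0" by (auto simp: I_def)
  \<comment> \<open>The pseudo-remainder lies in the ideal and has smaller degree than
    \<open>r\<close>, so by minimality it is 0: up to a factor from k[X], \<open>r\<close> divides
    the whole ideal.\<close>
  have div: "\<exists>a s. a \<noteq> 0 \<and> smult a w = r * s" if w: "\<exists>u' v'. w = g * u' + eqn * v'" for w
  proof -
    obtain u' v' where w: "w = g * u' + eqn * v'" using w by blast
    obtain a s where as: "a \<noteq> 0" "smult a w = r * s + pseudo_mod w r"
      using pseudo_mod(1)[OF r0] by blast
    have "pseudo_mod w r = smult a w - r * s" using as(2) by simp
    also have "\<dots> = g * (smult a u' - u * s) + eqn * (smult a v' - v * s)"
      unfolding w uv by (simp add: algebra_simps smult_add_right)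
    finally have "pseudo_mod w r = 0 \<or> pseudo_mod w r \<in> I" by (auto simp: I_def)
    with pseudo_mod(2)[OF r0, of w] min have "pseudo_mod w r = 0" by force
    with as show ?thesis by auto
  qed
  have nc: "\<not> eqn dvd [:a:]" if "a \<noteq> 0" for a
    using degree_multiple_eqn[of "[:a:]"] that q_gt_1 by auto
  have nr: "\<not> eqn dvd r"
  proof
    assume "eqn dvd r"
    obtain a s where "a \<noteq> 0" "smult a g = r * s"
      using div[of g] by (metis add.right_neutral mult.right_neutral mult_zero_right)
    hence "eqn dvd [:a:] * g" using \<open>eqn dvd r\<close> by simp
    with eqn_prime nc[OF \<open>a \<noteq> 0\<close>] ndvd show False by blast
  qed
  \<comment> \<open>Now the same divisibility is applied to \<open>eqn\<close>. Being prime and not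
    dividing \<open>r\<close>, it divides the cofactor \<open>s\<close>; after cancellation
    \<open>r\<close> divides a nonzero element of k[X] and so has degree 0 in Z.\<close>
  obtain a s where as: "a \<noteq> 0" "smult a eqn = r * s"
    using div[of eqn] by (metis add.left_neutral mult.right_neutral mult_zero_right)
  hence "eqn dvd r * s" by (metis dvd_smult dvd_refl)
  hence "eqn dvd s" using eqn_prime nr by blast
  then obtain s' where s': "s = eqn * s'" by (rule dvdE)
  have "eqn * [:a:] = eqn * (r * s')" using as(2) unfolding s' by (simp add: algebra_simps)
  hence ars: "[:a:] = r * s'" using eqn_nonzero by (simp only: mult_cancel_left) simp
  with as(1) have "s' \<noteq> 0" by auto
  hence "degree [:a:] = degree r + degree s'" unfolding ars using r0 by (intro degree_mult_eq)
  hence "degree r = 0" by simp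
  then obtain c where c: "r = [:c:]" by (rule degree_eq_zeroE)
  have "ev r = y * ev u"
    unfolding uv ev.hom_add ev.hom_mult g using ev_eq_0_iff[of eqn] by simp
  hence "y * ev u = hx c" "c \<noteq> 0" using r0 by (simp_all add: c)
  thus ?thesis unfolding A_def by blast
qed

text \<open>Expanding the fraction by the cofactor from \<open>ex_norm\<close> moves the denominator
  into k[x].\<close>

lemma fraction_hx: "\<exists>y\<in>A. \<exists>h. h \<noteq> 0 \<and> a = y / hx h"
proof -
  obtain g d where gd: "ev d \<noteq> 0" "a = ev g / ev d" using fraction by blast
  obtain d' h where d': "d' \<in> A" "h \<noteq> 0" "ev d * d' = hx h" using ex_norm[of "ev d"] gd(1) unfolding A_def by blast
  have "d' \<noteq> 0" using d'(2,3) by auto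
  hence "a = (ev g * d') / hx h" using gd(2) by (simp flip: d'(3))
  moreover have "ev g * d' \<in> A" using d'(1) by (intro A_mult) (simp_all add: A_def)
  ultimately show ?thesis using d'(2) by blast
qed

end

text \<open>A nonzero prime ideal of the coordinate ring. It arises in two ways: as the centre of a
  valuation ring containing x, and as the ideal of functions vanishing at a geometric point.\<close>

locale artin_schreier_prime = artin_schreier_curve +
  fixes P :: "'b set"
  assumes P_subset: "P \<subseteq> A"
    and P_add: "a \<in> P \<Longrightarrow> b \<in> P \<Longrightarrow> a + b \<in> P"
    and P_mult: "a \<in> P \<Longrightarrow> b \<in> A \<Longrightarrow> a * b \<in> P"
    and P_prime: "a \<in> A \<Longrightarrow> b \<in> A \<Longrightarrow> a * b \<in> P \<Longrightarrow> a \<in> P \<or> b \<in> P"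
    and one_notin_P: "1 \<notin> P"
    and P_nonzero: "\<exists>a\<in>P. a \<noteq> 0"
begin

lemma zero_in_P: "0 \<in> P"
  using P_nonzero P_mult[OF _ zero_in_A] by auto

lemma P_minus: "a \<in> P \<Longrightarrow> - a \<in> P"
  using P_mult[of a "- 1"] A_diff[OF zero_in_A one_in_A] by simp

lemma P_diff: "a \<in> P \<Longrightarrow> b \<in> P \<Longrightarrow> a - b \<in> P"
  using P_add[of a "- b"] P_minus[of b] by simp

lemma P_mult': "a \<in> P \<Longrightarrow> b \<in> A \<Longrightarrow> b * a \<in> P"
  using P_mult[of a b] by (simp add: mult.commute)

lemma P_power: "a \<in> A \<Longrightarrow> a ^ n \<in> P \<Longrightarrow> a \<in> P"
proof (induction n)
  case (Suc n)
  thus ?case using P_prime[of a "a ^ n"] A_power[of a n] by auto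
qed (simp add: one_notin_P)

lemma ex_poly_in_P: "\<exists>h. h \<noteq> 0 \<and> hx h \<in> P"
proof -
  obtain a where a: "a \<in> P" "a \<noteq> 0" using P_nonzero by blast
  hence "a \<in> A" using P_subset by blast
  then obtain y' h where "y' \<in> A" "h \<noteq> 0" "a * y' = hx h" using ex_norm[OF _ a(2)] by blast
  thus ?thesis using P_mult[OF a(1)] by metis
qed

text \<open>The intersection with k[x] is principal, generated by an element of least degree; this
  degree is positive because nonzero constants are units.\<close>

lemma ex_generator:
  obtains \<pi> where "\<pi> \<noteq> 0" "hx \<pi> \<in> P" "degree \<pi> > 0" "\<And>h. hx h \<in> P \<Longrightarrow> \<pi> dvd h"
proof -
  obtain h0 where h0: "h0 \<noteq> 0 \<and> hx h0 \<in> P" using ex_poly_in_P by blast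
  obtain \<pi> where pi: "\<pi> \<noteq> 0 \<and> hx \<pi> \<in> P" and min: "\<And>h. h \<noteq> 0 \<and> hx h \<in> P \<Longrightarrow> degree \<pi> \<le> degree h"
    using ex_has_least_nat[of "\<lambda>h. h \<noteq> 0 \<and> hx h \<in> P" h0 degree] h0 by blast
  have "\<pi> dvd h" if "hx h \<in> P" for h
  proof -
    have "hx (h mod \<pi>) = hx h - hx (h div \<pi>) * hx \<pi>"
      by (simp flip: hx.hom_mult hx.hom_diff add: minus_div_mult_eq_mod)
    hence "hx (h mod \<pi>) \<in> P" using that pi by (auto intro!: P_diff P_mult' hx_in_A)
    with min[of "h mod \<pi>"] degree_mod_less[of \<pi> h] pi have "h mod \<pi> = 0" by force
    thus ?thesis by (simp add: dvd_eq_mod_eq_0)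
  qed
  moreover have "degree \<pi> > 0"
  proof (rule ccontr)
    assume "\<not> degree \<pi> > 0"
    then obtain c where c: "\<pi> = [:c:]" by (auto elim: degree_eq_zeroE)
    with pi have "\<iota> c \<in> P" "c \<noteq> 0" by auto
    moreover have "\<iota> c * \<iota> (inverse c) = 1" using \<open>c \<noteq> 0\<close> by (simp add: iota.hom_1 flip: iota.hom_mult)
    ultimately show False using P_mult[OF _ iota_in_A, of "\<iota> c" "inverse c"] one_notin_P by simp
  qed
  ultimately show ?thesis using that pi by blast
qed

text \<open>The residue field of \<open>P \<inter> k[x]\<close> is finite, so it is fixed by some power of the Frobenius map.\<close>

lemma ex_Frobenius_power:
  "\<exists>l>0. x ^ (q ^ l) - x \<in> P"
proof -
  obtain h where h: "h \<noteq> 0" "hx h \<in> P" using ex_poly_in_P by blast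
  define r where "r i = (monom 1 1 ^ (q ^ i)) mod h" for i
  have "range r \<subseteq> {g. g = 0 \<or> degree g < degree h}"
    using degree_mod_less[OF h(1)] by (auto simp: r_def)
  hence "finite (range r)" using finite_polys_degree_less[OF finite_base] finite_subset by blast
  hence "\<not> inj r" using finite_imageD[of r UNIV] by auto
  then obtain i' j' where "r i' = r j'" "i' \<noteq> j'" by (auto simp: inj_def)
  then obtain i j where ij: "r i = r j" "i < j" by (metis linorder_neqE_nat)
  hence "h dvd monom 1 1 ^ (q ^ j) - monom 1 1 ^ (q ^ i)"
    using ij(1)[symmetric] by (simp add: r_def mod_eq_dvd_iff)
  then obtain s where s: "monom 1 1 ^ (q ^ j) - monom 1 1 ^ (q ^ i) = h * s" by (rule dvdE)
  have "x ^ (q ^ j) - x ^ (q ^ i) = hx (monom 1 1 ^ (q ^ j) - monom 1 1 ^ (q ^ i))"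
    by (simp add: hx.hom_diff hx.hom_power hx_monom iota.hom_1)
  also have "\<dots> \<in> P" unfolding s hx.hom_mult by (intro P_mult h hx_in_A)
  \<comment> \<open>The common exponent \<open>q ^ i\<close> is a Frobenius power, hence additive,
    and can be taken off since \<open>P\<close> is prime.\<close>
  also have "x ^ (q ^ j) = (x ^ (q ^ (j - i))) ^ (q ^ i)"
    using ij(2) by (simp flip: power_mult power_add)
  also have "(x ^ (q ^ (j - i))) ^ (q ^ i) - x ^ (q ^ i) = (x ^ (q ^ (j - i)) - x) ^ (q ^ i)"
    unfolding q_eq by (simp add: power_diff_K flip: power_mult)
  finally show ?thesis using P_power[of "x ^ (q ^ (j - i)) - x" "q ^ i"] ij(2)
    by (intro exI[of _ "j - i"]) (auto intro!: A_diff A_power x_in_A)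
qed

text \<open>Modulo \<open>t = x\<^sup>M - x\<close> with \<open>M\<close> a power of \<open>q\<close>, the map \<open>y \<mapsto> y\<^sup>M\<close> adds to \<open>z\<close> a polynomial in \<open>x\<close>, and
  hence its \<open>p\<^sub>0\<close>-th iterate is the identity: \<open>A/tA\<close> is reduced.\<close>

lemma power_congruence:
  assumes l: "l > 0" and t: "t = x ^ (q ^ l) - x"
  shows "\<exists>N\<ge>2. \<forall>y\<in>A. \<exists>w\<in>A. y ^ N - y = t * w"
proof -
  define cg where "cg a b \<longleftrightarrow> (\<exists>w\<in>A. a - b = t * w)" for a b
  have t_A: "t \<in> A" unfolding t by (intro A_diff A_power x_in_A)
  have cg_refl: "cg a a" for a unfolding cg_def using zero_in_A by force
  have cg_trans: "cg a c" if "cg a b" "cg b c" for a b c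
  proof -
    from that obtain v w where "v \<in> A" "a - b = t * v" "w \<in> A" "b - c = t * w" unfolding cg_def by blast
    hence "v + w \<in> A" "a - c = t * (v + w)" using A_add by (auto simp: algebra_simps)
    thus ?thesis unfolding cg_def by blast
  qed
  have cg_add: "cg (a + a') (b + b')" if "cg a b" "cg a' b'" for a b a' b'
  proof -
    from that obtain v w where "v \<in> A" "a - b = t * v" "w \<in> A" "a' - b' = t * w" unfolding cg_def by blast
    hence "v + w \<in> A" "a + a' - (b + b') = t * (v + w)" using A_add by (auto simp: algebra_simps)
    thus ?thesis unfolding cg_def by blast
  qed
  have cg_mult_left: "cg (c * a) (c * b)" if "cg a b" "c \<in> A" for a b c
  proof -
    from that obtain v where "v \<in> A" "a - b = t * v" unfolding cg_def by blast
    hence "c * v \<in> A" "c * a - c * b = t * (c * v)" using A_mult that(2) 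
      by (auto simp: algebra_simps simp flip: right_diff_distrib)
    thus ?thesis unfolding cg_def by blast
  qed
  have cg_mult: "cg (a * a') (b * b')" if "cg a b" "cg a' b'" "a' \<in> A" "b \<in> A" for a b a' b'
    using cg_trans[OF cg_mult_left[OF that(1,3)], of "b * b'"] cg_mult_left[OF that(2,4)]
    by (simp add: mult.commute)
  have cg_power: "cg (a ^ n) (b ^ n)" if "cg a b" "a \<in> A" "b \<in> A" for a b n
    by (induction n) (use that cg_refl A_power in \<open>auto intro!: cg_mult\<close>)
  have cg_x: "cg (x ^ (q ^ l)) x" unfolding cg_def t using one_in_A by force
  have cg_hx: "cg (hx h ^ (q ^ l)) (hx h)" for h
  proof (induction h)
    case 0 thus ?case using q_gt_1 cg_refl by (simp add: hx.hom_0 power_0_left)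
  next
    case (pCons c h)
    have "(hx (pCons c h)) ^ (q ^ l) = \<iota> c + x ^ (q ^ l) * hx h ^ (q ^ l)"
      unfolding q_eq power_mult[symmetric] by (simp add: hx_pCons power_add_K iota_power power_mult_distrib)
    thus ?case using cg_add[OF cg_refl[of "\<iota> c"] cg_mult[OF cg_x pCons.IH]]
      by (simp add: hx_pCons hx_in_A A_power x_in_A)
  qed
  have zq: "\<exists>h. z ^ (q ^ i) = z + hx h" for i
  proof (induction i)
    case 0 show ?case using hx.hom_0 by (intro exI[of _ 0]) simp
  next
    case (Suc i)
    then obtain h where h: "z ^ (q ^ i) = z + hx h" by blast
    have "z ^ (q ^ Suc i) = (z ^ (q ^ i)) ^ q" by (simp add: mult.commute flip: power_mult)
    also have "\<dots> = (z + hx h) ^ q" by (simp only: h)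
    also have "\<dots> = z ^ q + hx h ^ q" by (simp only: power_add_K q_eq)
    also have "\<dots> = z + hx (F + h ^ q)" by (simp add: z_power_q hx.hom_add hx.hom_power)
    finally show ?case by blast
  qed
  obtain h where h: "z ^ (q ^ l) = z + hx h" using zq by blast
  define N where "N j = (q ^ l) ^ j" for j :: nat
  have N_Suc: "y ^ N (Suc j) = (y ^ N j) ^ (q ^ l)" for y :: 'b and j
    by (simp add: N_def mult.commute flip: power_mult)
  have cg_x': "cg (x ^ N j) x" for j
  proof (induction j)
    case (Suc j)
    show ?case unfolding N_Suc using Suc cg_x cg_trans cg_power A_power x_in_A by blast
  qed (simp add: N_def cg_refl)
  \<comment> \<open>Each iteration adds the same \<open>hx h\<close>, because modulo
    \<open>t\<close> a polynomial in x equals its \<open>q ^ l\<close>-th power. After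
    \<open>p\<^sub>0\<close> iterations the added terms cancel.\<close>
  have cg_z': "cg (z ^ N j) (z + of_nat j * hx h)" for j
  proof (induction j)
    case (Suc j)
    have 1: "z + of_nat j * hx h \<in> A"
      using hx_in_A[of "of_nat j * h"] z_in_A A_add by (simp add: hx.hom_mult hx.hom_of_nat)
    have c1: "cg (z ^ N (Suc j)) ((z + of_nat j * hx h) ^ (q ^ l))"
      unfolding N_Suc using Suc 1 by (intro cg_power A_power z_in_A)
    have c2: "(z + of_nat j * hx h) ^ (q ^ l) = z + hx h + (hx (of_nat j * h)) ^ (q ^ l)"
      unfolding h[symmetric] unfolding q_eq power_mult[symmetric]
      by (simp add: power_add_K hx.hom_mult hx.hom_of_nat)
    have c3: "cg (z + hx h + (hx (of_nat j * h)) ^ (q ^ l)) (z + hx h + hx (of_nat j * h))"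
      by (intro cg_add cg_refl cg_hx)
    have "cg (z ^ N (Suc j)) (z + hx h + hx (of_nat j * h))" using cg_trans[OF c1[unfolded c2] c3] .
    thus ?case by (simp add: hx.hom_mult hx.hom_of_nat algebra_simps)
  qed (simp add: N_def cg_refl)
  have N_p0: "N j = p\<^sub>0 ^ (e * l * j)" for j by (simp add: N_def q_eq power_mult)
  define n where "n = N p\<^sub>0"
  have "(of_nat p\<^sub>0 :: 'b) = 0" using of_nat_CHAR[where 'a = 'b] by (simp add: CHAR_K)
  hence cz: "cg (z ^ n) z" using cg_z'[of "p\<^sub>0"] by (simp add: n_def)
  have "A \<subseteq> {y \<in> A. cg (y ^ n) y}"
  proof (rule A_subring)
    fix c show "\<iota> c \<in> {y \<in> A. cg (y ^ n) y}"
      using cg_refl by (simp add: iota_in_A n_def N_p0 iota_power)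
  qed (use cz cg_x' in \<open>auto simp: n_def x_in_A z_in_A N_p0 power_add_K power_mult_distrib
         intro!: cg_add cg_mult A_power A_add A_mult\<close>)
  moreover have "n \<ge> 2"
  proof -
    have "e * l * p\<^sub>0 > 0" using e_pos l prime_gt_0_nat[OF prime_p0] by simp
    hence "n > 1" unfolding n_def N_p0 using prime_gt_1_nat[OF prime_p0] by (intro one_less_power)
    thus ?thesis by simp
  qed
  ultimately show ?thesis unfolding cg_def by blast
qed

text \<open>Locally at \<open>P\<close>, every element of \<open>P\<close> is a multiple of t =
  \<open>x ^ (q ^ l) - x\<close>, so factors t can be split off one after the other. The process
  stops because an element divides its norm in k[x], and there the exponent of t is the multiplicity
  of \<pi>, as \<pi> divides the separable polynomial X^(q^l) - X just once.\<close>

lemma ex_local_parameter: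
  obtains t where "t \<in> P" "t \<noteq> 0"
    "\<And>a. a \<noteq> 0 \<Longrightarrow> \<exists>n u v. a = t powi n * (u / v) \<and> u \<in> A - P \<and> v \<in> A - P"
proof -
  obtain l where l: "l > 0" "x ^ (q ^ l) - x \<in> P" using ex_Frobenius_power by blast
  define t where "t = x ^ (q ^ l) - x"
  have ql: "q ^ l > 1" using q_gt_1 l(1) by (intro one_less_power)
  have t_hx: "t = hx (monom 1 (q ^ l) - monom 1 1)"
    by (simp add: t_def hx.hom_diff hx_monom iota.hom_1)
  have "degree (monom 1 (q ^ l) - monom (1::'a) 1) = q ^ l"
    using ql degree_add_eq_left[of "- monom (1::'a) 1" "monom 1 (q ^ l)"] by (simp add: degree_monom_eq)
  hence t0: "t \<noteq> 0" using ql unfolding t_hx hx_eq_0_iff by (metis degree_0 not_one_less_zero)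
  have tP: "t \<in> P" using l by (simp add: t_def)
  obtain N where N: "N \<ge> 2" "\<And>y. y \<in> A \<Longrightarrow> \<exists>w\<in>A. y ^ N - y = t * w"
    using power_congruence[OF l(1) t_def] by blast
  have AP_mult: "a * b \<in> A - P" if "a \<in> A - P" "b \<in> A - P" for a b
    using that A_mult P_prime by blast
  have one_AP: "1 \<in> A - P" using one_in_A one_notin_P by blast
  have nz: "a \<noteq> 0" if "a \<in> A - P" for a using that zero_in_P by auto
  \<comment> \<open>In \<open>y ^ N - y = y * (y ^ (N - 1) - 1)\<close> the second factor is outside
    \<open>P\<close> when y is in \<open>P\<close>, so it can serve as a denominator.\<close>
  have unram: "\<exists>s\<in>A - P. \<exists>w\<in>A. y * s = t * w" if y: "y \<in> P" for y
  proof -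
    obtain w where w: "w \<in> A" "y ^ N - y = t * w" using N(2)[of y] y P_subset by blast
    have yA: "y \<in> A" using y P_subset by blast
    have "N - 1 = Suc (N - 2)" using N(1) by simp
    hence "y ^ (N - 1) = y * y ^ (N - 2)" by (simp only: power_Suc)
    hence "y ^ (N - 1) \<in> P" using y yA by (simp add: P_mult A_power)
    moreover have "1 = y ^ (N - 1) - (y ^ (N - 1) - 1)" by simp
    ultimately have "y ^ (N - 1) - 1 \<notin> P" using P_diff one_notin_P by metis
    moreover have "y ^ (N - 1) - 1 \<in> A" using yA by (intro A_diff A_power one_in_A)
    moreover have "y ^ N = y * y ^ (N - 1)" using N(1) by (simp flip: power_Suc)
    hence "y * (y ^ (N - 1) - 1) = t * w" using w(2) by (simp add: algebra_simps)
    ultimately show ?thesis using w(1) by blast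
  qed
  obtain \<pi> where pi: "\<pi> \<noteq> 0" "hx \<pi> \<in> P" "degree \<pi> > 0" "\<And>h. hx h \<in> P \<Longrightarrow> \<pi> dvd h"
    using ex_generator by blast
  obtain \<epsilon> where eps: "monom 1 (q ^ l) - monom 1 1 = \<pi> * \<epsilon>"
    using pi(4)[of "monom 1 (q ^ l) - monom 1 1"] tP unfolding t_hx by (auto elim: dvdE)
  \<comment> \<open>Otherwise \<pi> would divide X^(q^l) - X twice, and then also its derivative,
    which is -1.\<close>
  have "hx \<epsilon> \<notin> P"
  proof
    assume "hx \<epsilon> \<in> P"
    then obtain \<epsilon>' where "\<epsilon> = \<pi> * \<epsilon>'" using pi(4) by (auto elim: dvdE)
    hence "pderiv (monom 1 (q ^ l) - monom 1 1) = pderiv (\<pi> * (\<pi> * \<epsilon>'))" using eps by simp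
    moreover have "(of_nat (q ^ l) :: 'a) = 0"
      unfolding of_nat_eq_0_iff_char_dvd CHAR_base q_eq power_mult[symmetric] using e_pos l(1) by (simp add: dvd_power)
    ultimately have "- 1 = pderiv (\<pi> * (\<pi> * \<epsilon>'))"
      by (simp only: pderiv_diff pderiv_monom) (simp add: one_pCons monom_0)
    also have "\<dots> = \<pi> * (2 * pderiv \<pi> * \<epsilon>' + \<pi> * pderiv \<epsilon>')"
      by (simp add: pderiv_mult algebra_simps)
    finally have "\<pi> dvd 1" by (metis dvd_minus_iff dvd_triv_left)
    thus False using pi(3) by (auto dest: dvd_imp_degree_le)
  qed
  hence epsA: "hx \<epsilon> \<in> A - P" using hx_in_A by blast
  have t_eps: "t = hx \<pi> * hx \<epsilon>" by (simp only: t_hx eps hx.hom_mult)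
  have poly: "\<exists>n u v. hx h * v = t ^ n * u \<and> u \<in> A - P \<and> v \<in> A - P" if "h \<noteq> 0" for h
    using that
  proof (induction "degree h" arbitrary: h rule: less_induct)
    case less
    show ?case
    proof (cases "hx h \<in> P")
      case False
      thus ?thesis using one_AP hx_in_A by (intro exI[of _ 0] exI[of _ "hx h"] exI[of _ 1]) simp
    next
      case True
      then obtain h1 where h1: "h = \<pi> * h1" using pi(4) by (auto elim: dvdE)
      with less.prems have "h1 \<noteq> 0" "degree h1 < degree h" using pi(3) by (auto simp: degree_mult_eq)
      then obtain n u v where nuv: "hx h1 * v = t ^ n * u" "u \<in> A - P" "v \<in> A - P"
        using less.hyps by blast
      have "hx h * (v * hx \<epsilon>) = t ^ Suc n * u"
        using nuv(1) by (simp add: h1 hx.hom_mult t_eps ac_simps)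
      thus ?thesis using nuv AP_mult[OF _ epsA] by blast
    qed
  qed
  \<comment> \<open>Here y' is a cofactor that makes \<open>y * y'\<close> a known power of t up to
    units. As long as y lies in \<open>P\<close>, \<open>unram\<close> trades it for some w with one
    factor t less, and the exponent n of the product bounds the number of rounds.\<close>
  have split: "\<exists>n u v. y * v = t ^ n * u \<and> u \<in> A - P \<and> v \<in> A - P"
    if "y \<in> A" "y' \<in> A" "u \<in> A - P" "v \<in> A - P" "y * y' * v = t ^ n * u" for y y' u v n
    using that
  proof (induction n arbitrary: y u v)
    case 0
    hence "y \<notin> P" using P_mult[of y "y' * v"] A_mult by (auto simp: mult.assoc)
    thus ?case using 0 one_AP by (intro exI[of _ 0] exI[of _ y] exI[of _ 1]) simp
  next
    case (Suc n)
    show ?case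
    proof (cases "y \<in> P")
      case False
      thus ?thesis using Suc.prems one_AP by (intro exI[of _ 0] exI[of _ y] exI[of _ 1]) simp
    next
      case True
      then obtain s w where s: "s \<in> A - P" and w: "w \<in> A" "y * s = t * w" using unram by blast
      have "t * (w * y' * v) = (y * y' * v) * s" using w(2) by (simp add: ac_simps)
      also have "\<dots> = t * (t ^ n * (u * s))" using Suc.prems(5) by (simp add: ac_simps)
      finally have "w * y' * v = t ^ n * (u * s)" using t0 by simp
      then obtain n' u' v' where nuv: "w * v' = t ^ n' * u'" "u' \<in> A - P" "v' \<in> A - P"
        using Suc.IH[OF w(1) Suc.prems(2) AP_mult[OF Suc.prems(3) s] Suc.prems(4)] by blast
      have "y * (v' * s) = (y * s) * v'" by (simp only: ac_simps)
      also have "\<dots> = t * (w * v')" by (simp only: w(2) mult.assoc)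
      also have "\<dots> = t ^ Suc n' * u'" by (simp only: nuv(1) power_Suc mult.assoc)
      finally have "y * (v' * s) = t ^ Suc n' * u'" .
      thus ?thesis using nuv AP_mult[OF _ s] by blast
    qed
  qed
  have A_case: "\<exists>n u v. y = t powi n * (u / v) \<and> u \<in> A - P \<and> v \<in> A - P" if y: "y \<in> A" "y \<noteq> 0" for y
  proof -
    obtain y' h where y': "y' \<in> A" "h \<noteq> 0" "y * y' = hx h" using ex_norm[OF y] by blast
    obtain n u v where "hx h * v = t ^ n * u" "u \<in> A - P" "v \<in> A - P" using poly[OF y'(2)] by blast
    then obtain m u' v' where nuv: "y * v' = t ^ m * u'" "u' \<in> A - P" "v' \<in> A - P"
      using split[OF y(1) y'(1)] y'(3) by metis
    have "y = t powi int m * (u' / v')"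
      using nuv(1) nz[OF nuv(3)] by (simp add: eq_divide_eq)
    thus ?thesis using nuv by blast
  qed
  have "\<exists>n u v. a = t powi n * (u / v) \<and> u \<in> A - P \<and> v \<in> A - P" if a: "a \<noteq> 0" for a
  proof -
    obtain y h where yh: "y \<in> A" "h \<noteq> 0" "a = y / hx h" using fraction_hx[of a] by blast
    with a have "y \<noteq> 0" "hx h \<noteq> 0" by auto
    then obtain n u v m u' v' where
      1: "y = t powi n * (u / v)" "u \<in> A - P" "v \<in> A - P"
      and 2: "hx h = t powi m * (u' / v')" "u' \<in> A - P" "v' \<in> A - P"
      using A_case[OF yh(1)] A_case[OF hx_in_A] by metis
    have "a = t powi (n - m) * ((u * v') / (v * u'))"
      unfolding yh(3) 1 2 power_int_diff[OF disjI1[OF t0]] by (simp add: ac_simps)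
    thus ?thesis using AP_mult 1 2 by blast
  qed
  thus ?thesis using that t0 tP by blast
qed

end

section \<open>Local rings of the affine curve\<close>

lemma card_roots_separable:
  fixes f :: "'c::alg_closed_field poly"
  assumes "f \<noteq> 0" "\<And>a. poly f a = 0 \<Longrightarrow> poly (pderiv f) a \<noteq> 0"
  shows "card {a. poly f a = 0} = degree f"
  using assms
proof (induction "degree f" arbitrary: f)
  case 0
  then obtain c where "f = [:c:]" by (metis degree_eq_zeroE)
  with 0 show ?case by simp
next
  case (Suc n)
  then obtain a where a: "poly f a = 0" using alg_closed_imp_poly_has_root[of f] by auto
  then obtain s where s: "f = [:- a, 1:] * s" unfolding poly_eq_0_iff_dvd by (rule dvdE)
  have s0: "s \<noteq> 0" using s Suc.prems by auto
  have pd: "poly (pderiv f) b = (b - a) * poly (pderiv s) b + poly s b" for b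
    unfolding s pderiv_mult by (simp add: pderiv_pCons del: mult_pCons_left)
  have "degree f = Suc (degree s)" unfolding s using s0 by (subst degree_mult_eq) auto
  hence n: "n = degree s" using Suc.hyps by simp
  have "card {b. poly s b = 0} = degree s"
  proof (rule Suc.hyps(1)[OF n s0])
    fix b assume b: "poly s b = 0"
    hence "poly f b = 0" by (simp add: s)
    hence "poly (pderiv f) b \<noteq> 0" by (rule Suc.prems)
    thus "poly (pderiv s) b \<noteq> 0" using b by (auto simp: pd)
  qed
  moreover have "{b. poly f b = 0} = insert a {b. poly s b = 0}"
    unfolding s poly_mult by auto
  moreover have "poly s a \<noteq> 0" using Suc.prems(2)[OF a] by (simp add: pd)
  moreover have "finite {b. poly s b = 0}" using s0 by (rule poly_roots_finite)
  ultimately show ?case using Suc.hyps n by simp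
qed

text \<open>The derivative of X^Q - X - c is -1 for a positive power Q of the characteristic. The
  case c = 0 gives the size of a finite field, the general case the number of points above a given
  x-coordinate.\<close>

lemma card_power_minus_self_eq:
  assumes "prime CHAR('c::alg_closed_field)" "e > 0"
  shows "card {b :: 'c. b ^ (CHAR('c) ^ e) - b = c} = CHAR('c) ^ e"
proof -
  define Q where "Q = CHAR('c) ^ e"
  have Q: "Q > 1" unfolding Q_def using assms prime_gt_1_nat by (intro one_less_power)
  define f :: "'c poly" where "f = monom 1 Q + (- [:c, 1:])"
  have dl: "degree (- [:c, 1:]) < degree (monom (1::'c) Q)" using Q by (simp add: degree_monom_eq)
  have deg: "degree f = Q" unfolding f_def using degree_add_eq_left[OF dl] by (simp add: degree_monom_eq)
  have "(of_nat Q :: 'c) = 0"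
    unfolding Q_def of_nat_eq_0_iff_char_dvd using assms(2) by (simp add: dvd_power)
  hence "pderiv f = [:-1:]" by (simp add: f_def pderiv_add pderiv_minus pderiv_diff pderiv_monom pderiv_pCons)
  hence "card {a. poly f a = 0} = degree f" using deg Q by (intro card_roots_separable) auto
  moreover have "{a. poly f a = 0} = {b. b ^ Q - b = c}"
    by (auto simp: f_def poly_monom algebra_simps)
  ultimately show ?thesis using deg by (simp add: Q_def)
qed

section \<open>Localisations at nonzero primes are discrete valuation rings\<close>

context artin_schreier_prime
begin

definition local_ring :: "'b set" where
  "local_ring = {u / v | u v. u \<in> A \<and> v \<in> A - P}"

lemma nonzero_A_minus_P: "v \<in> A - P \<Longrightarrow> v \<noteq> 0"
  using zero_in_P by auto

lemma A_minus_P_mult: "a \<in> A - P \<Longrightarrow> b \<in> A - P \<Longrightarrow> a * b \<in> A - P"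
  using A_mult P_prime by blast

lemma A_minus_P_one: "1 \<in> A - P"
  using one_in_A one_notin_P by blast

lemma local_ringI: "u \<in> A \<Longrightarrow> v \<in> A - P \<Longrightarrow> u / v \<in> local_ring"
  unfolding local_ring_def by blast

lemma A_subset_local_ring: "a \<in> A \<Longrightarrow> a \<in> local_ring"
  using local_ringI[OF _ A_minus_P_one] by simp

lemma inverse_P_notin: assumes "t \<in> P" "t \<noteq> 0" shows "inverse t \<notin> local_ring"
proof
  assume "inverse t \<in> local_ring"
  then obtain u v where uv: "inverse t = u / v" "u \<in> A" "v \<in> A - P" unfolding local_ring_def by blast
  hence "v = t * u" using assms(2) nonzero_A_minus_P[OF uv(3)] by (simp add: field_simps)
  thus False using P_mult[OF assms(1) uv(2)] uv(3) by simp
qed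

text \<open>Both claims come from the decomposition in \<open>ex_local_parameter\<close>: the sign
  of the exponent of t decides whether a or its inverse is in the ring.\<close>

lemma local_ring_closed_point: "local_ring \<in> closed_points \<iota>"
  and local_ring_parameter: "\<exists>t. local_parameter \<iota> local_ring t"
proof -
  obtain t where t: "t \<in> P" "t \<noteq> 0"
    and dec: "\<And>a. a \<noteq> 0 \<Longrightarrow> \<exists>n u v. a = t powi n * (u / v) \<and> u \<in> A - P \<and> v \<in> A - P"
    using ex_local_parameter by blast
  have tA: "t \<in> A" using t(1) P_subset by blast
  have not_t: "t \<noteq> \<iota> c" for c
  proof
    assume "t = \<iota> c"
    moreover from this t(2) have "c \<noteq> 0" by (auto simp: iota.hom_0)
    ultimately have "t * \<iota> (inverse c) = 1" by (simp add: iota.hom_1 flip: iota.hom_mult)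
    with P_mult[OF t(1) iota_in_A, of "inverse c"] one_notin_P show False by simp
  qed
  have val: "a \<in> local_ring \<or> inverse a \<in> local_ring" for a
  proof (cases "a = 0")
    case True thus ?thesis using A_subset_local_ring[OF zero_in_A] by simp
  next
    case False
    then obtain n u v where nuv: "a = t powi n * (u / v)" "u \<in> A - P" "v \<in> A - P" using dec by blast
    show ?thesis
    proof (cases "n \<ge> 0")
      case True
      hence "a = (t ^ nat n * u) / v" using nuv(1) by (simp add: power_int_def)
      moreover have "t ^ nat n * u \<in> A" using nuv tA by (intro A_mult A_power) auto
      ultimately show ?thesis using nuv(3) local_ringI by metis
    next
      case False
      hence "inverse a = (t ^ nat (-n) * v) / u"
        using nuv(1) by (simp add: power_int_def power_inverse divide_inverse ac_simps)
      moreover have "t ^ nat (-n) * v \<in> A" using nuv tA by (intro A_mult A_power) auto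
      ultimately show ?thesis using nuv(2) local_ringI by metis
    qed
  qed
  have closed: "a - b \<in> local_ring \<and> a * b \<in> local_ring" if ab: "a \<in> local_ring" "b \<in> local_ring" for a b
  proof -
    from ab obtain u v u' v' where
      1: "a = u / v" "u \<in> A" "v \<in> A - P" and 2: "b = u' / v'" "u' \<in> A" "v' \<in> A - P"
      unfolding local_ring_def by blast
    have "v \<noteq> 0" "v' \<noteq> 0" using 1 2 nonzero_A_minus_P by blast+
    hence "a - b = (u * v' - u' * v) / (v * v')" "a * b = (u * u') / (v * v')"
      unfolding 1(1) 2(1) by (simp_all add: field_simps)
    moreover have "u * v' - u' * v \<in> A" "u * u' \<in> A" using 1 2 by (auto intro!: A_diff A_mult)
    ultimately show ?thesis using local_ringI A_minus_P_mult[OF 1(3) 2(3)] by simp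
  qed
  have "t \<in> local_ring" "t \<notin> range \<iota>" using tA A_subset_local_ring not_t by auto
  moreover have "range \<iota> \<subseteq> local_ring" using iota_in_A A_subset_local_ring by auto
  ultimately have "range \<iota> \<subset> local_ring" by blast
  moreover have "local_ring \<subset> UNIV" using inverse_P_notin[OF t] by blast
  ultimately show cp: "local_ring \<in> closed_points \<iota>"
    unfolding closed_points_def using closed val by blast
  interpret closed_point \<iota> local_ring using cp embedding by unfold_locales
  have unit: "u / v \<in> unit_set local_ring" if "u \<in> A - P" "v \<in> A - P" for u v
    using that local_ringI[of u v] local_ringI[of v u] nonzero_A_minus_P by (simp add: unit_set_def)
  have "local_parameter \<iota> local_ring t"
  proof
    show "t \<in> max_ideal local_ring"
      using inverse_P_notin[OF t] A_subset_local_ring[OF tA] by (simp add: max_ideal_iff)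
    show "\<exists>n u. u \<in> unit_set local_ring \<and> a = t powi n * u" if "a \<noteq> 0" for a
      using dec[OF that] unit by blast
  qed (use t in simp)
  thus "\<exists>t. local_parameter \<iota> local_ring t" by blast
qed

lemma P_in_max_ideal: assumes "a \<in> P" shows "a \<in> max_ideal local_ring"
proof -
  interpret closed_point \<iota> local_ring using local_ring_closed_point embedding by unfold_locales
  have "a \<in> local_ring" using assms P_subset A_subset_local_ring by blast
  thus ?thesis using inverse_P_notin[OF assms] by (auto simp: max_ideal_iff)
qed

lemma max_ideal_inter_A: assumes "a \<in> max_ideal local_ring" "a \<in> A" shows "a \<in> P"
proof (rule ccontr)
  interpret closed_point \<iota> local_ring using local_ring_closed_point embedding by unfold_locales
  assume "a \<notin> P"
  hence "a \<in> A - P" using assms by blast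
  moreover from this have "inverse a \<in> local_ring" using local_ringI[OF one_in_A] by (simp add: divide_inverse)
  ultimately show False using assms(1) nonzero_A_minus_P by (simp add: max_ideal_iff)
qed

end

section \<open>Closed points at which x is regular\<close>

locale affine_closed_point = artin_schreier_curve +
  fixes \<O>
  assumes closed_O: "\<O> \<in> closed_points \<iota>" and x_in_O: "x \<in> \<O>"
begin

sublocale O: closed_point \<iota> \<O>
  using closed_O embedding by unfold_locales

text \<open>z is integral over k[x]: if it were not in the valuation ring, dividing the equation by
  \<open>z ^ q\<close> would put 1 into the maximal ideal.\<close>

lemma A_subset_O: "A \<subseteq> \<O>"
proof -
  have F: "hx h \<in> \<O>" for h
    by (induction h) (simp_all add: hx_pCons hx.hom_0 O.zero_closed O.add_closed O.mult_closed O.range_subset x_in_O)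
  have "z \<in> \<O>"
  proof (rule ccontr)
    assume z: "z \<notin> \<O>"
    hence z0: "z \<noteq> 0" using O.zero_closed by auto
    have zi: "inverse z \<in> max_ideal \<O>" using O.notin_imp_inverse[OF z] .
    obtain n where n: "q = Suc (Suc n)" using q_gt_1 by (metis One_nat_def less_iff_Suc_add plus_1_eq_Suc add_Suc)
    have "1 = z ^ q * inverse z ^ q" using z0 by (simp flip: power_mult_distrib)
    also have "\<dots> = (z * inverse z) * (inverse z * inverse z ^ n) + inverse z * (hx F * inverse z ^ Suc n)"
      unfolding z_power_q unfolding n power_Suc by (simp only: distrib_right distrib_left mult_ac)
    also have "\<dots> = inverse z * (inverse z ^ n + hx F * inverse z ^ Suc n)"
      by (simp only: right_inverse[OF z0] mult_1_left distrib_left)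
    also have "\<dots> \<in> max_ideal \<O>"
      using zi by (intro O.max_ideal_mult O.add_closed O.mult_closed F O.power_closed O.max_ideal_subset)
    finally show False using O.one_notin_max_ideal by blast
  qed
  with x_in_O show ?thesis
    by (intro A_subring) (simp_all add: O.add_closed O.mult_closed O.range_subset)
qed

text \<open>The centre of the valuation on the affine curve. It is nonzero because the denominator
  in k[x] of an element outside \<O> cannot be a unit of \<O>.\<close>

sublocale artin_schreier_prime \<iota> p\<^sub>0 e q F x z "max_ideal \<O> \<inter> A"
proof
  obtain a where a: "a \<notin> \<O>" using O.proper by blast
  obtain y h where yh: "y \<in> A" "h \<noteq> 0" "a = y / hx h" using fraction_hx[of a] by blast
  have "hx h \<in> \<O>" using hx_in_A A_subset_O by blast
  moreover have "inverse (hx h) \<notin> \<O>"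
    using a yh(1,3) A_subset_O O.mult_closed[of y "inverse (hx h)"] by (auto simp: divide_inverse)
  ultimately have "hx h \<in> max_ideal \<O> \<inter> A" using hx_in_A by (simp add: O.max_ideal_iff)
  thus "\<exists>a\<in>max_ideal \<O> \<inter> A. a \<noteq> 0" using yh(2) hx_eq_0_iff by blast
next
  fix a b assume "a \<in> max_ideal \<O> \<inter> A" "b \<in> max_ideal \<O> \<inter> A"
  thus "a + b \<in> max_ideal \<O> \<inter> A" by (simp add: O.max_ideal_add A_add)
next
  fix a b assume "a \<in> max_ideal \<O> \<inter> A" "b \<in> A"
  thus "a * b \<in> max_ideal \<O> \<inter> A" using A_subset_O by (auto intro: O.max_ideal_mult A_mult)
next
  fix a b assume "a \<in> A" "b \<in> A" "a * b \<in> max_ideal \<O> \<inter> A"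
  thus "a \<in> max_ideal \<O> \<inter> A \<or> b \<in> max_ideal \<O> \<inter> A"
    using A_subset_O O.max_ideal_prime[of a b] by auto
qed (simp_all add: O.one_notin_max_ideal)

text \<open>\<O> dominates the localisation at its centre, and a valuation ring is maximal with
  respect to domination.\<close>

lemma O_eq_local_ring: "\<O> = local_ring"
proof (intro equalityI subsetI)
  have unit: "v \<in> unit_set \<O>" if "v \<in> A - max_ideal \<O> \<inter> A" for v
    using that A_subset_O by (auto simp: O.unit_iff)
  {
    fix a assume "a \<in> local_ring"
    then obtain u v where uv: "a = u / v" "u \<in> A" "v \<in> A - max_ideal \<O> \<inter> A" unfolding local_ring_def by blast
    thus "a \<in> \<O>" using O.unit_inverse[OF unit[OF uv(3)]] A_subset_O O.mult_closed
      by (auto simp: divide_inverse unit_set_def)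
  }
  fix a assume a: "a \<in> \<O>"
  interpret L: closed_point \<iota> local_ring using local_ring_closed_point embedding by unfold_locales
  show "a \<in> local_ring"
  proof (rule ccontr)
    assume na: "a \<notin> local_ring"
    hence "inverse a \<in> max_ideal local_ring" by (rule L.notin_imp_inverse)
    hence "inverse a \<in> local_ring" by (rule L.max_ideal_subset)
    then obtain u v where uv: "inverse a = u / v" "u \<in> A" "v \<in> A - max_ideal \<O> \<inter> A" unfolding local_ring_def by blast
    have "u \<in> max_ideal \<O> \<inter> A"
    proof (rule ccontr)
      assume "u \<notin> max_ideal \<O> \<inter> A"
      hence "v / u \<in> local_ring" using uv by (intro local_ringI) auto
      moreover have "a = v / u" using uv(1) by (metis inverse_divide inverse_inverse_eq)
      ultimately show False using na by simp
    qed
    hence "u * inverse v \<in> max_ideal \<O>"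
      using O.unit_inverse[OF unit[OF uv(3)]] by (intro O.max_ideal_mult) (auto simp: unit_set_def)
    hence "inverse a \<in> max_ideal \<O>" using uv(1) by (simp add: divide_inverse)
    moreover have "a \<noteq> 0" using na A_subset_local_ring[OF zero_in_A] by auto
    ultimately show False using a by (simp add: O.max_ideal_iff)
  qed
qed

lemma ord_at_affine_iff: "a \<noteq> 0 \<Longrightarrow> ord_at \<O> a \<ge> 0 \<longleftrightarrow> a \<in> \<O>"
  using local_ring_parameter local_parameter.ord_at_nonneg_iff unfolding O_eq_local_ring[symmetric] by blast

end

section \<open>Evaluation at points over the algebraic closure\<close>

lemma comm_hom_to_ac: "comm_hom to_ac"
  by unfold_locales simp_all

definition eval_ac :: "'a::field alg_closure \<Rightarrow> 'a poly \<Rightarrow> 'a alg_closure" where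
  "eval_ac a h = poly (map_poly to_ac h) a"

definition eval2_ac :: "'a::field alg_closure \<Rightarrow> 'a alg_closure \<Rightarrow> 'a poly poly \<Rightarrow> 'a alg_closure" where
  "eval2_ac a b g = poly (map_poly (eval_ac a) g) b"

lemma comm_hom_eval_ac: "comm_hom (eval_ac a)"
  unfolding eval_ac_def by (rule comm_hom.comm_hom_poly_map[OF comm_hom_to_ac])

lemma comm_hom_eval2_ac: "comm_hom (eval2_ac a b)"
  unfolding eval2_ac_def by (rule comm_hom.comm_hom_poly_map[OF comm_hom_eval_ac])

lemma eval_ac_const: "eval_ac a [:c:] = to_ac c"
  unfolding eval_ac_def by (rule comm_hom.poly_map_hom_const[OF comm_hom_to_ac])

lemma eval_ac_monom: "eval_ac a (monom c n) = to_ac c * a ^ n"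
  unfolding eval_ac_def by (rule comm_hom.poly_map_hom_monom[OF comm_hom_to_ac])

lemma eval2_ac_const: "eval2_ac a b [:h:] = eval_ac a h"
  unfolding eval2_ac_def by (rule comm_hom.poly_map_hom_const[OF comm_hom_eval_ac])

lemma eval2_ac_monom: "eval2_ac a b (monom h n) = eval_ac a h * b ^ n"
  unfolding eval2_ac_def by (rule comm_hom.poly_map_hom_monom[OF comm_hom_eval_ac])

lemma ex_minimal_poly_ac:
  assumes "h0 \<noteq> 0" "eval_ac a h0 = 0"
  obtains \<pi> where "\<pi> \<noteq> 0" "degree \<pi> > 0" "\<And>h. eval_ac a h = 0 \<longleftrightarrow> \<pi> dvd h"
proof -
  interpret comm_hom "eval_ac a" by (rule comm_hom_eval_ac)
  obtain \<pi> where pi: "\<pi> \<noteq> 0 \<and> eval_ac a \<pi> = 0"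
    and min: "\<And>h. h \<noteq> 0 \<and> eval_ac a h = 0 \<Longrightarrow> degree \<pi> \<le> degree h"
    using ex_has_least_nat[of "\<lambda>h. h \<noteq> 0 \<and> eval_ac a h = 0" h0 degree] assms by blast
  have "eval_ac a h = 0 \<longleftrightarrow> \<pi> dvd h" for h
  proof
    assume h: "eval_ac a h = 0"
    have "eval_ac a h = eval_ac a (h div \<pi> * \<pi> + h mod \<pi>)" by simp
    hence "eval_ac a (h mod \<pi>) = 0" using h pi by (simp only: hom_add hom_mult) simp
    with min[of "h mod \<pi>"] degree_mod_less[of \<pi> h] pi have "h mod \<pi> = 0" by force
    thus "\<pi> dvd h" by (simp add: dvd_eq_mod_eq_0)
  next
    assume "\<pi> dvd h"
    thus "eval_ac a h = 0" using pi by (auto elim!: dvdE simp: hom_mult)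
  qed
  moreover have "degree \<pi> > 0"
  proof (rule ccontr)
    assume "\<not> degree \<pi> > 0"
    then obtain c where c: "\<pi> = [:c:]" by (auto elim: degree_eq_zeroE)
    with pi have "to_ac c = 0" "c \<noteq> 0" by (auto simp: eval_ac_const)
    hence "to_ac (c * inverse c) = 0" by (simp only: to_ac_mult mult_zero_left)
    thus False using \<open>c \<noteq> 0\<close> by simp
  qed
  ultimately show ?thesis using that pi by blast
qed

text \<open>The assumption \<open>algebraic\<close> supplies a nonzero element of the vanishing
  ideal, which is then a closed point of the affine curve.\<close>

locale geometric_point = artin_schreier_curve +
  fixes a b :: "'a alg_closure"
  assumes on_curve: "b ^ q - b = eval_ac a F"
    and algebraic: "\<exists>h. h \<noteq> 0 \<and> eval_ac a h = 0"
begin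

sublocale ec: comm_hom "eval2_ac a b"
  by (rule comm_hom_eval2_ac)

lemma eval2_ac_eqI: assumes "ev g = ev g'" shows "eval2_ac a b g = eval2_ac a b g'"
proof -
  have "eval2_ac a b eqn = 0"
    using on_curve
    by (simp add: eqn_def ec.hom_diff eval2_ac_monom eval2_ac_const comm_hom.hom_1[OF comm_hom_eval_ac])
  moreover have "eqn dvd g - g'" using assms by (simp add: ev.hom_diff flip: ev_eq_0_iff)
  ultimately have "eval2_ac a b (g - g') = 0" by (auto elim!: dvdE simp: ec.hom_mult)
  thus ?thesis by (simp add: ec.hom_diff)
qed

definition vanishing_ideal :: "'b set" where
  "vanishing_ideal = ev ` {g. eval2_ac a b g = 0}"

lemma ev_in_vanishing_ideal: "ev g \<in> vanishing_ideal \<longleftrightarrow> eval2_ac a b g = 0"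
proof
  assume "ev g \<in> vanishing_ideal"
  then obtain g' where "eval2_ac a b g' = 0" "ev g = ev g'" unfolding vanishing_ideal_def by blast
  thus "eval2_ac a b g = 0" using eval2_ac_eqI[of g g'] by simp
qed (simp add: vanishing_ideal_def)

sublocale artin_schreier_prime \<iota> p\<^sub>0 e q F x z vanishing_ideal
proof
  show "vanishing_ideal \<subseteq> A" by (auto simp: vanishing_ideal_def A_def)
next
  fix c d assume "c \<in> vanishing_ideal" "d \<in> vanishing_ideal"
  thus "c + d \<in> vanishing_ideal"
    unfolding vanishing_ideal_def by (auto simp: ec.hom_add simp flip: ev.hom_add)
next
  fix c d assume "c \<in> vanishing_ideal" "d \<in> A"
  then obtain g h where "c = ev g" "eval2_ac a b g = 0" "d = ev h"
    unfolding vanishing_ideal_def A_def by blast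
  thus "c * d \<in> vanishing_ideal"
    by (simp add: ec.hom_mult ev_in_vanishing_ideal flip: ev.hom_mult)
next
  fix c d assume "c \<in> A" "d \<in> A" and cd: "c * d \<in> vanishing_ideal"
  then obtain g h where gh: "c = ev g" "d = ev h" unfolding A_def by blast
  with cd have "eval2_ac a b (g * h) = 0" by (simp add: ev_in_vanishing_ideal flip: ev.hom_mult)
  thus "c \<in> vanishing_ideal \<or> d \<in> vanishing_ideal"
    by (simp add: ec.hom_mult ev_in_vanishing_ideal gh)
next
  show "1 \<notin> vanishing_ideal" using ev_in_vanishing_ideal[of 1] by (simp add: ev.hom_1 ec.hom_1)
next
  obtain h where "h \<noteq> 0" "eval_ac a h = 0" using algebraic by blast
  hence "ev [:h:] \<in> vanishing_ideal" "ev [:h:] \<noteq> 0"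
    by (simp_all add: ev_in_vanishing_ideal eval2_ac_const del: ev_const) simp
  thus "\<exists>c\<in>vanishing_ideal. c \<noteq> 0" by blast
qed

lemma x_in_local_ring: "x \<in> local_ring"
  by (rule A_subset_local_ring[OF x_in_A])

end

section \<open>Functions without poles on the affine curve\<close>

context artin_schreier_curve
begin

text \<open>Induction on the degree of the denominator \<open>h\<close> of \<open>y\<close>: if the reduced numerator vanishes at the \<open>q\<close>
  points above a root \<open>a\<close> of \<open>h\<close>, then its coefficients, which are polynomials in \<open>x\<close>, vanish at \<open>a\<close>.\<close>

lemma regular_imp_in_A:
  assumes "\<And>\<O>. \<O> \<in> closed_points \<iota> \<Longrightarrow> x \<in> \<O> \<Longrightarrow> y \<in> \<O>"
  shows "y \<in> A"
proof -
  obtain w h where "w \<in> A" "h \<noteq> 0" "y = w / hx h" using fraction_hx[of y] by blast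
  thus ?thesis
  proof (induction "degree h" arbitrary: w h rule: less_induct)
    case less
    show ?case
    proof (cases "degree h = 0")
      case True
      then obtain c where c: "h = [:c:]" by (rule degree_eq_zeroE)
      with less.prems have "c \<noteq> 0" by auto
      hence "\<iota> c * \<iota> (inverse c) = 1" by (simp add: iota.hom_1 flip: iota.hom_mult)
      hence "inverse (\<iota> c) = \<iota> (inverse c)" by (rule inverse_unique)
      with less.prems(3) c have "y = w * \<iota> (inverse c)" by (simp add: divide_inverse)
      thus ?thesis using less.prems(1) A_mult iota_in_A by blast
    next
      case False
      have "degree (map_poly to_ac h) = degree h" by (intro degree_map_poly) simp
      then obtain a where a: "eval_ac a h = 0"
        using alg_closed_imp_poly_has_root[of "map_poly to_ac h"] False by (auto simp: eval_ac_def)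
      obtain \<pi> where pi: "\<pi> \<noteq> 0" "degree \<pi> > 0" "\<And>h. eval_ac a h = 0 \<longleftrightarrow> \<pi> dvd h"
        using ex_minimal_poly_ac[OF less.prems(2) a] by blast
      obtain g0 where "w = ev g0" using less.prems(1) unfolding A_def by blast
      then obtain g where g: "w = ev g" "degree g < q" using ev_reduced_exists[of g0] by metis
      define B where "B = {b. b ^ q - b = eval_ac a F}"
      have CHAR_ac: "CHAR('a alg_closure) = p\<^sub>0" by (simp add: CHAR_base)
      have "card B = q"
        using card_power_minus_self_eq[where 'c = "'a alg_closure" and e = e] e_pos prime_p0
        unfolding B_def q_eq CHAR_ac by blast
      \<comment> \<open>Since y is regular at the point below (a, b) and \<open>hx h\<close>
        vanishes there, so does the numerator \<open>w = hx h * y\<close>.\<close>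
      have van: "poly (map_poly (eval_ac a) g) b = 0" if "b \<in> B" for b
      proof -
        interpret geometric_point \<iota> p\<^sub>0 e q F x z a b
          by unfold_locales (use that a less.prems(2) in \<open>auto simp: B_def\<close>)
        interpret L: closed_point \<iota> local_ring using local_ring_closed_point embedding by unfold_locales
        have "hx h \<in> vanishing_ideal"
          using a ev_in_vanishing_ideal[of "[:h:]"] by (simp only: ev_const eval2_ac_const)
        hence "hx h * y \<in> max_ideal local_ring"
          using assms[OF local_ring_closed_point x_in_local_ring]
          by (intro L.max_ideal_mult P_in_max_ideal)
        moreover have "hx h * y = w" using less.prems(2,3) by simp
        ultimately have "w \<in> vanishing_ideal" using max_ideal_inter_A less.prems(1) by simp
        thus ?thesis unfolding g(1) ev_in_vanishing_ideal eval2_ac_def .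
      qed
      have "degree (map_poly (eval_ac a) g) \<le> degree g"
        by (intro degree_le) (simp add: coeff_map_poly comm_hom.hom_0[OF comm_hom_eval_ac] coeff_eq_0)
      hence "map_poly (eval_ac a) g = 0"
        using van g(2) \<open>card B = q\<close> by (intro poly_eqI_degree[of B]) auto
      hence "eval_ac a (coeff g i) = 0" for i
        by (metis coeff_map_poly coeff_0 comm_hom.hom_0[OF comm_hom_eval_ac])
      hence "[:\<pi>:] dvd g" by (simp add: const_poly_dvd_iff pi(3))
      then obtain g' where g': "g = [:\<pi>:] * g'" by (rule dvdE)
      obtain h' where h': "h = \<pi> * h'" using a pi(3) by (auto elim: dvdE)
      have "h' \<noteq> 0" using less.prems(2) h' by auto
      moreover from this have "degree h' < degree h" using pi(1,2) h' by (simp add: degree_mult_eq)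
      moreover have "y = ev g' / hx h'"
        using less.prems(3) pi(1) unfolding g(1) g' h' ev.hom_mult hx.hom_mult by simp
      moreover have "ev g' \<in> A" by (simp add: A_def)
      ultimately show ?thesis using less.hyps by blast
    qed
  qed
qed

end

section \<open>The point at infinity\<close>

lemma comm_hom_const_poly: "comm_hom (\<lambda>c :: 'a::comm_ring_1. [:c:])"
  by unfold_locales (simp_all add: one_pCons)

text \<open>The assumption \<open>q_mod\<close> makes the pole orders q of x and p + 1 of z coprime,
  and it allows a quotient of a power of z by x as local parameter at infinity.\<close>

locale quadratic_as_curve = artin_schreier_curve +
  fixes p :: nat
  assumes p_ge_2: "p \<ge> 2" and q_mod: "(p + 1) dvd (q - 1)"
    and two_nonzero: "(2 :: 'a) \<noteq> 0"
    and F_eq: "F = monom 2 (p + 1) + monom 1 2"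
begin

text \<open>The grading that gives \<open>x\<close> the weight \<open>q\<close> and \<open>z\<close> the weight \<open>p + 1\<close> is the pole order at infinity.
  The leading form \<open>Z\<^sup>q - 2X\<^sup>p\<^sup>+\<^sup>1\<close> of the equation is parametrised by \<open>X = T\<^sup>q\<close>, \<open>Z = 2T\<^sup>p\<^sup>+\<^sup>1\<close>.\<close>

definition psi_x :: "'a poly \<Rightarrow> 'a poly" where
  "psi_x h = poly (map_poly (\<lambda>c. [:c:]) h) (monom 1 q)"

definition psi :: "'a poly poly \<Rightarrow> 'a poly" where
  "psi g = poly (map_poly psi_x g) (monom 2 (p + 1))"

sublocale psi_x: comm_hom psi_x
  unfolding psi_x_def by (rule comm_hom.comm_hom_poly_map[OF comm_hom_const_poly])

sublocale psi: comm_hom psi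
  unfolding psi_def by (rule psi_x.comm_hom_poly_map)

definition weight :: "nat \<Rightarrow> nat \<Rightarrow> nat" where
  "weight i j = q * i + (p + 1) * j"

definition weight_le :: "nat \<Rightarrow> 'a poly poly \<Rightarrow> bool" where
  "weight_le n g \<longleftrightarrow> (\<forall>i j. coeff (coeff g j) i \<noteq> 0 \<longrightarrow> weight i j \<le> n)"

lemma psi_monom: "psi (monom (monom c i) j) = monom (c * 2 ^ j) (weight i j)"
proof -
  have "psi_x (monom c i) = monom c (q * i)"
    unfolding psi_x_def comm_hom.poly_map_hom_monom[OF comm_hom_const_poly]
    by (simp add: monom_power smult_monom)
  thus ?thesis
    unfolding psi_def psi_x.poly_map_hom_monom
    by (simp add: monom_power mult_monom weight_def)
qed

lemma sum_of_bimonoms: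
  fixes g :: "'a poly poly"
  shows "g = (\<Sum>j\<le>degree g. \<Sum>i\<le>degree (coeff g j). monom (monom (coeff (coeff g j) i) i) j)"
proof -
  have "monom (\<Sum>i\<in>I. f i) j = (\<Sum>i\<in>I. monom (f i) j)" for I :: "nat set" and f :: "nat \<Rightarrow> 'a poly" and j
    by (induction I rule: infinite_finite_induct) (simp_all flip: add_monom)
  hence inner: "(\<Sum>i\<le>degree h. monom (monom (coeff h i) i) j) = monom h j" for h :: "'a poly" and j
    using poly_as_sum_of_monoms[of h] by metis
  show ?thesis by (simp only: inner poly_as_sum_of_monoms)
qed

lemma psi_eq_sum:
  "psi g = (\<Sum>j\<le>degree g. \<Sum>i\<le>degree (coeff g j). monom (coeff (coeff g j) i * 2 ^ j) (weight i j))"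
proof -
  have "psi g = psi (\<Sum>j\<le>degree g. \<Sum>i\<le>degree (coeff g j). monom (monom (coeff (coeff g j) i) i) j)"
    using arg_cong[OF sum_of_bimonoms[of g], of psi] .
  thus ?thesis by (simp only: psi.hom_sum psi_monom)
qed

lemma degree_psi_le: assumes "weight_le n g" shows "degree (psi g) \<le> n"
  unfolding psi_eq_sum
proof (intro degree_sum_le)
  fix i j
  show "degree (monom (coeff (coeff g j) i * 2 ^ j) (weight i j)) \<le> n"
  proof (cases "coeff (coeff g j) i = 0")
    case False
    thus ?thesis using assms degree_monom_le[of _ "weight i j"] unfolding weight_le_def
      by (meson order_trans)
  qed simp
qed simp_all

text \<open>q and p + 1 are coprime, so the weight determines j modulo q.\<close>

lemma weight_inj:
  assumes "weight i j = weight i' j'" "j < q" "j' < q"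
  shows "i = i' \<and> j = j'"
proof -
  have "coprime q (p + 1)"
  proof -
    obtain k where k: "q - 1 = (p + 1) * k" using q_mod by (rule dvdE)
    have "gcd q (p + 1) dvd (p + 1) * k" by (intro dvd_mult2 gcd_dvd2)
    hence "gcd q (p + 1) dvd q - (q - 1)" unfolding k[symmetric] by (rule dvd_diff_nat[OF gcd_dvd1])
    thus ?thesis using q_gt_1 by (simp add: coprime_iff_gcd_eq_1)
  qed
  have "[(p + 1) * j = (p + 1) * j'] (mod q)"
    using assms(1) unfolding weight_def cong_def
    by (metis mod_mult_self4)
  hence "[j = j'] (mod q)"
    using \<open>coprime q (p + 1)\<close> by (simp only: cong_mult_lcancel_nat coprime_commute)
  hence "j = j'" using assms(2,3) by (simp add: cong_def)
  thus ?thesis using assms(1) q_gt_1 by (simp add: weight_def)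
qed

text \<open>Distinct monomials of degree below q in Z have distinct weights, so their images under
  \<open>psi\<close> never cancel.\<close>

lemma coeff_psi:
  assumes "degree g < q" "j < q"
  shows "coeff (psi g) (weight i j) = coeff (coeff g j) i * 2 ^ j"
proof -
  have "coeff (psi g) (weight i j) =
      (\<Sum>j'\<le>degree g. \<Sum>i'\<le>degree (coeff g j'). if weight i' j' = weight i j then coeff (coeff g j') i' * 2 ^ j' else 0)"
    unfolding psi_eq_sum by (simp add: coeff_sum)
  also have "\<dots> = (\<Sum>j'\<le>degree g. \<Sum>i'\<le>degree (coeff g j'). if i' = i then if j' = j then coeff (coeff g j) i * 2 ^ j else 0 else 0)"
  proof (intro sum.cong refl)
    fix j' i' assume "j' \<in> {..degree g}"
    hence "j' < q" using assms(1) by simp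
    thus "(if weight i' j' = weight i j then coeff (coeff g j') i' * 2 ^ j' else 0) =
      (if i' = i then if j' = j then coeff (coeff g j) i * 2 ^ j else 0 else 0)"
      using weight_inj[of i' j' i j] assms(2) by auto
  qed
  also have "\<dots> = (\<Sum>j'\<le>degree g. if j' = j then if i \<le> degree (coeff g j) then coeff (coeff g j) i * 2 ^ j else 0 else 0)"
    by (intro sum.cong refl) (simp add: sum.delta)
  also have "\<dots> = coeff (coeff g j) i * 2 ^ j"
    by (auto simp: sum.delta coeff_eq_0)
  finally show ?thesis .
qed

lemma weight_le_degree_psi: assumes "degree g < q" shows "weight_le (degree (psi g)) g"
  unfolding weight_le_def
proof (intro allI impI)
  fix i j assume nz: "coeff (coeff g j) i \<noteq> 0"
  hence "j < q" using assms by (metis coeff_0 coeff_eq_0 linorder_not_less order_less_le_trans)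
  hence "coeff (psi g) (weight i j) \<noteq> 0" using nz two_nonzero coeff_psi[OF assms] by simp
  thus "weight i j \<le> degree (psi g)" by (rule le_degree)
qed

lemma psi_eq_0_iff: assumes "degree g < q" shows "psi g = 0 \<longleftrightarrow> g = 0"
proof
  assume "psi g = 0"
  have "coeff (coeff g j) i = 0" for i j
  proof (cases "j < q")
    case True
    thus ?thesis using coeff_psi[OF assms True, of i] two_nonzero \<open>psi g = 0\<close> by simp
  qed (use assms in \<open>simp add: coeff_eq_0\<close>)
  thus "g = 0" by (simp add: poly_eq_iff)
qed (simp add: psi.hom_0)

lemma weight_le_mult:
  assumes "weight_le m g" "weight_le n h"
  shows "weight_le (m + n) (g * h)"
  unfolding weight_le_def
proof (intro allI impI)
  fix i j assume "coeff (coeff (g * h) j) i \<noteq> 0"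
  then obtain j' where j': "j' \<le> j" "coeff (coeff g j' * coeff h (j - j')) i \<noteq> 0"
    unfolding coeff_mult coeff_sum by (metis (no_types, lifting) sum.neutral atMost_iff)
  then obtain i' where i': "i' \<le> i" "coeff (coeff g j') i' * coeff (coeff h (j - j')) (i - i') \<noteq> 0"
    unfolding coeff_mult by (metis (no_types, lifting) sum.neutral atMost_iff)
  obtain k l where "i = i' + k" "j = j' + l" using i'(1) j'(1) by (metis le_Suc_ex)
  hence "weight i j = weight i' j' + weight (i - i') (j - j')"
    by (simp add: weight_def algebra_simps)
  also have "\<dots> \<le> m + n" using assms i'(2) unfolding weight_le_def by (intro add_mono) auto
  finally show "weight i j \<le> m + n" .
qed

text \<open>Reduction modulo the equation must not raise the weight above n. Only the coefficient of
  \<open>psi\<close> at n has to survive, since the terms X^2 and Z of the equation disturb those at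
  lower exponents.\<close>

definition reducible_to :: "nat \<Rightarrow> 'a poly poly \<Rightarrow> bool" where
  "reducible_to n G \<longleftrightarrow> (\<exists>g. degree g < q \<and> ev g = ev G \<and> weight_le n g \<and> coeff (psi g) n = coeff (psi G) n)"

lemma reducible_to_add:
  assumes "reducible_to n G" "reducible_to n H"
  shows "reducible_to n (G + H)"
proof -
  obtain g h where g: "degree g < q" "ev g = ev G" "weight_le n g" "coeff (psi g) n = coeff (psi G) n"
    and h: "degree h < q" "ev h = ev H" "weight_le n h" "coeff (psi h) n = coeff (psi H) n"
    using assms unfolding reducible_to_def by blast
  have "degree (g + h) < q" using g(1) h(1) by (rule degree_add_less)
  moreover have "weight_le n (g + h)" using g(3) h(3) unfolding weight_le_def
    by (metis add.right_neutral coeff_add add_0)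
  ultimately show ?thesis unfolding reducible_to_def
    using g h by (intro exI[of _ "g + h"]) (simp add: ev.hom_add psi.hom_add)
qed

lemma reducible_to_0: "reducible_to n 0"
  unfolding reducible_to_def using q_gt_1 by (intro exI[of _ 0]) (simp add: weight_le_def)

text \<open>Z^q is replaced by 2X^(p+1) + X^2 + Z. The first term keeps the weight, the other two
  lower it, and the exponent of Z drops in all three.\<close>

lemma reducible_to_monom:
  assumes "weight i j \<le> n"
  shows "reducible_to n (monom (monom c i) j)"
  using assms
proof (induction j arbitrary: i c rule: less_induct)
  case (less j)
  show ?case
  proof (cases "j < q")
    case True
    moreover have "degree (monom (monom c i) j) \<le> j" by (rule degree_monom_le)
    ultimately show ?thesis unfolding reducible_to_def using less.prems
      by (intro exI[of _ "monom (monom c i) j"]) (auto simp: weight_le_def split: if_splits)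
  next
    case False
    define k where "k = j - q"
    have j: "j = k + q" using False by (simp add: k_def)
    have w: "weight (i + p + 1) k = weight i j" "weight (i + 2) k < weight i j" "weight i (k + 1) < weight i j"
    proof -
      have "2 * q < (p + 1) * q" "p + 1 < (p + 1) * q" 
        using mult_strict_right_mono[of 2 "p + 1" q] mult_strict_left_mono[of 1 q "p + 1"] p_ge_2 q_gt_1 by simp_all
      thus "weight (i + p + 1) k = weight i j" "weight (i + 2) k < weight i j" "weight i (k + 1) < weight i j"
        by (simp_all add: weight_def j algebra_simps)
    qed
    define G1 where "G1 = monom (monom (2 * c) (i + p + 1)) k"
    define G2 where "G2 = monom (monom c (i + 2)) k"
    define G3 where "G3 = monom (monom c i) (k + 1)"
    have "reducible_to n G1" "reducible_to n G2" "reducible_to n G3"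
      unfolding G1_def G2_def G3_def using w less.prems q_gt_1 p_ge_2
      by (auto intro!: less.IH simp: j)
    hence "reducible_to n (G1 + (G2 + G3))" by (intro reducible_to_add)
    moreover have "ev (G1 + (G2 + G3)) = ev (monom (monom c i) j)"
    proof -
      have "ev (monom (monom c i) j) = \<iota> c * x ^ i * z ^ k * z ^ q"
        by (simp add: ev_monom hx_monom j power_add ac_simps)
      also have "z ^ q = z + 2 * x ^ (p + 1) + x ^ 2"
        by (simp add: z_power_q F_eq hx.hom_add hx_monom iota.hom_1 iota.hom_numeral)
      finally show ?thesis
        by (simp add: G1_def G2_def G3_def ev.hom_add ev_monom hx_monom iota.hom_mult iota.hom_numeral
            power_add algebra_simps power2_eq_square)
    qed
    moreover have "coeff (psi (G1 + (G2 + G3))) n = coeff (psi (monom (monom c i) j)) n"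
    proof -
      \<comment> \<open>\<open>psi\<close> sends Z^q to 2^q T^(q(p+1)) and 2X^(p+1) to 2 T^(q(p+1));
        the two agree by Fermat's little theorem.\<close>
      have "2 = (2 :: 'a) ^ q"
      proof -
        have "[:2 :: 'a:] = [:2:] ^ q"
          using prime_p0 of_nat_power_CHAR_power[where 'b = 'a, of 2 e] by (simp add: CHAR_base q_eq poly_const_pow)
        thus ?thesis by (simp add: poly_const_pow)
      qed
      moreover have "psi G2 = monom (c * 2 ^ k) (weight (i + 2) k)" "psi G3 = monom (c * 2 ^ (k + 1)) (weight i (k + 1))"
        unfolding G2_def G3_def by (rule psi_monom)+
      hence "coeff (psi G2) n = 0" "coeff (psi G3) n = 0" using w less.prems by auto
      moreover have "psi G1 = monom (2 * c * 2 ^ k) (weight i j)"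
        unfolding G1_def psi_monom w(1) ..
      ultimately show ?thesis by (simp add: psi.hom_add psi_monom j power_add ac_simps)
    qed
    ultimately show ?thesis unfolding reducible_to_def by simp
  qed
qed

lemma weight_le_imp_reducible_to: assumes "weight_le n G" shows "reducible_to n G"
proof -
  have sum: "reducible_to n (\<Sum>i\<in>I. f i)" if "\<And>i. i \<in> I \<Longrightarrow> reducible_to n (f i)" for I :: "nat set" and f
    using that by (induction I rule: infinite_finite_induct) (simp_all add: reducible_to_0 reducible_to_add)
  have "reducible_to n (monom (monom (coeff (coeff G j) i) i) j)" for i j
    using assms reducible_to_monom reducible_to_0 
    by (cases "coeff (coeff G j) i = 0") (auto simp: weight_le_def)
  hence "reducible_to n (\<Sum>j\<le>degree G. \<Sum>i\<le>degree (coeff G j). monom (monom (coeff (coeff G j) i) i) j)"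
    by (intro sum)
  thus ?thesis by (simp only: sum_of_bimonoms[of G, symmetric])
qed

end

section \<open>The valuation defined by the pole order\<close>

context quadratic_as_curve
begin

definition reduced :: "'b \<Rightarrow> 'a poly poly" where
  "reduced y = (THE g. degree g < q \<and> ev g = y)"

lemma reduced_ev: "degree g < q \<Longrightarrow> reduced (ev g) = g"
  unfolding reduced_def by (rule the_equality) (auto intro: ev_inj)

lemma reduced_props: assumes "y \<in> A" shows "degree (reduced y) < q" "ev (reduced y) = y"
proof -
  obtain g where g: "degree g < q" "ev g = y" using assms ev_reduced_exists unfolding A_def by blast
  hence "reduced y = g" using reduced_ev by blast
  thus "degree (reduced y) < q" "ev (reduced y) = y" using g by simp_all
qed

definition symb :: "'b \<Rightarrow> 'a poly" where "symb y = psi (reduced y)"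

text \<open>Zero receives the value 0, just like the nonzero constants, so the rule for products is
  restricted to nonzero factors.\<close>

definition pole :: "'b \<Rightarrow> nat" where "pole y = degree (symb y)"

lemma symb_ev: "degree g < q \<Longrightarrow> symb (ev g) = psi g"
  by (simp add: symb_def reduced_ev)

lemma symb_eq_0_iff: "y \<in> A \<Longrightarrow> symb y = 0 \<longleftrightarrow> y = 0"
  using reduced_props[of y] reduced_ev[of 0] q_gt_1
  by (auto simp: symb_def psi_eq_0_iff ev.hom_0)

lemma symb_add: assumes "y \<in> A" "y' \<in> A" shows "symb (y + y') = symb y + symb y'"
proof -
  have "symb (ev (reduced y + reduced y')) = psi (reduced y + reduced y')"
    using reduced_props assms by (intro symb_ev degree_add_less)
  thus ?thesis using reduced_props assms by (simp add: ev.hom_add psi.hom_add symb_def)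
qed

lemma symb_scale: assumes "y \<in> A" shows "symb (\<iota> c * y) = smult c (symb y)"
proof -
  have "degree (smult [:c:] (reduced y)) < q"
    using reduced_props[OF assms] degree_smult_le[of "[:c:]" "reduced y"] by simp
  hence "symb (ev (smult [:c:] (reduced y))) = psi (smult [:c:] (reduced y))" by (rule symb_ev)
  also have "smult [:c:] (reduced y) = [:[:c:]:] * reduced y" by simp
  also have "psi \<dots> = psi (monom (monom c 0) 0) * psi (reduced y)"
    by (simp only: psi.hom_mult monom_0)
  also have "\<dots> = smult c (psi (reduced y))"
    unfolding psi_monom by (simp add: weight_def monom_0)
  finally show ?thesis using reduced_props[OF assms] by (simp add: symb_def ev_smult)
qed

lemma pole_add_le: "y \<in> A \<Longrightarrow> y' \<in> A \<Longrightarrow> pole (y + y') \<le> max (pole y) (pole y')"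
  by (simp add: pole_def symb_add degree_add_le_max)

text \<open>\<open>psi\<close> is multiplicative before reduction and k[T] is a domain, so the
  product of the leading coefficients is nonzero; \<open>reducible_to\<close> carries it over to the
  reduced product.\<close>

lemma pole_mult:
  assumes "y \<in> A" "y' \<in> A" "y \<noteq> 0" "y' \<noteq> 0"
  shows "pole (y * y') = pole y + pole y'"
proof -
  define g g' where "g = reduced y" and "g' = reduced y'"
  have g: "degree g < q" "ev g = y" "degree g' < q" "ev g' = y'"
    using reduced_props assms by (simp_all add: g_def g'_def)
  define n where "n = pole y + pole y'"
  have n: "n = degree (psi g) + degree (psi g')" by (simp add: n_def pole_def symb_def g_def g'_def)
  have "weight_le n (g * g')" unfolding n by (intro weight_le_mult weight_le_degree_psi g)
  then obtain r where r: "degree r < q" "ev r = ev (g * g')" "weight_le n r"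
    "coeff (psi r) n = coeff (psi (g * g')) n"
    using weight_le_imp_reducible_to unfolding reducible_to_def by blast
  have "coeff (psi (g * g')) n = lead_coeff (psi g) * lead_coeff (psi g')"
    unfolding psi.hom_mult n by (rule coeff_mult_degree_sum)
  moreover have "psi g \<noteq> 0" "psi g' \<noteq> 0"
    using symb_eq_0_iff assms by (simp_all add: g_def g'_def symb_def)
  ultimately have "coeff (psi r) n \<noteq> 0" unfolding r(4) by simp
  hence "degree (psi r) = n" using degree_psi_le[OF r(3)] le_degree by (metis antisym)
  moreover have "y * y' = ev r" using r(2) g by (simp add: ev.hom_mult)
  ultimately show ?thesis using symb_ev[OF r(1)] by (simp add: pole_def n_def)
qed

lemma pole_monom: "c \<noteq> 0 \<Longrightarrow> j < q \<Longrightarrow> pole (\<iota> c * x ^ i * z ^ j) = weight i j"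
  using symb_ev[of "monom (monom c i) j"] degree_monom_le[of "monom c i" j] two_nonzero
  by (simp add: ev_monom hx_monom psi_monom pole_def degree_monom_eq)

lemma pole_iota: "pole (\<iota> c) = 0"
  using pole_monom[of c 0 0] symb_eq_0_iff[OF zero_in_A] q_gt_1
  by (cases "c = 0") (simp_all add: weight_def iota.hom_0 pole_def)

lemma pole_x: "pole x = q"
  using pole_monom[of 1 0 1] q_gt_1 by (simp add: weight_def iota.hom_1)

lemma pole_z: "pole z = p + 1"
  using pole_monom[of 1 1 0] q_gt_1 by (simp add: weight_def iota.hom_1)

lemma pole_power: "y \<in> A \<Longrightarrow> y \<noteq> 0 \<Longrightarrow> pole (y ^ n) = n * pole y"
  using pole_iota[of 1]
  by (induction n) (simp_all add: iota.hom_1 pole_mult A_power)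

text \<open>The leading coefficients of symbols lie in k itself. This is what makes the residue
  field at infinity equal to k.\<close>

lemma pole_cancel:
  assumes "y \<in> A" "y' \<in> A" "y' \<noteq> 0" "pole y = pole y'"
  shows "\<exists>c. y - \<iota> c * y' = 0 \<or> pole (y - \<iota> c * y') < pole y"
proof -
  define c where "c = lead_coeff (symb y) / lead_coeff (symb y')"
  define d where "d = y - \<iota> c * y'"
  have dA: "d \<in> A" unfolding d_def using assms by (intro A_diff A_mult iota_in_A)
  have "d = y + \<iota> (- c) * y'" by (simp add: d_def iota.hom_minus)
  hence d: "symb d = symb y + smult (- c) (symb y')"
    using assms by (simp only: symb_add symb_scale A_mult iota_in_A)
  have "symb y' \<noteq> 0" using assms symb_eq_0_iff by simp
  hence "coeff (symb d) (pole y) = 0"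
    using assms(4) unfolding d by (simp add: c_def pole_def)
  moreover have "degree (symb d) \<le> pole y"
    unfolding d using assms(4) degree_smult_le[of "- c" "symb y'"]
    by (intro degree_add_le) (simp_all add: pole_def)
  ultimately have "symb d = 0 \<or> degree (symb d) < pole y"
    by (metis le_neq_implies_less leading_coeff_0_iff)
  thus ?thesis using symb_eq_0_iff[OF dA] by (auto simp: pole_def d_def)
qed

text \<open>Minus the valuation at infinity; additivity of \<open>pole\<close> makes it independent
  of the fraction. At 0 no such fraction exists, so \<open>O_inf\<close> admits 0
  separately.\<close>

definition pole_inf :: "'b \<Rightarrow> int" where
  "pole_inf a = (THE n. \<exists>u v. u \<in> A \<and> v \<in> A \<and> u \<noteq> 0 \<and> v \<noteq> 0 \<and> a = u / v \<and> n = int (pole u) - int (pole v))"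

lemma pole_inf_divide:
  assumes "u \<in> A" "v \<in> A" "u \<noteq> 0" "v \<noteq> 0"
  shows "pole_inf (u / v) = int (pole u) - int (pole v)"
  unfolding pole_inf_def
proof (rule the_equality)
  show "\<exists>u' v'. u' \<in> A \<and> v' \<in> A \<and> u' \<noteq> 0 \<and> v' \<noteq> 0 \<and> u / v = u' / v' \<and>
      int (pole u) - int (pole v) = int (pole u') - int (pole v')"
    using assms by blast
next
  fix n assume "\<exists>u' v'. u' \<in> A \<and> v' \<in> A \<and> u' \<noteq> 0 \<and> v' \<noteq> 0 \<and> u / v = u' / v' \<and> n = int (pole u') - int (pole v')"
  then obtain u' v' where *: "u' \<in> A" "v' \<in> A" "u' \<noteq> 0" "v' \<noteq> 0" "u / v = u' / v'"
    "n = int (pole u') - int (pole v')" by blast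
  hence "u * v' = u' * v" using assms by (simp add: frac_eq_eq)
  hence "pole u + pole v' = pole u' + pole v" using pole_mult * assms by metis
  thus "n = int (pole u) - int (pole v)" using *(6) by simp
qed

lemma fraction_A: assumes "a \<noteq> 0" obtains u v where "u \<in> A" "v \<in> A" "u \<noteq> 0" "v \<noteq> 0" "a = u / v"
proof -
  obtain y h where "y \<in> A" "h \<noteq> 0" "a = y / hx h" using fraction_hx[of a] by blast
  with assms show ?thesis using that[of y "hx h"] hx_in_A by auto
qed

lemma pole_inf_A: "y \<in> A \<Longrightarrow> y \<noteq> 0 \<Longrightarrow> pole_inf y = int (pole y)"
  using pole_inf_divide[OF _ one_in_A, of y] pole_iota[of 1] by (simp add: iota.hom_1)

lemma pole_inf_mult:
  assumes "a \<noteq> 0" "b \<noteq> 0" shows "pole_inf (a * b) = pole_inf a + pole_inf b"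
proof -
  obtain u v where a: "u \<in> A" "v \<in> A" "u \<noteq> 0" "v \<noteq> 0" "a = u / v" using assms(1) by (rule fraction_A)
  obtain u' v' where b: "u' \<in> A" "v' \<in> A" "u' \<noteq> 0" "v' \<noteq> 0" "b = u' / v'" using assms(2) by (rule fraction_A)
  have "pole_inf ((u * u') / (v * v')) = int (pole (u * u')) - int (pole (v * v'))"
    using a b by (intro pole_inf_divide A_mult) auto
  thus ?thesis using a b by (simp add: pole_inf_divide pole_mult)
qed

lemma pole_inf_one: "pole_inf 1 = 0"
  using pole_inf_A[OF one_in_A] pole_iota[of 1] by (simp add: iota.hom_1)

lemma pole_inf_inverse: "a \<noteq> 0 \<Longrightarrow> pole_inf (inverse a) = - pole_inf a"
  using pole_inf_mult[of a "inverse a"] by (simp add: pole_inf_one)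

lemma pole_inf_power: "a \<noteq> 0 \<Longrightarrow> pole_inf (a ^ n) = int n * pole_inf a"
  by (induction n) (simp_all add: pole_inf_one pole_inf_mult algebra_simps)

lemma pole_inf_powi: "a \<noteq> 0 \<Longrightarrow> pole_inf (a powi n) = n * pole_inf a"
  by (simp add: power_int_def pole_inf_power pole_inf_inverse)

lemma pole_inf_iota: "c \<noteq> 0 \<Longrightarrow> pole_inf (\<iota> c) = 0"
  using pole_inf_A[OF iota_in_A, of c] hx_eq_0_iff[of "[:c:]"] by (simp add: pole_iota)

lemma pole_inf_add:
  assumes "a \<noteq> 0" "b \<noteq> 0" "a + b \<noteq> 0" shows "pole_inf (a + b) \<le> max (pole_inf a) (pole_inf b)"
proof -
  obtain u v where a: "u \<in> A" "v \<in> A" "u \<noteq> 0" "v \<noteq> 0" "a = u / v" using assms(1) by (rule fraction_A)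
  obtain u' v' where b: "u' \<in> A" "v' \<in> A" "u' \<noteq> 0" "v' \<noteq> 0" "b = u' / v'" using assms(2) by (rule fraction_A)
  have ab: "a + b = (u * v' + u' * v) / (v * v')" using a b by (simp add: field_simps)
  with assms have nz: "u * v' + u' * v \<noteq> 0" by auto
  have "pole_inf (a + b) = int (pole (u * v' + u' * v)) - int (pole (v * v'))"
    unfolding ab using a b nz by (intro pole_inf_divide A_add A_mult) auto
  also have "pole (u * v' + u' * v) \<le> max (pole (u * v')) (pole (u' * v))"
    using a b by (intro pole_add_le A_mult) auto
  finally have "pole_inf (a + b) \<le> int (max (pole (u * v')) (pole (u' * v))) - int (pole (v * v'))" by simp
  thus ?thesis using a b by (simp add: pole_inf_divide pole_mult max_def split: if_splits)
qed

lemma pole_inf_cancel: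
  assumes "a \<noteq> 0" "pole_inf a = 0" shows "\<exists>c. a - \<iota> c = 0 \<or> pole_inf (a - \<iota> c) < 0"
proof -
  obtain u v where a: "u \<in> A" "v \<in> A" "u \<noteq> 0" "v \<noteq> 0" "a = u / v" using assms(1) by (rule fraction_A)
  hence "pole u = pole v" using assms(2) pole_inf_divide by simp
  then obtain c where c: "u - \<iota> c * v = 0 \<or> pole (u - \<iota> c * v) < pole u"
    using pole_cancel a by blast
  have ac: "a - \<iota> c = (u - \<iota> c * v) / v" using a by (simp add: field_simps)
  have "u - \<iota> c * v \<in> A" using a by (intro A_diff A_mult iota_in_A)
  hence "a - \<iota> c = 0 \<or> pole_inf (a - \<iota> c) < 0"
    using c a \<open>pole u = pole v\<close> unfolding ac by (cases "u - \<iota> c * v = 0") (auto simp: pole_inf_divide)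
  thus ?thesis by blast
qed

definition O_inf :: "'b set" where "O_inf = {a. a = 0 \<or> pole_inf a \<le> 0}"

lemma x_nonzero: "x \<noteq> 0" and z_nonzero: "z \<noteq> 0"
  using pole_x pole_z pole_iota[of 0] q_gt_1 by (auto simp: iota.hom_0)

lemma O_inf_closed_point: "O_inf \<in> closed_points \<iota>"
proof -
  have neg: "- a \<in> O_inf" if "a \<in> O_inf" for a
    using that pole_inf_mult[of "- 1" a] pole_inf_iota[of "- 1"]
    by (cases "a = 0") (auto simp: O_inf_def iota.hom_minus iota.hom_1)
  have add: "a + b \<in> O_inf" if "a \<in> O_inf" "b \<in> O_inf" for a b
    using that pole_inf_add[of a b] by (cases "a = 0"; cases "b = 0"; cases "a + b = 0") (auto simp: O_inf_def)
  have "a - b \<in> O_inf" if "a \<in> O_inf" "b \<in> O_inf" for a b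
    using add[OF that(1) neg[OF that(2)]] by simp
  moreover have "a * b \<in> O_inf" if "a \<in> O_inf" "b \<in> O_inf" for a b
    using that pole_inf_mult[of a b] by (cases "a = 0"; cases "b = 0") (auto simp: O_inf_def)
  moreover have "a \<in> O_inf \<or> inverse a \<in> O_inf" for a
    using pole_inf_inverse[of a] by (cases "a = 0") (auto simp: O_inf_def)
  moreover have "x \<notin> O_inf" using x_nonzero pole_x q_gt_1 pole_inf_A[OF x_in_A] by (simp add: O_inf_def)
  hence "O_inf \<subset> UNIV" by blast
  moreover have "\<iota> c \<in> O_inf" for c
    using pole_inf_iota[of c] by (cases "c = 0") (auto simp: O_inf_def iota.hom_0)
  moreover have "inverse x \<in> O_inf" using x_nonzero pole_inf_inverse[of x] pole_inf_A[OF x_in_A] by (simp add: O_inf_def)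
  moreover have "inverse x \<notin> range \<iota>"
  proof
    assume "inverse x \<in> range \<iota>"
    then obtain c where c: "inverse x = \<iota> c" by blast
    hence "c \<noteq> 0" using x_nonzero by (auto simp: iota.hom_0)
    hence "pole_inf (inverse x) = 0" unfolding c by (rule pole_inf_iota)
    thus False using x_nonzero pole_inf_inverse[of x] pole_inf_A[OF x_in_A] pole_x q_gt_1 by simp
  qed
  ultimately show ?thesis unfolding closed_points_def by (auto simp: psubset_eq)
qed

sublocale inf: closed_point \<iota> O_inf
  using O_inf_closed_point embedding by unfold_locales

lemma max_ideal_inf: "a \<in> max_ideal O_inf \<longleftrightarrow> a = 0 \<or> pole_inf a < 0"
  unfolding inf.max_ideal_iff using pole_inf_inverse[of a] by (auto simp: O_inf_def)

lemma unit_set_inf: "a \<in> unit_set O_inf \<longleftrightarrow> a \<noteq> 0 \<and> pole_inf a = 0"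
  using pole_inf_inverse[of a] by (auto simp: unit_set_def O_inf_def)

lemma inf_local_parameter: "\<exists>t. local_parameter \<iota> O_inf t \<and> pole_inf t = - 1"
proof -
  obtain s where s: "q - 1 = (p + 1) * s" using q_mod by (rule dvdE)
  \<comment> \<open>The numerator has a pole of order s(p + 1) = q - 1 and x has one of order q,
    which leaves a simple zero.\<close>
  define t where "t = z ^ s / x"
  have t0: "t \<noteq> 0" using x_nonzero z_nonzero by (simp add: t_def)
  have "pole_inf t = int (s * (p + 1)) - int q"
    unfolding t_def using x_nonzero z_nonzero
    by (subst pole_inf_divide) (simp_all add: A_power x_in_A z_in_A pole_power pole_z pole_x)
  also have "s * (p + 1) = q - 1" using s by (simp only: mult.commute)
  finally have t: "pole_inf t = - 1" using q_gt_1 by simp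
  have "local_parameter \<iota> O_inf t"
  proof
    show "t \<in> max_ideal O_inf" "t \<noteq> 0" using t t0 by (simp_all add: max_ideal_inf)
    fix a :: 'b assume a: "a \<noteq> 0"
    define u where "u = a * t powi (pole_inf a)"
    have "u \<in> unit_set O_inf" using a t t0
      by (simp add: u_def unit_set_inf pole_inf_mult pole_inf_powi)
    moreover have "a = t powi (- pole_inf a) * u" using t0 by (simp add: u_def power_int_minus)
    ultimately show "\<exists>n u. u \<in> unit_set O_inf \<and> a = t powi n * u" by blast
  qed
  thus ?thesis using t by blast
qed

lemma ord_at_inf: assumes "a \<noteq> 0" shows "ord_at O_inf a = - pole_inf a"
proof -
  obtain t where "local_parameter \<iota> O_inf t" and t: "pole_inf t = - 1" using inf_local_parameter by blast
  then interpret local_parameter \<iota> O_inf t by simp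
  obtain n u where "u \<in> unit_set O_inf" "a = t powi n * u" using decomp[OF assms] by blast
  thus ?thesis using t_nonzero t
    by (simp add: ord_at_eq unit_set_inf pole_inf_mult pole_inf_powi)
qed

end

section \<open>Uniqueness of the point at which x has a pole\<close>

context closed_point
begin

text \<open>At a point where x has a pole, functions are controlled below only through their q-th
  powers. This lemma and the next one lead back to the functions themselves.\<close>

lemma power_unit_imp_unit:
  assumes "n > 0" "a ^ n \<in> unit_set \<O>" shows "a \<in> unit_set \<O>"
proof -
  obtain m where m: "n = Suc m" using assms(1) gr0_conv_Suc by blast
  have a0: "a \<noteq> 0" using unit_nonzero[OF assms(2)] m by auto
  have 1: "b \<notin> max_ideal \<O>" if "b ^ n \<in> unit_set \<O>" for b
    using that max_ideal_mult[of b "b ^ m"] by (auto simp: m unit_iff power_closed max_ideal_subset)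
  have "inverse a ^ n \<in> unit_set \<O>" using unit_inverse[OF assms(2)] by (simp add: power_inverse)
  hence "inverse a \<notin> max_ideal \<O>" by (rule 1)
  hence "a \<in> \<O>" using notin_imp_inverse by blast
  thus ?thesis using 1[OF assms(2)] by (simp add: unit_iff)
qed

lemma power_max_ideal_imp_max_ideal:
  assumes "n > 0" "a ^ n \<in> max_ideal \<O>" shows "a \<in> max_ideal \<O>"
proof -
  obtain m where m: "n = Suc m" using assms(1) gr0_conv_Suc by blast
  have "a \<in> \<O>"
  proof (rule ccontr)
    assume a: "a \<notin> \<O>"
    hence a0: "a \<noteq> 0" using zero_closed by auto
    have "inverse a ^ n \<in> \<O>" using notin_imp_inverse[OF a] by (intro power_closed max_ideal_subset)
    hence "a ^ n * inverse a ^ n \<in> max_ideal \<O>" using assms(2) by (rule max_ideal_mult[rotated])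
    thus False using a0 one_notin_max_ideal by (simp flip: power_mult_distrib)
  qed
  thus ?thesis using assms(2) max_ideal_power by blast
qed

lemma iota_unit: "c \<noteq> 0 \<Longrightarrow> \<iota> c \<in> unit_set \<O>"
proof -
  interpret comm_hom \<iota> using embedding by (rule field_embedding_comm_hom)
  assume "c \<noteq> 0"
  hence "\<iota> c * \<iota> (inverse c) = 1" by (simp add: hom_1 flip: hom_mult)
  hence "\<iota> c \<noteq> 0" "inverse (\<iota> c) = \<iota> (inverse c)" by (auto simp: inverse_unique)
  thus ?thesis by (simp add: unit_set_def range_subset)
qed

end

locale infinite_closed_point = quadratic_as_curve +
  fixes \<O>
  assumes closed_O: "\<O> \<in> closed_points \<iota>" and x_notin_O: "x \<notin> \<O>"
begin

sublocale O: closed_point \<iota> \<O>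
  using closed_O embedding by unfold_locales

lemma inverse_x: "inverse x \<in> max_ideal \<O>"
  using x_notin_O by (rule O.notin_imp_inverse)

lemma inverse_x_power: assumes "n > 0" shows "inverse x ^ n \<in> max_ideal \<O>"
proof -
  obtain m where "n = Suc m" using assms gr0_conv_Suc by blast
  thus ?thesis using inverse_x by (simp add: O.max_ideal_mult O.power_closed O.max_ideal_subset)
qed

text \<open>Divided by x^(p+1), the right-hand side of the equation becomes the unit 2 + x^(1-p), as
  2 is nonzero and 1/x is in the maximal ideal. This also forces a pole of z, so z^q - z is z^q
  times a unit.\<close>

lemma leading_unit: "z ^ q / x ^ (p + 1) \<in> unit_set \<O>"
proof -
  define v where "v = \<iota> 2 + inverse x ^ (p - 1)"
  have v: "v \<in> unit_set \<O>"
    unfolding v_def using two_nonzero p_ge_2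
    by (intro O.unit_plus_max_ideal O.iota_unit inverse_x_power) auto
  have hxF: "hx F * inverse x ^ (p + 1) = v"
  proof -
    have "p + 1 = 2 + (p - 1)" using p_ge_2 by simp
    hence "inverse x ^ (p + 1) = inverse x ^ 2 * inverse x ^ (p - 1)" by (simp only: power_add)
    moreover have pw: "x ^ n * inverse x ^ n = 1" for n
      by (simp only: power_mult_distrib[symmetric] right_inverse[OF x_nonzero] power_one)
    note pw[of 2] pw[of "p + 1"]
    ultimately have 1: "x ^ 2 * inverse x ^ (p + 1) = inverse x ^ (p - 1)" "x ^ (p + 1) * inverse x ^ (p + 1) = 1"
      by (simp_all only: mult.assoc[symmetric] mult_1_left)
    have "hx F = \<iota> 2 * x ^ (p + 1) + x ^ 2"
      unfolding F_eq hx.hom_add hx_monom iota.hom_1 by simp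
    hence "hx F * inverse x ^ (p + 1) = \<iota> 2 * (x ^ (p + 1) * inverse x ^ (p + 1)) + x ^ 2 * inverse x ^ (p + 1)"
      by (simp only: distrib_right mult.assoc)
    thus ?thesis unfolding 1 v_def by simp
  qed
  have z: "z \<notin> \<O>"
  proof
    assume "z \<in> \<O>"
    hence "z ^ q - z \<in> \<O>" by (intro O.diff_closed O.power_closed)
    hence "hx F \<in> \<O>" by (simp add: z_power_q)
    hence "inverse x ^ (p + 1) * hx F \<in> max_ideal \<O>" by (intro O.max_ideal_mult inverse_x_power) simp
    hence "v \<in> max_ideal \<O>" by (simp only: hxF[symmetric] mult.commute)
    thus False using v by (simp add: O.unit_iff)
  qed
  have "inverse z ^ (q - 1) \<in> max_ideal \<O>"
  proof -
    obtain m where "q - 1 = Suc m" using q_gt_1 by (metis zero_less_diff gr0_conv_Suc)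
    thus ?thesis using O.notin_imp_inverse[OF z]
      by (simp add: O.max_ideal_mult O.power_closed O.max_ideal_subset)
  qed
  hence u: "1 + (- (inverse z ^ (q - 1))) \<in> unit_set \<O>"
    using O.iota_unit[of 1] by (intro O.unit_plus_max_ideal O.max_ideal_minus) (simp_all add: iota.hom_1)
  have "z ^ q * inverse z ^ (q - 1) = z"
  proof -
    have "q = Suc (q - 1)" using q_gt_1 by simp
    hence "z ^ q = z * z ^ (q - 1)" by (metis power_Suc)
    hence "z ^ q * inverse z ^ (q - 1) = z * (z * inverse z) ^ (q - 1)" by (simp only: power_mult_distrib mult.assoc)
    thus ?thesis using z_nonzero by simp
  qed
  hence "z ^ q * (1 + (- (inverse z ^ (q - 1)))) = z ^ q - z" by (simp add: algebra_simps)
  also have "\<dots> = hx F" by (simp add: z_power_q)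
  finally have eq: "z ^ q * (1 + (- (inverse z ^ (q - 1)))) = hx F" .
  have "z ^ q * inverse x ^ (p + 1) * (1 + (- (inverse z ^ (q - 1)))) =
      z ^ q * (1 + (- (inverse z ^ (q - 1)))) * inverse x ^ (p + 1)"
    by (simp only: mult.assoc mult.commute[of "inverse x ^ (p + 1)"])
  also have "\<dots> = v" unfolding eq by (rule hxF)
  finally have "z ^ q * inverse x ^ (p + 1) * (1 + (- (inverse z ^ (q - 1)))) = v" .
  hence "z ^ q * inverse x ^ (p + 1) = v * inverse (1 + (- (inverse z ^ (q - 1))))"
    using O.unit_nonzero[OF u] by (simp add: eq_divide_eq flip: divide_inverse)
  also have "\<dots> \<in> unit_set \<O>" using v u by (intro O.unit_mult O.unit_inverse)
  finally show ?thesis by (simp add: divide_inverse power_inverse)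
qed

lemma pole_eq_weight:
  assumes "y \<in> A" "y \<noteq> 0" obtains i j where "j < q" "pole y = weight i j"
proof -
  define g where "g = reduced y"
  have g: "degree g < q" using reduced_props[OF assms(1)] by (simp add: g_def)
  define n where "n = degree (psi g)"
  have "coeff (psi g) n \<noteq> 0" using symb_eq_0_iff assms by (simp add: g_def symb_def n_def)
  also have "coeff (psi g) n = (\<Sum>j\<le>degree g. \<Sum>i\<le>degree (coeff g j).
      coeff (monom (coeff (coeff g j) i * 2 ^ j) (weight i j)) n)"
    unfolding psi_eq_sum coeff_sum ..
  finally obtain j i where "j \<le> degree g"
    "coeff (monom (coeff (coeff g j) i * 2 ^ j) (weight i j)) n \<noteq> 0"
    by (metis (no_types, lifting) sum.neutral atMost_iff)
  hence "j < q" "pole y = weight i j"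
    using g by (auto simp: pole_def symb_def g_def n_def split: if_splits)
  thus ?thesis using that by blast
qed

text \<open>As \<open>z\<^sup>q\<close> is \<open>x\<^sup>p\<^sup>+\<^sup>1\<close> up to a unit, the \<open>q\<close>-th power of a monomial of weight \<open>n\<close> is \<open>x\<^sup>n\<close> up to a unit.\<close>

lemma power_q_div_unit:
  assumes "y \<in> A" "y \<noteq> 0"
  shows "y ^ q * inverse x ^ pole y \<in> unit_set \<O>"
  using assms
proof (induction "pole y" arbitrary: y rule: less_induct)
  case less
  obtain i j where ij: "j < q" "pole y = weight i j" using less.prems by (rule pole_eq_weight)
  define w where "w = x ^ i * z ^ j"
  have w: "w \<in> A" "w \<noteq> 0" "pole w = pole y"
    using pole_monom[of 1 j i] ij x_nonzero z_nonzero
    by (auto simp: w_def iota.hom_1 intro!: A_mult A_power x_in_A z_in_A)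
  \<comment> \<open>A multiple of the monomial with the same pole order is split off. The q-th power
    is additive, so the remainder d can be treated by induction and contributes only to the maximal
    ideal.\<close>
  obtain c where c: "y - \<iota> c * w = 0 \<or> pole (y - \<iota> c * w) < pole y"
    using pole_cancel[OF less.prems(1) w(1,2)] w(3) by metis
  define d where "d = y - \<iota> c * w"
  have dA: "d \<in> A" unfolding d_def using less.prems w by (intro A_diff A_mult iota_in_A)
  have c0: "c \<noteq> 0"
  proof
    assume "c = 0"
    with c less.prems show False by (simp add: iota.hom_0)
  qed
  have "w ^ q * inverse x ^ weight i j = (z ^ q / x ^ (p + 1)) ^ j"
  proof -
    have "w ^ q * inverse x ^ weight i j = (x ^ (q * i) * inverse x ^ (q * i)) * (z ^ (q * j) * inverse x ^ ((p + 1) * j))"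
      by (simp only: w_def weight_def power_mult_distrib power_add power_mult[symmetric] mult.commute[of q] ac_simps)
    also have "x ^ (q * i) * inverse x ^ (q * i) = 1" using x_nonzero by (simp flip: power_mult_distrib)
    finally show ?thesis by (simp only: mult_1_left divide_inverse power_mult_distrib power_mult power_inverse)
  qed
  hence w_unit: "w ^ q * inverse x ^ pole y \<in> unit_set \<O>"
    using O.unit_power[OF leading_unit, of j] by (simp only: ij(2))
  have "y ^ q = (\<iota> c * w + d) ^ (p\<^sub>0 ^ e)" by (simp add: d_def q_eq)
  also have "\<dots> = \<iota> c * w ^ q + d ^ q" by (simp only: power_add_K power_mult_distrib iota_power q_eq)
  finally have y: "y ^ q * inverse x ^ pole y = \<iota> c * (w ^ q * inverse x ^ pole y) + d ^ q * inverse x ^ pole y"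
    by (simp only: distrib_right mult.assoc)
  have "d ^ q * inverse x ^ pole y \<in> max_ideal \<O>"
  proof (cases "d = 0")
    case True
    thus ?thesis using q_gt_1 O.max_ideal_zero by (simp add: power_0_left)
  next
    case False
    hence lt: "pole d < pole y" using c by (simp add: d_def)
    hence "d ^ q * inverse x ^ pole d \<in> unit_set \<O>" using less.hyps dA False by blast
    hence "inverse x ^ (pole y - pole d) * (d ^ q * inverse x ^ pole d) \<in> max_ideal \<O>"
      using lt by (intro O.max_ideal_mult inverse_x_power) (auto simp: unit_set_def)
    also have "inverse x ^ (pole y - pole d) * (d ^ q * inverse x ^ pole d) = d ^ q * inverse x ^ (pole y - pole d + pole d)"
      by (simp only: power_add ac_simps)
    finally show ?thesis using lt by simp
  qed
  thus ?case unfolding y by (intro O.unit_plus_max_ideal O.unit_mult[OF O.iota_unit w_unit] c0)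
qed

lemma pole_inf_power_q:
  assumes "a \<noteq> 0" "pole_inf a \<le> 0"
  shows "\<exists>u\<in>unit_set \<O>. a ^ q = inverse x ^ nat (- pole_inf a) * u"
proof -
  obtain u v where a: "u \<in> A" "v \<in> A" "u \<noteq> 0" "v \<noteq> 0" "a = u / v" using assms(1) by (rule fraction_A)
  define n where "n = nat (- pole_inf a)"
  have n: "pole v = n + pole u" using assms(2) a by (simp add: n_def pole_inf_divide)
  define u' v' where "u' = u ^ q * inverse x ^ pole u" and "v' = v ^ q * inverse x ^ pole v"
  have uv: "u' \<in> unit_set \<O>" "v' \<in> unit_set \<O>" using power_q_div_unit a by (simp_all add: u'_def v'_def)
  have "inverse x ^ n * (u' / v') = a ^ q"
    using a x_nonzero unfolding u'_def v'_def n by (simp add: power_add power_divide)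
  moreover have "u' / v' \<in> unit_set \<O>" using uv by (simp add: divide_inverse O.unit_mult O.unit_inverse)
  ultimately show ?thesis unfolding n_def by metis
qed

text \<open>Comparing q-th powers shows that \<O> contains \<open>O_inf\<close> and that its maximal
  ideal contains the one of \<open>O_inf\<close>; for valuation rings such domination is
  equality.\<close>

lemma O_eq_O_inf: "\<O> = O_inf"
proof -
  have 1: "a \<in> max_ideal \<O>" if "a \<in> max_ideal O_inf" for a
  proof (cases "a = 0")
    case False
    hence neg: "pole_inf a < 0" using that max_ideal_inf by blast
    then obtain u where u: "u \<in> unit_set \<O>" "a ^ q = inverse x ^ nat (- pole_inf a) * u"
      using pole_inf_power_q[OF False] by auto
    have "inverse x ^ nat (- pole_inf a) * u \<in> max_ideal \<O>"
      using neg u(1) by (intro O.max_ideal_mult inverse_x_power) (auto simp: unit_set_def)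
    thus ?thesis using u(2) O.power_max_ideal_imp_max_ideal[of q a] q_gt_1 by simp
  qed (simp add: O.max_ideal_zero)
  have 2: "a \<in> \<O>" if "a \<in> O_inf" for a
  proof (cases "a \<in> max_ideal O_inf")
    case True thus ?thesis using 1 O.max_ideal_subset by blast
  next
    case False
    hence "a \<in> unit_set O_inf" using that inf.unit_iff by blast
    hence a: "a \<noteq> 0" "pole_inf a = 0" by (simp_all add: unit_set_inf)
    then obtain u where "u \<in> unit_set \<O>" "a ^ q = inverse x ^ nat (- pole_inf a) * u"
      using pole_inf_power_q[of a] by auto
    hence "a ^ q \<in> unit_set \<O>" using a by simp
    hence "a \<in> unit_set \<O>" using O.power_unit_imp_unit[of q a] q_gt_1 by simp
    thus ?thesis by (simp add: unit_set_def)
  qed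
  have 3: "a \<in> O_inf" if "a \<in> \<O>" for a
  proof (rule ccontr)
    assume a: "a \<notin> O_inf"
    hence "inverse a \<in> max_ideal \<O>" using inf.notin_imp_inverse 1 by blast
    moreover have "a \<noteq> 0" using a inf.zero_closed by auto
    ultimately show False using that by (simp add: O.max_ideal_iff)
  qed
  show ?thesis using 2 3 by blast
qed

end

section \<open>The genus\<close>

lemma card_extensional:
  assumes "finite B" shows "card (extensional B :: ('b \<Rightarrow> 'a) set) = CARD('a) ^ card B"
proof -
  have "extensional B = (B \<rightarrow>\<^sub>E (UNIV :: 'a set))" by (simp add: PiE_def)
  thus ?thesis using assms by (simp add: card_funcsetE)
qed

text \<open>As k is finite, invariance of dimension is a matter of counting: coordinate vectors for
  one basis inject into those for the other.\<close>

lemma basis_mod_card_le: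
  assumes fin: "finite (UNIV :: 'a::field set)" and iota: "field_embedding (\<iota> :: 'a \<Rightarrow> 'k::field)"
    and W: "\<And>a b. a \<in> W \<Longrightarrow> b \<in> W \<Longrightarrow> a - b \<in> W"
    and V: "0 \<in> V" "\<And>a b. a \<in> V \<Longrightarrow> b \<in> V \<Longrightarrow> a + b \<in> V" "\<And>c a. a \<in> V \<Longrightarrow> \<iota> c * a \<in> V"
    and B: "basis_mod \<iota> W V B" and B': "basis_mod \<iota> W V B'"
  shows "card B \<le> card B'"
proof -
  define s where "s B c = (\<Sum>b\<in>B. \<iota> (c b) * b)" for B :: "'k set" and c
  have sV: "s B c \<in> V" if "basis_mod \<iota> W V B" for B c
  proof -
    have "B \<subseteq> V" using that by (simp add: basis_mod_def)
    thus ?thesis unfolding s_def by (induction B rule: infinite_finite_induct) (auto intro: V)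
  qed
  have ex: "\<exists>!c. c \<in> extensional B \<and> v - s B c \<in> W" if "basis_mod \<iota> W V B" "v \<in> V" for B v
    using that unfolding basis_mod_def s_def by blast
  define f where "f c = (THE c'. c' \<in> extensional B' \<and> s B c - s B' c' \<in> W)" for c
  have f: "f c \<in> extensional B'" "s B c - s B' (f c) \<in> W" for c
    using theI'[OF ex[OF B' sV[OF B, of c]]] unfolding f_def by simp_all
  have "inj_on f (extensional B)"
  proof (rule inj_onI)
    fix c1 c2 assume c: "c1 \<in> extensional B" "c2 \<in> extensional B" "f c1 = f c2"
    have "s B c2 - s B' (f c1) \<in> W" using f(2)[of c2] c(3) by simp
    from W[OF f(2)[of c1] this] have "s B c1 - s B c2 \<in> W" by simp
    moreover have "s B c1 - s B c1 \<in> W" using W[OF f(2) f(2), of c1 c1] by simp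
    ultimately show "c1 = c2" using ex[OF B sV[OF B, of c1]] c by blast
  qed
  moreover have "f ` extensional B \<subseteq> extensional B'" using f by blast
  moreover have fB: "finite B" "finite B'" using B B' by (simp_all add: basis_mod_def)
  moreover have "finite (extensional B' :: ('k \<Rightarrow> 'a) set)"
    using finite_PiE[OF fB(2), of "\<lambda>_. UNIV :: 'a set"] fin by (simp add: PiE_def)
  ultimately have "card (extensional B :: ('k \<Rightarrow> 'a) set) \<le> card (extensional B' :: ('k \<Rightarrow> 'a) set)"
    by (intro card_inj_on_le)
  hence "CARD('a) ^ card B \<le> CARD('a) ^ card B'" using fB by (simp add: card_extensional)
  moreover have "CARD('a) > 1"
  proof -
    have "card {0, 1 :: 'a} \<le> CARD('a)" using fin by (intro card_mono) auto
    thus ?thesis by simp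
  qed
  ultimately show ?thesis by simp
qed

lemma dim_mod_eq:
  assumes "finite (UNIV :: 'a::field set)" "field_embedding (\<iota> :: 'a \<Rightarrow> 'k::field)"
    "\<And>a b. a \<in> W \<Longrightarrow> b \<in> W \<Longrightarrow> a - b \<in> W"
    "0 \<in> V" "\<And>a b. a \<in> V \<Longrightarrow> b \<in> V \<Longrightarrow> a + b \<in> V" "\<And>c a. a \<in> V \<Longrightarrow> \<iota> c * a \<in> V"
    "basis_mod \<iota> W V B"
  shows "dim_mod \<iota> W V = card B"
  unfolding dim_mod_def
proof (rule the_equality)
  fix n assume "\<exists>B'. basis_mod \<iota> W V B' \<and> card B' = n"
  then obtain B' where B': "basis_mod \<iota> W V B'" "card B' = n" by blast
  show "n = card B"
    using basis_mod_card_le[OF assms(1-6) B'(1) assms(7)] basis_mod_card_le[OF assms(1-6) assms(7) B'(1)] B'(2)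
    by simp
qed (use assms in blast)

text \<open>\<open>basis_mod\<close> attaches the coefficients to the vectors themselves. For an
  indexed family, independence also makes the indexing injective, so no vector is counted
  twice.\<close>

lemma basis_mod_zero_indexed:
  fixes v :: "'i \<Rightarrow> 'k::field"
  assumes "comm_hom (\<iota> :: 'a::field \<Rightarrow> 'k)" and I: "finite I" and V: "v ` I \<subseteq> V"
    and span: "\<And>y. y \<in> V \<Longrightarrow> \<exists>c. y = (\<Sum>i\<in>I. \<iota> (c i) * v i)"
    and indep: "\<And>c. (\<Sum>i\<in>I. \<iota> (c i) * v i) = 0 \<Longrightarrow> \<forall>i\<in>I. c i = 0"
  shows "basis_mod \<iota> {0} V (v ` I)" "card (v ` I) = card I"
proof -
  interpret comm_hom \<iota> by fact
  have uniq: "\<forall>i\<in>I. c i = d i" if "(\<Sum>i\<in>I. \<iota> (c i) * v i) = (\<Sum>i\<in>I. \<iota> (d i) * v i)" for c d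
    using indep[of "\<lambda>i. c i - d i"] that by (simp add: hom_diff left_diff_distrib sum_subtractf)
  have inj: "inj_on v I"
  proof (rule inj_onI)
    fix i j assume ij: "i \<in> I" "j \<in> I" "v i = v j"
    have "(\<Sum>k\<in>I. \<iota> (if k = i then 1 else 0) * v k) = (\<Sum>k\<in>I. if k = i then v k else 0)"
      "(\<Sum>k\<in>I. \<iota> (if k = j then 1 else 0) * v k) = (\<Sum>k\<in>I. if k = j then v k else 0)"
      by (intro sum.cong refl; simp add: hom_0 hom_1)+
    hence "(\<Sum>k\<in>I. \<iota> (if k = i then 1 else 0) * v k) = (\<Sum>k\<in>I. \<iota> (if k = j then 1 else 0) * v k)"
      using ij I by simp
    from bspec[OF uniq[OF this] ij(1)] have "(if i = i then 1 else 0) = (if i = j then 1 else (0 :: 'a))" .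
    thus "i = j" by (simp split: if_splits)
  qed
  thus "card (v ` I) = card I" by (rule card_image)
  show "basis_mod \<iota> {0} V (v ` I)"
    unfolding basis_mod_def
  proof (intro conjI ballI)
    fix y assume "y \<in> V"
    then obtain c where c: "y = (\<Sum>i\<in>I. \<iota> (c i) * v i)" using span by blast
    have re: "(\<Sum>b\<in>v ` I. \<iota> (d b) * b) = (\<Sum>i\<in>I. \<iota> (d (v i)) * v i)" for d
      using inj by (simp add: sum.reindex)
    define d where "d = restrict (\<lambda>b. c (the_inv_into I v b)) (v ` I)"
    have d: "d (v i) = c i" if "i \<in> I" for i using that inj by (simp add: d_def the_inv_into_f_f)
    show "\<exists>!d. d \<in> extensional (v ` I) \<and> y - (\<Sum>b\<in>v ` I. \<iota> (d b) * b) \<in> {0}"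
    proof (rule ex1I[of _ d])
      show "d \<in> extensional (v ` I) \<and> y - (\<Sum>b\<in>v ` I. \<iota> (d b) * b) \<in> {0}"
        unfolding re using d by (simp add: c) (simp add: d_def)
    next
      fix d' assume d': "d' \<in> extensional (v ` I) \<and> y - (\<Sum>b\<in>v ` I. \<iota> (d' b) * b) \<in> {0}"
      hence "(\<Sum>i\<in>I. \<iota> (d' (v i)) * v i) = (\<Sum>i\<in>I. \<iota> (c i) * v i)" unfolding re by (simp add: c)
      hence "\<forall>i\<in>I. d' (v i) = c i" by (rule uniq)
      thus "d' = d" using d d' by (intro extensionalityI[of _ "v ` I"]) (auto simp: d_def)
    qed
  qed (use I V in auto)
qed

section \<open>Riemann-Roch spaces of multiples of the point at infinity\<close>

context quadratic_as_curve
begin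

lemma closed_point_cases:
  assumes "\<O> \<in> closed_points \<iota>"
  shows "x \<in> \<O> \<and> affine_closed_point \<iota> p\<^sub>0 e q F x z \<O> \<or> x \<notin> \<O> \<and> \<O> = O_inf"
proof (cases "x \<in> \<O>")
  case True
  thus ?thesis using assms by (auto intro!: affine_closed_point.intro affine_closed_point_axioms.intro artin_schreier_curve_axioms)
next
  case False
  interpret infinite_closed_point \<iota> p\<^sub>0 e q F x z p \<O>
    by unfold_locales (use assms False in auto)
  show ?thesis using False O_eq_O_inf by simp
qed

lemma x_notin_O_inf: "x \<notin> O_inf"
  using x_nonzero pole_x q_gt_1 pole_inf_A[OF x_in_A] by (simp add: O_inf_def)

text \<open>By \<open>pole_inf_cancel\<close> a function regular at infinity is a constant modulo
  the maximal ideal.\<close>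

lemma point_degree_inf: "point_degree \<iota> O_inf = 1"
proof -
  have "basis_mod \<iota> (max_ideal O_inf) O_inf {1}"
    unfolding basis_mod_def
  proof (intro conjI ballI)
    fix v assume v: "v \<in> O_inf"
    have "\<exists>c. v - \<iota> c \<in> max_ideal O_inf"
    proof (cases "v \<in> max_ideal O_inf")
      case True thus ?thesis by (intro exI[of _ 0]) (simp add: iota.hom_0)
    next
      case False
      hence "v \<in> unit_set O_inf" using v by (simp add: inf.unit_iff)
      thus ?thesis using pole_inf_cancel[of v] by (simp add: unit_set_inf max_ideal_inf)
    qed
    then obtain c where c: "v - \<iota> c \<in> max_ideal O_inf" by blast
    show "\<exists>!c. c \<in> extensional {1} \<and> v - (\<Sum>b\<in>{1}. \<iota> (c b) * b) \<in> max_ideal O_inf"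
    proof (rule ex1I[of _ "restrict (\<lambda>_. c) {1}"])
      fix c' assume c': "c' \<in> extensional {1} \<and> v - (\<Sum>b\<in>{1}. \<iota> (c' b) * b) \<in> max_ideal O_inf"
      hence "v - \<iota> (c' 1) \<in> max_ideal O_inf" by simp
      from inf.max_ideal_diff[OF this c] have "\<iota> (c - c' 1) \<in> max_ideal O_inf" by (simp add: iota.hom_diff)
      hence "c - c' 1 = 0" using inf.iota_unit[of "c - c' 1"] inf.unit_iff by blast
      thus "c' = restrict (\<lambda>_. c) {1}" using c' by (intro extensionalityI[of _ "{1}"]) auto
    qed (use c in simp)
  qed (auto simp: inf.one_closed)
  hence "dim_mod \<iota> (max_ideal O_inf) O_inf = card {1 :: 'b}"
    by (intro dim_mod_eq finite_base embedding inf.max_ideal_diff inf.zero_closed inf.add_closed inf.mult_closed inf.range_subset)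
  thus ?thesis by (simp add: point_degree_def)
qed

definition inf_divisor :: "nat \<Rightarrow> 'b set \<Rightarrow> int" where
  "inf_divisor N = (\<lambda>P. if P = O_inf then int N else 0)"

lemma inf_divisor_support: "N > 0 \<Longrightarrow> {P. inf_divisor N P \<noteq> 0} = {O_inf}"
  by (auto simp: inf_divisor_def)

lemma inf_divisor_in_divisors: "N > 0 \<Longrightarrow> inf_divisor N \<in> divisors \<iota>"
  unfolding divisors_def by (simp add: inf_divisor_support O_inf_closed_point)

lemma divisor_degree_inf: "N > 0 \<Longrightarrow> divisor_degree \<iota> (inf_divisor N) = int N"
  unfolding divisor_degree_def by (simp add: inf_divisor_support point_degree_inf) (simp add: inf_divisor_def)

text \<open>Away from infinity the condition is regularity, which by \<open>regular_imp_in_A\<close>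
  means membership in \<open>A\<close>; at infinity it bounds the pole order.\<close>

lemma riemann_roch_space_inf:
  "riemann_roch_space \<iota> (inf_divisor N) = {y \<in> A. y = 0 \<or> pole y \<le> N}" (is "?L = ?R")
proof (intro equalityI subsetI)
  fix y assume y: "y \<in> ?L"
  show "y \<in> ?R"
  proof (cases "y = 0")
    case True thus ?thesis using zero_in_A by simp
  next
    case False
    hence ord: "ord_at P y + inf_divisor N P \<ge> 0" if "P \<in> closed_points \<iota>" for P
      using y that by (simp add: riemann_roch_space_def)
    have yA: "y \<in> A"
    proof (rule regular_imp_in_A)
      fix P assume P: "P \<in> closed_points \<iota>" "x \<in> P"
      hence "affine_closed_point \<iota> p\<^sub>0 e q F x z P" using closed_point_cases by blast
      then interpret P: affine_closed_point \<iota> p\<^sub>0 e q F x z P .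
      have "P \<noteq> O_inf" using P(2) x_notin_O_inf by blast
      thus "y \<in> P" using ord[OF P(1)] P.ord_at_affine_iff[OF False] by (simp add: inf_divisor_def)
    qed
    moreover have "pole y \<le> N"
      using ord[OF O_inf_closed_point] ord_at_inf[OF False] pole_inf_A[OF yA False]
      by (simp add: inf_divisor_def)
    ultimately show ?thesis by simp
  qed
next
  fix y assume y: "y \<in> ?R"
  show "y \<in> ?L"
  proof (cases "y = 0")
    case False
    have "ord_at P y + inf_divisor N P \<ge> 0" if P: "P \<in> closed_points \<iota>" for P
    proof (cases "P = O_inf")
      case True
      thus ?thesis using y False ord_at_inf pole_inf_A by (simp add: inf_divisor_def)
    next
      case ne: False
      hence "affine_closed_point \<iota> p\<^sub>0 e q F x z P" using closed_point_cases[OF P] by blast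
      then interpret P: affine_closed_point \<iota> p\<^sub>0 e q F x z P .
      have "y \<in> P" using y P.A_subset_O by blast
      thus ?thesis using ne P.ord_at_affine_iff[OF False] by (simp add: inf_divisor_def)
    qed
    thus ?thesis by (simp add: riemann_roch_space_def)
  qed (simp add: riemann_roch_space_def)
qed

definition weight_index :: "nat \<Rightarrow> (nat \<times> nat) set" where
  "weight_index N = {(i, j). j < q \<and> weight i j \<le> N}"

lemma finite_weight_index: "finite (weight_index N)"
proof (rule finite_subset)
  show "weight_index N \<subseteq> {..N} \<times> {..<q}"
  proof
    fix ij assume "ij \<in> weight_index N"
    then obtain i j where ij: "ij = (i, j)" "j < q" "weight i j \<le> N" by (auto simp: weight_index_def)
    have "i \<le> q * i" using q_gt_1 by simp
    hence "i \<le> weight i j" unfolding weight_def by (rule trans_le_add1)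
    thus "ij \<in> {..N} \<times> {..<q}" using ij by simp
  qed
qed simp

text \<open>The monomials x^i z^j with j < q are a basis of \<open>A\<close>, and the pole order of
  a combination is the largest weight occurring in it, so those of weight at most N span the
  space.\<close>

lemma ell_inf: "ell \<iota> (inf_divisor N) = card (weight_index N)"
proof -
  define V where "V = {y \<in> A. y = 0 \<or> pole y \<le> N}"
  define v where "v = (\<lambda>(i, j). x ^ i * z ^ j)"
  have pole0: "pole 0 = 0" using pole_iota[of 0] by (simp add: iota.hom_0)
  have V: "V = {y \<in> A. pole y \<le> N}" using pole0 by (auto simp: V_def)
  have vA: "v ij \<in> A" for ij by (auto simp: v_def intro!: A_mult A_power x_in_A z_in_A split: prod.split)
  have pole_v: "pole (v (i, j)) = weight i j" if "j < q" for i j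
    using pole_monom[of 1 j i] that by (simp add: v_def iota.hom_1)
  define G where "G c = (\<Sum>(i, j)\<in>weight_index N. monom (monom (c (i, j)) i) j)" for c :: "nat \<times> nat \<Rightarrow> 'a"
  have evG: "ev (G c) = (\<Sum>ij\<in>weight_index N. \<iota> (c ij) * v ij)" for c
    unfolding G_def ev.hom_sum v_def by (intro sum.cong) (auto simp: ev_monom hx_monom mult.assoc)
  have degG: "degree (G c) < q" for c
    unfolding G_def using q_gt_1
    by (intro degree_sum_less) (auto simp: weight_index_def intro: le_less_trans[OF degree_monom_le])
  have coeffG: "coeff (coeff (G c) j) i = c (i, j)" if "(i, j) \<in> weight_index N" for c i j
  proof -
    have "coeff (coeff (G c) j) i = (\<Sum>ij\<in>weight_index N. if ij = (i, j) then c ij else 0)"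
      unfolding G_def coeff_sum by (intro sum.cong) (auto split: if_splits)
    thus ?thesis using that finite_weight_index by simp
  qed
  have vV: "v ` weight_index N \<subseteq> V" using vA pole_v by (auto simp: V weight_index_def)
    have span: "\<exists>c. y = (\<Sum>ij\<in>weight_index N. \<iota> (c ij) * v ij)" if y: "y \<in> V" for y
    proof -
      define g where "g = reduced y"
      have g: "degree g < q" "ev g = y" using reduced_props y by (simp_all add: g_def V)
      have "weight_le (pole y) g" using weight_le_degree_psi[OF g(1)] by (simp add: pole_def symb_def g_def)
      hence w: "weight i j \<le> N" if "coeff (coeff g j) i \<noteq> 0" for i j
        using that y unfolding weight_le_def V by (auto intro: order_trans)
      define c where "c = (\<lambda>(i, j). coeff (coeff g j) i)"
      have "g = G c"
      proof (intro poly_eqI)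
        fix j i
        show "coeff (coeff g j) i = coeff (coeff (G c) j) i"
        proof (cases "(i, j) \<in> weight_index N")
          case True thus ?thesis by (simp add: coeffG c_def)
        next
          case False
          hence "coeff (coeff g j) i = 0" using w[of j i] g(1) 
            by (cases "j < q") (auto simp: weight_index_def coeff_eq_0)
          moreover have "coeff (coeff (G c) j) i = 0"
            unfolding G_def coeff_sum using False by (intro sum.neutral) auto
          ultimately show ?thesis by simp
        qed
      qed
      hence "y = ev (G c)" using g by simp
      thus ?thesis unfolding evG by blast
    qed
    have indep: "\<forall>ij\<in>weight_index N. c ij = 0" if "(\<Sum>ij\<in>weight_index N. \<iota> (c ij) * v ij) = 0" for c
    proof -
      have "ev (G c) = ev 0" using that by (simp add: evG ev.hom_0)
      hence "G c = 0" using degG q_gt_1 by (intro ev_inj) auto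
      thus ?thesis using coeffG[of _ _ c] by auto
    qed
  have b: "basis_mod \<iota> {0} V (v ` weight_index N)" "card (v ` weight_index N) = card (weight_index N)"
    using basis_mod_zero_indexed[OF iota.comm_hom_axioms finite_weight_index vV span indep] by simp_all
  have "dim_mod \<iota> {0} V = card (v ` weight_index N)"
  proof (rule dim_mod_eq[OF finite_base embedding _ _ _ _ b(1)])
    show "0 \<in> V" using zero_in_A by (simp add: V_def)
    show "a + b \<in> V" if "a \<in> V" "b \<in> V" for a b
      using that pole_add_le[of a b] A_add by (auto simp: V)
    show "\<iota> c * a \<in> V" if "a \<in> V" for c a
      using that A_mult iota_in_A degree_smult_le[of c "symb a"] by (auto simp: V pole_def symb_scale)
  qed simp
  thus ?thesis unfolding ell_def riemann_roch_space_inf using b(2) by (simp add: V_def)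
qed

text \<open>The point reflection of the rectangle \<open>[0, p + 1] \<times> [0, q]\<close> maps the weights at most \<open>q(p + 1)\<close> to the
  weights at least \<open>q(p + 1)\<close>.\<close>

lemma card_weight_index: "2 * card (weight_index (q * (p + 1))) \<le> (p + 2) * (q + 1)"
proof -
  define N where "N = q * (p + 1)"
  define I where "I = weight_index N"
  define r where "r = (\<lambda>(i, j). (p + 1 - i, q - j))"
  have I: "i \<le> p + 1 \<and> j < q \<and> weight i j \<le> N" if "(i, j) \<in> I" for i j
  proof -
    have w: "j < q" "weight i j \<le> N" using that by (auto simp: I_def weight_index_def)
    hence "q * i \<le> q * (p + 1)" unfolding weight_def N_def by linarith
    hence "i \<le> p + 1" using q_gt_1 by (simp only: mult_le_cancel1)
    thus ?thesis using w by simp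
  qed
  have inj: "inj_on r I"
    using I by (auto simp: inj_on_def r_def) (metis Suc_eq_plus1 diff_diff_cancel less_imp_le)+
  \<comment> \<open>A pair in \<open>I\<close> whose reflection also lies in \<open>I\<close> would
    have weight exactly N. In \<open>I\<close> only (p + 1, 0) has this weight, and its reflection
    (0, q) violates j < q.\<close>
  have "I \<inter> r ` I = {}"
  proof (rule ccontr)
    assume "I \<inter> r ` I \<noteq> {}"
    then obtain i j where ij: "(i, j) \<in> I" "(p + 1 - i, q - j) \<in> I" by (auto simp: r_def)
    obtain k l where k: "p + 1 = i + k" and l: "q = j + l" using I[OF ij(1)] by (metis le_Suc_ex less_imp_le)
    have "q * i + q * k = N" "(p + 1) * j + (p + 1) * l = (p + 1) * q"
      by (simp_all only: distrib_left[symmetric] k[symmetric] l[symmetric] N_def)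
    moreover have "N = (p + 1) * q" by (simp add: N_def)
    ultimately have "weight i j + weight k l = 2 * N" unfolding weight_def by linarith
    moreover have "weight i j \<le> N" "weight k l \<le> N" "l < q" "j < q"
      using I[OF ij(1)] I[OF ij(2)] k l by simp_all
    ultimately have "weight i j = weight (p + 1) 0" by (simp add: N_def weight_def)
    hence "j = 0" using weight_inj[of i j "p + 1" 0] \<open>j < q\<close> by simp
    thus False using l \<open>l < q\<close> by simp
  qed
  moreover have "finite I" unfolding I_def by (rule finite_weight_index)
  ultimately have "card (I \<union> r ` I) = card I + card I"
    by (subst card_Un_disjoint) (auto simp: card_image[OF inj])
  moreover have "card (I \<union> r ` I) \<le> card ({..p + 1} \<times> {..q})"
  proof (intro card_mono subsetI)
    fix ij assume "ij \<in> I \<union> r ` I"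
    then obtain i j where "(i, j) \<in> I" "ij = (i, j) \<or> ij = r (i, j)" by (cases ij) auto
    thus "ij \<in> {..p + 1} \<times> {..q}" using I[of i j] by (auto simp: r_def)
  qed simp
  ultimately show ?thesis by (simp add: I_def N_def card_cartesian_product)
qed

text \<open>The genus is a supremum, so a single divisor gives a lower bound. For N = q(p + 1) the
  count of weights yields N + 1 - (p + 2)(q + 1)/2 = (q - 1)p/2.\<close>

lemma genus_ge: assumes "genus \<iota> = enat g" shows "(q - 1) * p \<le> 2 * g"
proof -
  define N where "N = q * (p + 1)"
  have N0: "N > 0" using q_gt_1 by (simp add: N_def)
  define D where "D = divisor_degree \<iota> (inf_divisor N) + 1 - int (ell \<iota> (inf_divisor N))"
  have "enat (nat D) \<le> genus \<iota>"
    unfolding genus_def D_def using inf_divisor_in_divisors[OF N0] by (rule SUP_upper)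
  hence "nat D \<le> g" using assms by simp
  hence "D \<le> int g" by simp
  moreover have "D = int N + 1 - int (card (weight_index N))"
    by (simp add: D_def divisor_degree_inf[OF N0] ell_inf)
  moreover have "2 * int (card (weight_index N)) \<le> (int p + 2) * (int q + 1)"
  proof -
    have "int (2 * card (weight_index N)) \<le> int ((p + 2) * (q + 1))"
      using card_weight_index unfolding N_def[symmetric] by (simp only: of_nat_le_iff)
    thus ?thesis by (simp add: algebra_simps)
  qed
  moreover have "int N = int q * (int p + 1)" by (simp add: N_def algebra_simps)
  ultimately have "(int q - 1) * int p \<le> 2 * int g" by (simp add: algebra_simps)
  thus ?thesis using q_gt_1 by (metis of_nat_diff of_nat_1 of_nat_mult of_nat_numeral of_nat_le_iff less_imp_le)
qed

end

section \<open>Rational points\<close>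

context artin_schreier_curve
begin

definition affine_points :: "nat \<Rightarrow> ('a alg_closure \<times> 'a alg_closure) set" where
  "affine_points Q = {(a, b). a \<in> Fq Q \<and> b \<in> Fq Q \<and> b ^ q - b = eval_ac a F}"

end

locale rational_point = closed_point \<iota> \<O>
  for \<iota> :: "'a::field \<Rightarrow> 'k::field" and \<O> +
  fixes Q :: nat and \<phi> :: "'k \<Rightarrow> 'a alg_closure"
  assumes rational: "(\<O>, \<phi>) \<in> rational_points \<iota> Q"
begin

lemma phi_in_Fq: "a \<in> \<O> \<Longrightarrow> \<phi> a \<in> Fq Q"
  and phi_extensional: "\<phi> \<in> extensional \<O>"
  and phi_iota: "\<phi> (\<iota> c) = to_ac c"
  and phi_add: "a \<in> \<O> \<Longrightarrow> b \<in> \<O> \<Longrightarrow> \<phi> (a + b) = \<phi> a + \<phi> b"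
  and phi_mult: "a \<in> \<O> \<Longrightarrow> b \<in> \<O> \<Longrightarrow> \<phi> (a * b) = \<phi> a * \<phi> b"
  and phi_max_ideal: "a \<in> max_ideal \<O> \<Longrightarrow> \<phi> a = 0"
  using rational by (auto simp: rational_points_def PiE_def)

lemma phi_0: "\<phi> 0 = 0"
  using max_ideal_zero by (rule phi_max_ideal)

lemma phi_1: "\<phi> 1 = 1"
  using phi_iota[of 1] embedding by (simp add: field_embedding_def)

lemma phi_eq_0_iff: assumes "a \<in> \<O>" shows "\<phi> a = 0 \<longleftrightarrow> a \<in> max_ideal \<O>"
proof
  assume "\<phi> a = 0"
  show "a \<in> max_ideal \<O>"
  proof (rule ccontr)
    assume "a \<notin> max_ideal \<O>"
    hence "a \<noteq> 0" "inverse a \<in> \<O>" using assms by (auto simp: max_ideal_iff)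
    hence "\<phi> 1 = \<phi> a * \<phi> (inverse a)" using phi_mult[of a "inverse a"] assms by simp
    thus False using \<open>\<phi> a = 0\<close> by (simp add: phi_1)
  qed
qed (rule phi_max_ideal)

end

lemma rational_pointI:
  assumes "field_embedding \<iota>" "(\<O>, \<phi>) \<in> rational_points \<iota> Q"
  shows "rational_point \<iota> \<O> Q \<phi>"
  using assms by unfold_locales (auto simp: rational_points_def)

locale affine_rational_point = affine_closed_point \<iota> p\<^sub>0 e q F x z \<O> + rational_point \<iota> \<O> Q \<phi>
  for \<iota> :: "'a::field \<Rightarrow> 'k::field" and p\<^sub>0 e q F x z \<O> Q \<phi>
begin

lemma phi_hx: "\<phi> (hx h) = eval_ac (\<phi> x) h"
proof (induction h)
  case 0
  show ?case by (simp add: hx.hom_0 phi_0 eval_ac_def)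
next
  case (pCons c h)
  have "hx h \<in> \<O>" using hx_in_A A_subset_O by blast
  hence "\<phi> (hx (pCons c h)) = \<phi> (\<iota> c) + \<phi> x * \<phi> (hx h)"
    using x_in_O O.range_subset by (simp add: hx_pCons phi_add phi_mult O.mult_closed)
  thus ?case using pCons.IH
    by (simp add: phi_iota eval_ac_def comm_hom.poly_map_hom_pCons[OF comm_hom_to_ac])
qed

lemma phi_ev: "\<phi> (ev g) = eval2_ac (\<phi> x) (\<phi> z) g"
proof (induction g)
  case 0
  show ?case by (simp add: ev.hom_0 phi_0 eval2_ac_def)
next
  case (pCons h g)
  have "hx h \<in> \<O>" "ev g \<in> \<O>" "z \<in> \<O>" using hx_in_A A_subset_O z_in_A by (auto simp: A_def)
  hence "\<phi> (ev (pCons h g)) = \<phi> (hx h) + \<phi> z * \<phi> (ev g)"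
    by (simp add: ev_pCons phi_add phi_mult O.mult_closed)
  thus ?case using pCons.IH
    by (simp add: phi_hx eval2_ac_def comm_hom.poly_map_hom_pCons[OF comm_hom_eval_ac])
qed

lemma coordinates: "(\<phi> x, \<phi> z) \<in> affine_points Q"
proof -
  have "z \<in> \<O>" using z_in_A A_subset_O by blast
  moreover have "eval2_ac (\<phi> x) (\<phi> z) eqn = 0"
    using phi_ev[of eqn] ev_eq_0_iff[of eqn] by (simp add: phi_0)
  hence "\<phi> z ^ q - \<phi> z = eval_ac (\<phi> x) F"
    by (simp add: eqn_def comm_hom.hom_diff[OF comm_hom_eval2_ac] eval2_ac_monom eval2_ac_const
        comm_hom.hom_1[OF comm_hom_eval_ac])
  ultimately show ?thesis using x_in_O by (simp add: affine_points_def phi_in_Fq)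
qed

lemma max_ideal_inter_A_eq: "max_ideal \<O> \<inter> A = {y. \<exists>g. y = ev g \<and> eval2_ac (\<phi> x) (\<phi> z) g = 0}"
  using phi_eq_0_iff A_subset_O by (fastforce simp: A_def simp flip: phi_ev)

text \<open>In this form the local ring depends only on the coordinates \<phi> x and \<phi> z of the
  point.\<close>

lemma O_eq: "\<O> = {u / v | u v. u \<in> A \<and> v \<in> A - {y. \<exists>g. y = ev g \<and> eval2_ac (\<phi> x) (\<phi> z) g = 0}}"
proof -
  have "\<O> = {u / v | u v. u \<in> A \<and> v \<in> A - (max_ideal \<O> \<inter> A)}"
    using O_eq_local_ring unfolding local_ring_def .
  thus ?thesis unfolding max_ideal_inter_A_eq .
qed

lemma phi_fraction:
  assumes "eval2_ac (\<phi> x) (\<phi> z) h \<noteq> 0" "ev g / ev h \<in> \<O>"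
  shows "\<phi> (ev g / ev h) = eval2_ac (\<phi> x) (\<phi> z) g / eval2_ac (\<phi> x) (\<phi> z) h"
proof -
  have "ev h \<noteq> 0" using assms(1) phi_0 by (auto simp flip: phi_ev)
  moreover have "ev h \<in> \<O>" using A_subset_O by (auto simp: A_def)
  ultimately have "\<phi> (ev g) = \<phi> (ev g / ev h) * \<phi> (ev h)"
    using phi_mult[OF assms(2), of "ev h"] by simp
  thus ?thesis using assms(1) by (simp add: phi_ev eq_divide_eq)
qed

end

context quadratic_as_curve
begin

lemma affine_rational_point_inj:
  assumes P: "(\<O>, \<phi>) \<in> rational_points \<iota> Q" "(\<O>', \<phi>') \<in> rational_points \<iota> Q"
    and x: "x \<in> \<O>" "x \<in> \<O>'" and eq: "\<phi> x = \<phi>' x" "\<phi> z = \<phi>' z"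
  shows "\<O> = \<O>' \<and> \<phi> = \<phi>'"
proof -
  interpret P: rational_point \<iota> \<O> Q \<phi> using embedding P(1) by (rule rational_pointI)
  interpret P': rational_point \<iota> \<O>' Q \<phi>' using embedding P(2) by (rule rational_pointI)
  interpret P: affine_rational_point \<iota> p\<^sub>0 e q F x z \<O> Q \<phi>
    by unfold_locales (use P.closed x in auto)
  interpret P': affine_rational_point \<iota> p\<^sub>0 e q F x z \<O>' Q \<phi>'
    by unfold_locales (use P'.closed x in auto)
  have O: "\<O> = \<O>'" using P.O_eq P'.O_eq eq by simp
  moreover have "\<phi> = \<phi>'"
  proof (rule extensionalityI[OF P.phi_extensional])
    show "\<phi>' \<in> extensional \<O>" using P'.phi_extensional O by simp
    fix a assume a: "a \<in> \<O>"
    hence "a \<in> {u / v | u v. u \<in> A \<and> v \<in> A - {y. \<exists>g. y = ev g \<and> eval2_ac (\<phi> x) (\<phi> z) g = 0}}"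
      using P.O_eq by simp
    then obtain g h where "a = ev g / ev h" "eval2_ac (\<phi> x) (\<phi> z) h \<noteq> 0"
      unfolding A_def by blast
    thus "\<phi> a = \<phi>' a" using P.phi_fraction[of h g] P'.phi_fraction[of h g] a O eq by simp
  qed
  ultimately show ?thesis by blast
qed

text \<open>The residue field at infinity is k, on which the homomorphism is prescribed.\<close>

lemma infinite_rational_point_unique:
  assumes P: "(O_inf, \<phi>) \<in> rational_points \<iota> Q" "(O_inf, \<phi>') \<in> rational_points \<iota> Q"
  shows "\<phi> = \<phi>'"
proof -
  interpret P: rational_point \<iota> O_inf Q \<phi> using embedding P(1) by (rule rational_pointI)
  interpret P': rational_point \<iota> O_inf Q \<phi>' using embedding P(2) by (rule rational_pointI)
  show ?thesis
  proof (rule extensionalityI[OF P.phi_extensional P'.phi_extensional])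
    fix a assume a: "a \<in> O_inf"
    show "\<phi> a = \<phi>' a"
    proof (cases "a \<in> max_ideal O_inf")
      case True
      thus ?thesis by (simp add: P.phi_max_ideal P'.phi_max_ideal)
    next
      case False
      hence "a \<in> unit_set O_inf" using a by (simp add: inf.unit_iff)
      then obtain c where c: "a - \<iota> c \<in> max_ideal O_inf"
        using pole_inf_cancel[of a] by (auto simp: unit_set_inf max_ideal_inf)
      have "\<phi> ((a - \<iota> c) + \<iota> c) = to_ac c" "\<phi>' ((a - \<iota> c) + \<iota> c) = to_ac c"
        using c inf.max_ideal_subset[OF c] inf.range_subset
        by (simp_all only: P.phi_add P'.phi_add P.phi_max_ideal P'.phi_max_ideal P.phi_iota P'.phi_iota add_0)
      thus ?thesis by simp
    qed
  qed
qed

text \<open>A point is encoded by its coordinates, with \<open>None\<close> for infinity.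
  Injectivity of the encoding is enough for an upper bound.\<close>

lemma card_rational_points_le:
  assumes "finite (affine_points Q)"
  shows "card (rational_points \<iota> Q) \<le> card (affine_points Q) + 1"
proof -
  define f :: "'b set \<times> ('b \<Rightarrow> 'a alg_closure) \<Rightarrow> _" where
    "f = (\<lambda>(\<O>, \<phi>). if x \<in> \<O> then Some (\<phi> x, \<phi> z) else None)"
  have cl: "\<O> \<in> closed_points \<iota>" if "(\<O>, \<phi>) \<in> rational_points \<iota> Q" for \<O> \<phi>
    using that by (auto simp: rational_points_def)
  have inj: "inj_on f (rational_points \<iota> Q)"
  proof (rule inj_onI)
    fix P P' assume P: "P \<in> rational_points \<iota> Q" "P' \<in> rational_points \<iota> Q" "f P = f P'"
    obtain \<O> \<phi> \<O>' \<phi>' where [simp]: "P = (\<O>, \<phi>)" "P' = (\<O>', \<phi>')" by (cases P; cases P')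
    show "P = P'"
    proof (cases "x \<in> \<O>")
      case True
      moreover from this have "x \<in> \<O>'" using P(3) by (auto simp: f_def split: if_splits)
      ultimately show ?thesis using affine_rational_point_inj[of \<O> \<phi> Q \<O>' \<phi>'] P by (auto simp: f_def)
    next
      case False
      moreover from this have "x \<notin> \<O>'" using P(3) by (auto simp: f_def split: if_splits)
      ultimately have "\<O> = O_inf" "\<O>' = O_inf" using closed_point_cases cl P by auto
      thus ?thesis using infinite_rational_point_unique[of \<phi> Q \<phi>'] P by auto
    qed
  qed
  have "f ` rational_points \<iota> Q \<subseteq> insert None (Some ` affine_points Q)"
  proof
    fix y assume "y \<in> f ` rational_points \<iota> Q"
    then obtain \<O> \<phi> where P: "(\<O>, \<phi>) \<in> rational_points \<iota> Q" "y = f (\<O>, \<phi>)" by auto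
    interpret P: rational_point \<iota> \<O> Q \<phi> using embedding P(1) by (rule rational_pointI)
    show "y \<in> insert None (Some ` affine_points Q)"
    proof (cases "x \<in> \<O>")
      case True
      interpret P: affine_rational_point \<iota> p\<^sub>0 e q F x z \<O> Q \<phi>
        by unfold_locales (use P.closed True in auto)
      show ?thesis using P.coordinates True P(2) by (simp add: f_def)
    qed (simp add: P(2) f_def)
  qed
  hence "card (rational_points \<iota> Q) \<le> card (insert None (Some ` affine_points Q))"
    using inj assms by (intro card_inj_on_le) auto
  also have "\<dots> = card (affine_points Q) + 1"
    using assms by (subst card_insert_disjoint) (auto simp: card_image)
  finally show ?thesis .
qed

end

section \<open>Character sums over finite fields\<close>

lemma Fq_eq_roots: "Fq Q = {b :: 'a::field alg_closure. b ^ Q - b = 0}"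
  by (simp add: Fq_def)

lemma card_Fq:
  assumes "prime CHAR('a::field alg_closure)" "k > 0"
  shows "card (Fq (CHAR('a alg_closure) ^ k) :: 'a alg_closure set) = CHAR('a alg_closure) ^ k"
  unfolding Fq_eq_roots using assms by (rule card_power_minus_self_eq)

lemma finite_Fq:
  assumes "prime CHAR('a::field alg_closure)" "k > 0"
  shows "finite (Fq (CHAR('a alg_closure) ^ k) :: 'a alg_closure set)"
proof -
  have "CHAR('a alg_closure) ^ k > 0" using prime_gt_0_nat[OF assms(1)] by simp
  thus ?thesis using card_Fq[OF assms] by (metis card_ge_0_finite)
qed

text \<open>\<open>F\<close> is now the field with Q elements, no longer the right-hand side of the
  equation. It is a parameter because the theory is used a second time in \<open>gauss_one\<close>,
  for the subfield over which it is quadratic.\<close>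

locale char_p_closure =
  fixes p\<^sub>0 k Q :: nat and F :: "'a::field alg_closure set"
  assumes prime_p0: "prime p\<^sub>0" and CHAR_eq: "CHAR('a alg_closure) = p\<^sub>0"
    and k_pos: "k > 0" and Q_eq: "Q = p\<^sub>0 ^ k" and F_eq: "F = Fq Q"
begin

lemma power_add: "(a + b :: 'a alg_closure) ^ (p\<^sub>0 ^ j) = a ^ (p\<^sub>0 ^ j) + b ^ (p\<^sub>0 ^ j)"
  using freshmans_dream'[where 'a = "'a alg_closure", of _ j a b] prime_p0 CHAR_eq by blast

lemma power_diff: "(a - b :: 'a alg_closure) ^ (p\<^sub>0 ^ j) = a ^ (p\<^sub>0 ^ j) - b ^ (p\<^sub>0 ^ j)"
  using diff_power_CHAR_power[where 'b = "'a alg_closure", of a b j] prime_p0 CHAR_eq by metis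

lemma power_of_nat: "(of_nat n :: 'a alg_closure) ^ (p\<^sub>0 ^ j) = of_nat n"
  using of_nat_power_CHAR_power[where 'b = "'a alg_closure", of n j] prime_p0 CHAR_eq by metis

lemma mem_F: "a \<in> F \<longleftrightarrow> a ^ (p\<^sub>0 ^ k) = a"
  by (simp add: F_eq Fq_def Q_eq)

lemma card_F: "card F = Q" and finite_F: "finite F"
  using card_Fq[where 'a = 'a and k = k] finite_Fq[where 'a = 'a and k = k] prime_p0 k_pos
  unfolding CHAR_eq F_eq Q_eq by blast+

lemma Q_pos: "Q > 0"
  using prime_gt_0_nat[OF prime_p0] by (simp add: Q_eq)

lemma F_add: "a \<in> F \<Longrightarrow> b \<in> F \<Longrightarrow> a + b \<in> F"
  by (simp add: mem_F power_add)

lemma F_diff: "a \<in> F \<Longrightarrow> b \<in> F \<Longrightarrow> a - b \<in> F"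
  by (simp add: mem_F power_diff)

lemma F_of_nat: "of_nat n \<in> F"
  by (simp add: mem_F power_of_nat)

lemma F_0: "0 \<in> F" and F_1: "1 \<in> F" and F_numeral: "numeral w \<in> F"
  using F_of_nat[of 0] F_of_nat[of 1] F_of_nat[of "numeral w"] by simp_all

lemma F_minus: "a \<in> F \<Longrightarrow> - a \<in> F"
  using F_diff[OF F_0] by simp

lemma F_mult: "a \<in> F \<Longrightarrow> b \<in> F \<Longrightarrow> a * b \<in> F"
  by (simp add: mem_F power_mult_distrib)

lemma F_power: "a \<in> F \<Longrightarrow> a ^ n \<in> F"
  by (induction n) (simp_all add: F_1 F_mult)

lemma F_inverse: "a \<in> F \<Longrightarrow> inverse a \<in> F"
  by (simp add: mem_F power_inverse)

lemma F_divide: "a \<in> F \<Longrightarrow> b \<in> F \<Longrightarrow> a / b \<in> F"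
  by (simp add: divide_inverse F_mult F_inverse)

lemmas F_closed = F_add F_diff F_0 F_1 F_numeral F_minus F_mult F_power F_inverse F_divide

lemma bij_betw_translate: assumes "a \<in> F" shows "bij_betw (\<lambda>u. a + u) F F"
  by (rule bij_betw_byWitness[where f' = "\<lambda>u. u - a"]) (use assms F_closed in auto)

lemma bij_betw_scale: assumes "a \<in> F" "a \<noteq> 0" shows "bij_betw (\<lambda>u. a * u) F F"
  by (rule bij_betw_byWitness[where f' = "\<lambda>u. u / a"]) (use assms F_closed in auto)

lemma bij_betw_Frobenius: "bij_betw (\<lambda>u. u ^ (p\<^sub>0 ^ j)) F F"
proof (rule bij_betw_imageI)
  show inj: "inj_on (\<lambda>u. u ^ (p\<^sub>0 ^ j)) F"
  proof (rule inj_onI)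
    fix u v :: "'a alg_closure" assume "u ^ (p\<^sub>0 ^ j) = v ^ (p\<^sub>0 ^ j)"
    hence "(u - v) ^ (p\<^sub>0 ^ j) = 0" by (simp add: power_diff)
    thus "u = v" by simp
  qed
  show "(\<lambda>u. u ^ (p\<^sub>0 ^ j)) ` F = F"
    using inj finite_F F_power by (intro endo_inj_surj) auto
qed

text \<open>The residues of the numbers below \<open>p\<^sub>0\<close> already exhaust the
  \<open>p\<^sub>0\<close> roots of the equation.\<close>

lemma prime_field:
  assumes "(a :: 'a alg_closure) ^ p\<^sub>0 = a" obtains n where "a = of_nat n"
proof -
  let ?R = "{b :: 'a alg_closure. b ^ p\<^sub>0 - b = 0}"
  have c: "card ?R = p\<^sub>0"
    using card_power_minus_self_eq[where 'c = "'a alg_closure" and e = 1 and c = 0] prime_p0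
    unfolding CHAR_eq by simp
  hence "finite ?R" using prime_gt_0_nat[OF prime_p0] by (metis card_ge_0_finite)
  moreover have "of_nat n ^ p\<^sub>0 = (of_nat n :: 'a alg_closure)" for n using power_of_nat[of n 1] by simp
  hence "of_nat ` {..<p\<^sub>0} \<subseteq> ?R" by auto
  moreover have "inj_on (of_nat :: nat \<Rightarrow> 'a alg_closure) {..<p\<^sub>0}"
    using inj_on_of_nat_CHAR[where 'b = "'a alg_closure"] unfolding CHAR_eq .
  hence "card ((of_nat :: nat \<Rightarrow> 'a alg_closure) ` {..<p\<^sub>0}) = p\<^sub>0" by (simp add: card_image)
  ultimately have "of_nat ` {..<p\<^sub>0} = ?R" using c by (intro card_subset_eq) auto
  moreover have "a \<in> ?R" using assms by simp
  ultimately have "a \<in> of_nat ` {..<p\<^sub>0}" by simp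
  thus ?thesis using that by blast
qed

text \<open>The character is \<open>\<omega>\<^bsup>Tr a\<^esup>\<close> with \<open>\<omega>\<close> a primitive \<open>p\<^sub>0\<close>-th root of unity and \<open>Tr\<close> the trace to the prime field.\<close>

lemma ex_character:
  "\<exists>\<psi> :: 'a alg_closure \<Rightarrow> complex. (\<forall>a\<in>F. \<forall>b\<in>F. \<psi> (a + b) = \<psi> a * \<psi> b) \<and> (\<forall>a. norm (\<psi> a) = 1) \<and>
     (\<forall>a\<in>F. \<psi> (a ^ p\<^sub>0) = \<psi> a) \<and> (\<exists>a\<in>F. \<psi> a \<noteq> 1)"
proof -
  define \<omega> where "\<omega> = cis (2 * pi / real p\<^sub>0)"
  define Tr where "Tr a = (\<Sum>i<k. a ^ (p\<^sub>0 ^ i))" for a :: "'a alg_closure"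
  \<comment> \<open>The chosen n is determined only modulo \<open>p\<^sub>0\<close>, which does not
    matter because the \<open>p\<^sub>0\<close>-th power of \<omega> is 1.\<close>
  define \<chi> where "\<chi> t = \<omega> ^ (SOME n. of_nat n = t)" for t :: "'a alg_closure"
  have p0: "p\<^sub>0 > 1" using prime_p0 by (rule prime_gt_1_nat)
  have \<omega>p: "\<omega> ^ p\<^sub>0 = 1" using p0 by (simp add: \<omega>_def DeMoivre)
  have \<omega>1: "\<omega> \<noteq> 1"
  proof
    assume "\<omega> = 1"
    hence "cos (2 * pi / real p\<^sub>0) = 1" by (simp add: \<omega>_def complex_eq_iff)
    then obtain n :: int where n: "2 * pi / real p\<^sub>0 = of_int n * 2 * pi" unfolding cos_one_2pi_int by blast
    hence "1 = of_int n * real p\<^sub>0" using p0 by (simp add: field_simps)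
    hence "1 = n * int p\<^sub>0" by (metis of_int_1 of_int_eq_iff of_int_mult of_int_of_nat_eq)
    hence "int p\<^sub>0 dvd 1" by (metis dvd_triv_right)
    thus False using p0 by simp
  qed
  have \<omega>mod: "\<omega> ^ n = \<omega> ^ (n mod p\<^sub>0)" for n
  proof -
    have "\<omega> ^ n = \<omega> ^ (p\<^sub>0 * (n div p\<^sub>0) + n mod p\<^sub>0)" by simp
    thus ?thesis by (simp only: Power.power_add power_mult \<omega>p power_one mult_1_left)
  qed
  have \<chi>: "\<chi> (of_nat n) = \<omega> ^ n" for n
  proof -
    define m where "m = (SOME m. of_nat m = (of_nat n :: 'a alg_closure))"
    have "of_nat m = (of_nat n :: 'a alg_closure)" unfolding m_def by (rule someI[of _ n]) simp
    hence "m mod p\<^sub>0 = n mod p\<^sub>0" by (simp only: of_nat_eq_iff_cong_CHAR CHAR_eq cong_def)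
    hence "\<omega> ^ m = \<omega> ^ n" using \<omega>mod by metis
    thus ?thesis by (simp add: \<chi>_def m_def)
  qed
  have Tr_add: "Tr (a + b) = Tr a + Tr b" for a b by (simp add: Tr_def power_add sum.distrib)
  \<comment> \<open>The Frobenius map shifts the summands of the trace cyclically.\<close>
  have Tr_Frob: "Tr (a ^ p\<^sub>0) = Tr a" if "a \<in> F" for a
  proof -
    have "Tr (a ^ p\<^sub>0) = (\<Sum>i<k. a ^ (p\<^sub>0 ^ Suc i))" by (simp add: Tr_def flip: power_mult)
    also have "\<dots> + a ^ (p\<^sub>0 ^ 0) = (\<Sum>i<Suc k. a ^ (p\<^sub>0 ^ i))" by (subst sum.lessThan_Suc_shift) simp
    also have "\<dots> = Tr a + a" using that by (simp add: Tr_def mem_F)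
    finally show ?thesis by simp
  qed
  have Tr_pow: "Tr a ^ p\<^sub>0 = Tr (a ^ p\<^sub>0)" for a
  proof -
    have "(\<Sum>i\<in>I. a ^ (p\<^sub>0 ^ i)) ^ p\<^sub>0 = (\<Sum>i\<in>I. (a ^ p\<^sub>0) ^ (p\<^sub>0 ^ i))" for I :: "nat set"
    proof (induction I rule: infinite_finite_induct)
      case (insert j I)
      have e: "(a ^ (p\<^sub>0 ^ j)) ^ p\<^sub>0 = (a ^ p\<^sub>0) ^ (p\<^sub>0 ^ j)"
        unfolding power_mult[symmetric] by (rule arg_cong[of _ _ "(^) a"]) (rule mult.commute)
      show ?case using power_add[of _ _ 1] insert e by simp
    qed (use p0 in simp_all)
    thus ?thesis by (simp add: Tr_def)
  qed
  have Tr_prime: "\<exists>n. Tr a = of_nat n" if "a \<in> F" for a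
    using prime_field[of "Tr a"] Tr_pow Tr_Frob[OF that] by metis
  have "\<exists>a\<in>F. Tr a \<noteq> 0"
  proof (rule ccontr)
    assume *: "\<not> (\<exists>a\<in>F. Tr a \<noteq> 0)"
    \<comment> \<open>The trace as a polynomial: its degree is below Q, so it cannot vanish on all Q
      elements of \<open>F\<close>.\<close>
    define f :: "'a alg_closure poly" where "f = (\<Sum>i<k. monom 1 (p\<^sub>0 ^ i))"
    have f: "poly f a = Tr a" for a by (simp add: f_def Tr_def poly_sum poly_monom)
    have "coeff f (p\<^sub>0 ^ (k - 1)) = (\<Sum>i<k. if i = k - 1 then 1 else 0)"
      unfolding f_def coeff_sum using p0 by (intro sum.cong) auto
    hence f0: "f \<noteq> 0" using k_pos by auto
    have "degree f \<le> p\<^sub>0 ^ (k - 1)"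
      unfolding f_def using p0
      by (intro degree_sum_le) (auto intro!: order_trans[OF degree_monom_le] power_increasing)
    moreover have "p\<^sub>0 ^ (k - 1) < p\<^sub>0 ^ k" using p0 k_pos by (intro power_strict_increasing) auto
    moreover have "Q \<le> card {a. poly f a = 0}"
      unfolding card_F[symmetric] using * by (intro card_mono poly_roots_finite f0) (auto simp: f)
    moreover have "card {a. poly f a = 0} \<le> degree f" using f0 by (rule card_poly_roots_bound)
    ultimately show False by (simp add: Q_eq)
  qed
  then obtain a where a: "a \<in> F" "Tr a \<noteq> 0" by blast
  then obtain n where n: "Tr a = of_nat n" using Tr_prime by blast
  \<comment> \<open>The trace is linear over the prime field, so this scaling turns it into 1, where
    the character takes the value \<omega>.\<close>
  define a' where "a' = a / of_nat n"
  have "a' \<in> F" unfolding a'_def using a(1) F_of_nat F_divide by blast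
  moreover have "Tr a' = 1"
    using a(2) n by (simp add: a'_def Tr_def power_divide power_of_nat flip: sum_divide_distrib)
  hence "\<chi> (Tr a') \<noteq> 1" using \<chi>[of 1] \<omega>1 by simp
  moreover have "\<chi> (Tr (a + b)) = \<chi> (Tr a) * \<chi> (Tr b)" if ab: "a \<in> F" "b \<in> F" for a b
  proof -
    obtain n m where nm: "Tr a = of_nat n" "Tr b = of_nat m" using Tr_prime ab by blast
    hence "Tr (a + b) = of_nat (n + m)" by (simp add: Tr_add)
    thus ?thesis by (simp only: nm \<chi> Power.power_add)
  qed
  moreover have "norm (\<chi> t) = 1" for t by (simp add: \<chi>_def \<omega>_def norm_power)
  ultimately show ?thesis using Tr_Frob by (intro exI[of _ "\<lambda>a. \<chi> (Tr a)"]) auto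
qed

end

section \<open>Orthogonality of additive characters\<close>

locale character = char_p_closure p\<^sub>0 k Q F
  for p\<^sub>0 k Q :: nat and F :: "'a::field alg_closure set" +
  fixes \<psi> :: "'a alg_closure \<Rightarrow> complex"
  assumes psi_add: "a \<in> F \<Longrightarrow> b \<in> F \<Longrightarrow> \<psi> (a + b) = \<psi> a * \<psi> b"
    and norm_psi: "norm (\<psi> a) = 1"
    and psi_Frobenius: "a \<in> F \<Longrightarrow> \<psi> (a ^ p\<^sub>0) = \<psi> a"
    and psi_nontrivial: "\<exists>a\<in>F. \<psi> a \<noteq> 1"
begin

lemma psi_nonzero: "\<psi> a \<noteq> 0"
  using norm_psi[of a] by auto

lemma psi_0: "\<psi> 0 = 1"
  using psi_add[OF F_0 F_0] psi_nonzero[of 0] by simp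

lemma psi_minus: assumes "a \<in> F" shows "\<psi> (- a) = cnj (\<psi> a)"
proof -
  have "\<psi> a * \<psi> (- a) = 1" using psi_add[OF assms F_minus[OF assms]] by (simp add: psi_0)
  moreover have "\<psi> a * cnj (\<psi> a) = 1" using norm_psi[of a] by (simp add: complex_norm_square[symmetric])
  ultimately show ?thesis using psi_nonzero[of a] by (metis mult_left_cancel)
qed

lemma psi_Frobenius_power: "a \<in> F \<Longrightarrow> \<psi> (a ^ (p\<^sub>0 ^ j)) = \<psi> a"
proof (induction j)
  case (Suc j)
  have "\<psi> (a ^ (p\<^sub>0 ^ Suc j)) = \<psi> ((a ^ (p\<^sub>0 ^ j)) ^ p\<^sub>0)"
    by (simp add: mult.commute flip: power_mult)
  thus ?case using Suc psi_Frobenius F_power by simp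
qed simp

text \<open>For nonzero c, a translation by some a with \<psi> a different from 1 permutes the terms
  but multiplies the sum by \<psi> a.\<close>

lemma sum_psi_scale: assumes "c \<in> F" shows "(\<Sum>u\<in>F. \<psi> (c * u)) = (if c = 0 then of_nat Q else 0)"
proof (cases "c = 0")
  case True
  thus ?thesis using card_F by (simp add: psi_0)
next
  case False
  obtain a where a: "a \<in> F" "\<psi> a \<noteq> 1" using psi_nontrivial by blast
  have "(\<Sum>u\<in>F. \<psi> (c * u)) = (\<Sum>u\<in>F. \<psi> u)"
    using sum.reindex_bij_betw[OF bij_betw_scale[OF assms False], of \<psi>] .
  moreover have "\<psi> a * (\<Sum>u\<in>F. \<psi> u) = (\<Sum>u\<in>F. \<psi> (a + u))"
    using a(1) by (simp add: sum_distrib_left psi_add)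
  moreover have "\<dots> = (\<Sum>u\<in>F. \<psi> u)"
    using sum.reindex_bij_betw[OF bij_betw_translate[OF a(1)], of \<psi>] .
  ultimately show ?thesis using a(2) False by (metis mult_cancel_right1)
qed

lemma sum_psi_scale_Frobenius:
  assumes "c \<in> F" shows "(\<Sum>u\<in>F. \<psi> (c * u ^ (p\<^sub>0 ^ j))) = (if c = 0 then of_nat Q else 0)"
  using sum.reindex_bij_betw[OF bij_betw_Frobenius[of j], of "\<lambda>u. \<psi> (c * u)"] sum_psi_scale[OF assms] by simp

end

section \<open>Character sums of the quadratic form f\<close>

locale quadratic_character = character +
  fixes p m :: nat
  assumes p_eq: "p = p\<^sub>0 ^ m" and m_pos: "m > 0" and p0_odd: "p\<^sub>0 \<noteq> 2"
begin

definition f :: "'a alg_closure \<Rightarrow> 'a alg_closure" where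
  "f a = 2 * a ^ (p + 1) + a ^ 2"

definition S :: "'a alg_closure \<Rightarrow> complex" where
  "S c = (\<Sum>a\<in>F. \<psi> (c * f a))"

lemma p_gt_1: "p > 1"
  unfolding p_eq using prime_gt_1_nat[OF prime_p0] m_pos by (intro one_less_power)

lemma two_nonzero: "(2 :: 'a alg_closure) \<noteq> 0"
proof
  assume "(2 :: 'a alg_closure) = 0"
  hence "(of_nat 2 :: 'a alg_closure) = 0" by simp
  hence "p\<^sub>0 dvd 2" by (simp only: of_nat_eq_0_iff_char_dvd CHAR_eq)
  hence "p\<^sub>0 \<le> 2" by (auto dest: dvd_imp_le)
  thus False using p0_odd prime_gt_1_nat[OF prime_p0] by simp
qed

lemma F_f: "a \<in> F \<Longrightarrow> f a \<in> F"
  unfolding f_def by (intro F_closed)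

lemma power_p_add: "(a + b :: 'a alg_closure) ^ p = a ^ p + b ^ p"
  unfolding p_eq by (rule power_add)

lemma power_p_two: "(2 :: 'a alg_closure) ^ p = 2"
  using power_of_nat[of 2 m] by (simp add: p_eq)

lemma psi_power_p: "a \<in> F \<Longrightarrow> \<psi> (a ^ p) = \<psi> a"
  unfolding p_eq by (rule psi_Frobenius_power)

lemma S_0: "S 0 = of_nat Q"
  by (simp add: S_def psi_0 card_F)

text \<open>The equation is detected by orthogonality over c. When b is summed first, Frobenius
  invariance turns \<psi>(cb - cb^q) into \<psi>((c^q - c)b^q), so that only the c with c^q = c
  remain.\<close>

lemma card_points_eq_sum:
  assumes q: "q = p\<^sub>0 ^ j"
  shows "of_nat (card {(a, b). a \<in> F \<and> b \<in> F \<and> b ^ q - b = f a}) = (\<Sum>c\<in>{c\<in>F. c ^ q = c}. S c)"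
proof -
  have inner: "(\<Sum>b\<in>F. \<psi> (c * b - c * b ^ q)) = (if c ^ q = c then of_nat Q else 0)" if c: "c \<in> F" for c
  proof -
    have "(\<Sum>b\<in>F. \<psi> (c * b - c * b ^ q)) = (\<Sum>b\<in>F. \<psi> ((c ^ q - c) * b ^ q))"
    proof (intro sum.cong refl)
      fix b assume b: "b \<in> F"
      have "\<psi> (c * b - c * b ^ q) = \<psi> (c * b) * \<psi> (- (c * b ^ q))"
        using psi_add[of "c * b" "- (c * b ^ q)"] b c by (simp add: F_closed)
      also have "\<psi> (c * b) = \<psi> ((c * b) ^ q)" unfolding q using b c by (simp add: psi_Frobenius_power F_closed)
      also have "\<psi> ((c * b) ^ q) * \<psi> (- (c * b ^ q)) = \<psi> ((c * b) ^ q + - (c * b ^ q))"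
        using b c by (intro psi_add[symmetric] F_closed)
      finally show "\<psi> (c * b - c * b ^ q) = \<psi> ((c ^ q - c) * b ^ q)"
        by (simp add: power_mult_distrib algebra_simps)
    qed
    also have "\<dots> = (if c ^ q - c = 0 then of_nat Q else 0)"
      unfolding q using c by (intro sum_psi_scale_Frobenius F_closed)
    finally show ?thesis by simp
  qed
  have "of_nat Q * of_nat (card {(a, b). a \<in> F \<and> b \<in> F \<and> b ^ q - b = f a}) =
      (\<Sum>(a, b)\<in>F \<times> F. if b ^ q - b = f a then of_nat Q else (0 :: complex))"
  proof -
    have "{(a, b). a \<in> F \<and> b \<in> F \<and> b ^ q - b = f a} = {ab \<in> F \<times> F. snd ab ^ q - snd ab = f (fst ab)}" by auto
    thus ?thesis using finite_F by (simp add: sum.If_cases case_prod_unfold Int_def)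
  qed
  also have "\<dots> = (\<Sum>(a, b)\<in>F \<times> F. \<Sum>c\<in>F. \<psi> ((f a - (b ^ q - b)) * c))"
  proof (intro sum.cong refl, clarify)
    fix a b assume "a \<in> F" "b \<in> F"
    hence "f a - (b ^ q - b) \<in> F" by (intro F_closed F_f)
    from sum_psi_scale[OF this]
    show "(if b ^ q - b = f a then of_nat Q else 0) = (\<Sum>c\<in>F. \<psi> ((f a - (b ^ q - b)) * c))"
      by (auto split: if_splits)
  qed
  also have "\<dots> = (\<Sum>a\<in>F. \<Sum>b\<in>F. \<Sum>c\<in>F. \<psi> (c * f a) * \<psi> (c * b - c * b ^ q))"
    unfolding sum.cartesian_product[symmetric]
  proof (intro sum.cong refl)
    fix a b c assume abc: "a \<in> F" "b \<in> F" "c \<in> F"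
    have "(f a - (b ^ q - b)) * c = c * f a + (c * b - c * b ^ q)" by (simp add: algebra_simps)
    thus "\<psi> ((f a - (b ^ q - b)) * c) = \<psi> (c * f a) * \<psi> (c * b - c * b ^ q)"
      using abc by (simp only: psi_add F_closed F_f)
  qed
  also have "\<dots> = (\<Sum>a\<in>F. \<Sum>c\<in>F. \<psi> (c * f a) * (\<Sum>b\<in>F. \<psi> (c * b - c * b ^ q)))"
    unfolding sum_distrib_left by (intro sum.cong refl sum.swap)
  also have "\<dots> = (\<Sum>c\<in>F. \<Sum>a\<in>F. \<psi> (c * f a) * (\<Sum>b\<in>F. \<psi> (c * b - c * b ^ q)))"
    by (rule sum.swap)
  also have "\<dots> = (\<Sum>c\<in>F. S c * (if c ^ q = c then of_nat Q else 0))"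
    unfolding S_def sum_distrib_right by (intro sum.cong refl) (simp add: inner)
  also have "\<dots> = (\<Sum>c\<in>F. if c ^ q = c then S c * of_nat Q else 0)"
    by (intro sum.cong) auto
  also have "\<dots> = of_nat Q * (\<Sum>c\<in>{c\<in>F. c ^ q = c}. S c)"
    using finite_F by (simp add: sum.If_cases sum_distrib_left mult.commute Int_def)
  finally show ?thesis using Q_pos by simp
qed

text \<open>The radical of the quadratic form c f: those h for which c f(b + h) - c f(b) - c f(h)
  has value 1 under \<psi> for every b.\<close>

definition W :: "'a alg_closure \<Rightarrow> 'a alg_closure set" where
  "W c = {h\<in>F. c * h + c ^ p * (h ^ (p ^ 2) + h ^ p) = 0}"

text \<open>Differencing: in S(c) times its conjugate put a = b + h. The sum over b vanishes unless
  h is in the radical, which leaves Q times a sum of \<open>card (W c)\<close> numbers of absolute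
  value 1.\<close>

lemma norm_S_squared_le: assumes c: "c \<in> F" shows "norm (S c) ^ 2 \<le> Q * card (W c)"
proof -
  define L where "L h = c * h + c ^ p * (h ^ (p ^ 2) + h ^ p)" for h
  have L: "L h \<in> F" if "h \<in> F" for h unfolding L_def using c that by (intro F_closed)
  have expand: "\<psi> (c * f (b + h)) * cnj (\<psi> (c * f b)) = \<psi> (c * f h) * \<psi> ((2 * L h) * b ^ p)"
    if "b \<in> F" "h \<in> F" for b h
  proof -
    note bh = that
    have "f (b + h) = f b + (f h + (2 * (h * b ^ p) + 2 * ((h ^ p + h) * b)))"
      by (simp add: f_def power_p_add power2_eq_square algebra_simps)
    hence "c * f (b + h) + - (c * f b) = c * f h + (2 * c * h * b ^ p + 2 * (c * (h ^ p + h) * b))"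
      by (simp add: algebra_simps)
    moreover have "\<psi> (c * f (b + h)) * cnj (\<psi> (c * f b)) = \<psi> (c * f (b + h) + - (c * f b))"
      using bh c by (simp only: psi_minus[symmetric] psi_add F_closed F_f)
    ultimately have "\<psi> (c * f (b + h)) * cnj (\<psi> (c * f b)) =
        \<psi> (c * f h) * (\<psi> (2 * c * h * b ^ p) * \<psi> (2 * (c * (h ^ p + h) * b)))"
      using bh c by (simp only: psi_add F_closed F_f)
    \<comment> \<open>The cross terms involve both b and b^p. Raising the term in b to the p-th
      power does not change its character value and makes everything linear in b^p.\<close>
    also have "\<psi> (2 * (c * (h ^ p + h) * b)) = \<psi> ((2 * (c * (h ^ p + h) * b)) ^ p)"
      using bh c by (intro psi_power_p[symmetric] F_closed)
    also have "(2 * (c * (h ^ p + h) * b)) ^ p = 2 * (c ^ p * (h ^ (p ^ 2) + h ^ p) * b ^ p)"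
      by (simp add: power_mult_distrib power_p_add power_p_two power2_eq_square flip: power_mult)
    also have "\<psi> (2 * c * h * b ^ p) * \<psi> \<dots> = \<psi> (2 * c * h * b ^ p + 2 * (c ^ p * (h ^ (p ^ 2) + h ^ p) * b ^ p))"
      using bh c by (intro psi_add[symmetric] F_closed)
    also have "2 * c * h * b ^ p + 2 * (c ^ p * (h ^ (p ^ 2) + h ^ p) * b ^ p) = (2 * L h) * b ^ p"
      by (simp add: L_def algebra_simps)
    finally show ?thesis .
  qed
  have "complex_of_real (norm (S c) ^ 2) = S c * cnj (S c)" by (simp only: complex_norm_square)
  also have "\<dots> = (\<Sum>b\<in>F. (\<Sum>a\<in>F. \<psi> (c * f a)) * cnj (\<psi> (c * f b)))"
    by (simp only: S_def cnj_sum sum_distrib_left)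
  also have "\<dots> = (\<Sum>b\<in>F. (\<Sum>h\<in>F. \<psi> (c * f (b + h))) * cnj (\<psi> (c * f b)))"
  proof (rule sum.cong[OF refl])
    fix b assume "b \<in> F"
    from sum.reindex_bij_betw[OF bij_betw_translate[OF this], of "\<lambda>a. \<psi> (c * f a)"]
    show "(\<Sum>a\<in>F. \<psi> (c * f a)) * cnj (\<psi> (c * f b)) = (\<Sum>h\<in>F. \<psi> (c * f (b + h))) * cnj (\<psi> (c * f b))"
      by (simp only:)
  qed
  also have "\<dots> = (\<Sum>b\<in>F. \<Sum>h\<in>F. \<psi> (c * f h) * \<psi> ((2 * L h) * b ^ p))"
    unfolding sum_distrib_right by (intro sum.cong refl expand)
  also have "\<dots> = (\<Sum>h\<in>F. \<Sum>b\<in>F. \<psi> (c * f h) * \<psi> ((2 * L h) * b ^ p))" by (rule sum.swap)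
  also have "\<dots> = (\<Sum>h\<in>F. \<psi> (c * f h) * (if L h = 0 then of_nat Q else 0))"
  proof (intro sum.cong refl)
    fix h assume "h \<in> F"
    hence "2 * L h \<in> F" using L by (intro F_closed)
    from sum_psi_scale_Frobenius[OF this, of m]
    show "(\<Sum>b\<in>F. \<psi> (c * f h) * \<psi> ((2 * L h) * b ^ p)) = \<psi> (c * f h) * (if L h = 0 then of_nat Q else 0)"
      using two_nonzero by (simp add: p_eq flip: sum_distrib_left)
  qed
  also have "\<dots> = (\<Sum>h\<in>F. if L h = 0 then \<psi> (c * f h) * of_nat Q else 0)" by (intro sum.cong) auto
  also have "\<dots> = (\<Sum>h\<in>W c. \<psi> (c * f h) * of_nat Q)"
    using finite_F by (simp add: sum.If_cases W_def L_def Int_def)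
  finally have "norm (S c) ^ 2 = norm (\<Sum>h\<in>W c. \<psi> (c * f h) * of_nat Q)"
    by (metis norm_of_real abs_of_nonneg zero_le_power2)
  also have "\<dots> \<le> (\<Sum>h\<in>W c. norm (\<psi> (c * f h) * of_nat Q))" by (rule norm_sum)
  also have "\<dots> = real Q * real (card (W c))" by (simp add: norm_mult norm_psi)
  finally show ?thesis by simp
qed

lemma card_W_le: assumes "c \<noteq> 0" shows "card (W c) \<le> p ^ 2"
proof -
  define g where "g = monom (c ^ p) (p ^ 2) + (monom (c ^ p) p + monom c 1)"
  have "p < p ^ 2" using p_gt_1 by (simp add: power2_eq_square)
  hence lt: "degree (monom (c ^ p) p + monom c 1) < degree (monom (c ^ p) (p ^ 2))"
    using assms p_gt_1 by (intro degree_add_less) (auto simp: degree_monom_eq)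
  have deg: "degree g = p ^ 2"
    unfolding g_def using degree_add_eq_left[OF lt] assms by (simp add: degree_monom_eq)
  hence "g \<noteq> 0" using p_gt_1 by auto
  hence "card {h. poly g h = 0} \<le> p ^ 2" using card_poly_roots_bound[of g] deg by simp
  moreover have "W c \<subseteq> {h. poly g h = 0}" by (auto simp: W_def g_def poly_monom algebra_simps)
  hence "card (W c) \<le> card {h. poly g h = 0}" using \<open>g \<noteq> 0\<close> by (intro card_mono poly_roots_finite)
  ultimately show ?thesis by simp
qed

lemma norm_S_le: assumes "c \<in> F" "c \<noteq> 0" shows "norm (S c) \<le> p * sqrt Q"
proof -
  have "norm (S c) ^ 2 \<le> Q * card (W c)" using assms(1) by (rule norm_S_squared_le)
  also have "\<dots> \<le> Q * p ^ 2" using card_W_le[OF assms(2)] by (intro of_nat_mono mult_le_mono2)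
  also have "real (Q * p ^ 2) = (p * sqrt Q) ^ 2" by (simp add: power_mult_distrib)
  finally show ?thesis by (rule power2_le_imp_le) simp
qed

end

section \<open>Quadratic Gauss sums\<close>

context quadratic_character
begin

definition gauss :: "'a alg_closure \<Rightarrow> complex" where
  "gauss a = (\<Sum>y\<in>F. \<psi> (a * y ^ 2))"

text \<open>The same differencing as for \<open>S\<close>; here the radical is 0, so the absolute
  value is exact.\<close>

lemma norm_gauss: assumes a: "a \<in> F" "a \<noteq> 0" shows "norm (gauss a) = sqrt Q"
proof -
  have expand: "\<psi> (a * (b + h) ^ 2) * cnj (\<psi> (a * b ^ 2)) = \<psi> (a * h ^ 2) * \<psi> ((2 * a * h) * b)"
    if "b \<in> F" "h \<in> F" for b h
  proof -
    have "a * (b + h) ^ 2 + - (a * b ^ 2) = a * h ^ 2 + (2 * a * h) * b"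
      by (simp add: power2_eq_square algebra_simps)
    moreover have "\<psi> (a * (b + h) ^ 2) * cnj (\<psi> (a * b ^ 2)) = \<psi> (a * (b + h) ^ 2 + - (a * b ^ 2))"
      using a that by (simp only: psi_minus[symmetric] psi_add F_closed)
    ultimately show ?thesis using a that by (simp only: psi_add F_closed)
  qed
  have "complex_of_real (norm (gauss a) ^ 2) = gauss a * cnj (gauss a)" by (simp only: complex_norm_square)
  also have "\<dots> = (\<Sum>b\<in>F. (\<Sum>y\<in>F. \<psi> (a * y ^ 2)) * cnj (\<psi> (a * b ^ 2)))"
    by (simp only: gauss_def cnj_sum sum_distrib_left)
  also have "\<dots> = (\<Sum>b\<in>F. (\<Sum>h\<in>F. \<psi> (a * (b + h) ^ 2)) * cnj (\<psi> (a * b ^ 2)))"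
  proof (rule sum.cong[OF refl])
    fix b assume "b \<in> F"
    from sum.reindex_bij_betw[OF bij_betw_translate[OF this], of "\<lambda>y. \<psi> (a * y ^ 2)"]
    show "(\<Sum>y\<in>F. \<psi> (a * y ^ 2)) * cnj (\<psi> (a * b ^ 2)) = (\<Sum>h\<in>F. \<psi> (a * (b + h) ^ 2)) * cnj (\<psi> (a * b ^ 2))"
      by (simp only:)
  qed
  also have "\<dots> = (\<Sum>b\<in>F. \<Sum>h\<in>F. \<psi> (a * h ^ 2) * \<psi> ((2 * a * h) * b))"
    unfolding sum_distrib_right by (intro sum.cong refl expand)
  also have "\<dots> = (\<Sum>h\<in>F. \<Sum>b\<in>F. \<psi> (a * h ^ 2) * \<psi> ((2 * a * h) * b))" by (rule sum.swap)
  also have "\<dots> = (\<Sum>h\<in>F. if h = 0 then of_nat Q else 0)"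
  proof (intro sum.cong refl)
    fix h assume "h \<in> F"
    hence "2 * a * h \<in> F" using a by (intro F_closed)
    from sum_psi_scale[OF this]
    show "(\<Sum>b\<in>F. \<psi> (a * h ^ 2) * \<psi> ((2 * a * h) * b)) = (if h = 0 then of_nat Q else 0)"
      using two_nonzero a(2) by (simp add: psi_0 flip: sum_distrib_left)
  qed
  also have "\<dots> = of_nat Q" using finite_F F_0 by simp
  finally have "norm (gauss a) ^ 2 = real Q" by (metis of_real_eq_iff of_real_of_nat_eq)
  thus ?thesis by (metis norm_ge_zero real_sqrt_unique)
qed

lemma gauss_square_scale: assumes "d \<in> F" "d \<noteq> 0" shows "gauss (d ^ 2) = gauss 1"
  unfolding gauss_def
  using sum.reindex_bij_betw[OF bij_betw_scale[OF assms], of "\<lambda>y. \<psi> (1 * y ^ 2)"]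
  by (simp add: power_mult_distrib)

text \<open>An even power of the odd number \<open>p\<^sub>0\<close> is 1 modulo 4, and the fourth
  power of i is 1.\<close>

lemma sqrt_minus_one_mem:
  assumes "(i :: 'a alg_closure) ^ 2 = -1" "even l" shows "i ^ (p\<^sub>0 ^ l) = i"
proof -
  obtain h where h: "l = 2 * h" using assms(2) by (rule evenE)
  have "odd p\<^sub>0" using prime_p0 p0_odd prime_odd_nat prime_ge_2_nat by (metis le_neq_implies_less)
  then obtain n where n: "p\<^sub>0 ^ h = 2 * n + 1" by (metis oddE even_power)
  have "p\<^sub>0 ^ l = (p\<^sub>0 ^ h) ^ 2" by (simp add: h mult.commute power_mult)
  also have "\<dots> = 2 * (2 * (n * n + n)) + 1" unfolding n by (simp add: power2_eq_square algebra_simps)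
  finally have "i ^ (p\<^sub>0 ^ l) = i ^ (2 * (2 * (n * n + n)) + 1)" by (simp only:)
  also have "\<dots> = ((i ^ 2) ^ 2) ^ (n * n + n) * i"
    by (simp only: Power.power_add power_mult power_one_right)
  finally have "i ^ (p\<^sub>0 ^ l) = ((i ^ 2) ^ 2) ^ (n * n + n) * i" .
  thus ?thesis using assms(1) by simp
qed

text \<open>Splitting \<open>F = F\<^sub>1 + \<gamma>F\<^sub>1\<close> with \<open>F\<^sub>1\<close> of index two and \<open>\<gamma>\<^sup>2\<close> a non-square of \<open>F\<^sub>1\<close> shows that the Gauss
  sum is minus the square of the Gauss sum of \<open>F\<^sub>1\<close>, which is real.\<close>

lemma gauss_one:
  assumes k: "4 dvd k"
  shows "gauss 1 = - of_real (sqrt Q)"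
proof -
  define l where "l = k div 2"
  have l: "k = l + l" "even l" "l > 0" using k k_pos by (auto simp: l_def)
  define Q1 where "Q1 = p\<^sub>0 ^ l"
  have QQ: "(a ^ Q1) ^ Q1 = a" if "a \<in> F" for a
    using that by (simp add: mem_F Q1_def l(1) Power.power_add flip: power_mult)
  define F1 :: "'a alg_closure set" where "F1 = Fq Q1"
  have mem1: "a \<in> F1 \<longleftrightarrow> a ^ Q1 = a" for a by (simp add: F1_def Fq_def)
  have sub: "a \<in> F" if "a \<in> F1" for a
    using that by (simp add: mem_F mem1 Q1_def l(1) Power.power_add power_mult)
  have pw_add: "(a + b) ^ Q1 = a ^ Q1 + b ^ Q1" for a b :: "'a alg_closure" unfolding Q1_def by (rule power_add)
  have pw_diff: "(a - b) ^ Q1 = a ^ Q1 - b ^ Q1" for a b :: "'a alg_closure" unfolding Q1_def by (rule power_diff)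
  have psi_Q1: "\<psi> (a ^ Q1) = \<psi> a" if "a \<in> F" for a unfolding Q1_def using that by (rule psi_Frobenius_power)
  have two_pw: "2 ^ Q1 = (2 :: 'a alg_closure)" using power_of_nat[of 2 l] by (simp add: Q1_def)
  have "odd p\<^sub>0" using prime_p0 p0_odd prime_odd_nat prime_ge_2_nat by (metis le_neq_implies_less)
  hence "odd Q1" by (simp add: Q1_def)
  have pw_minus: "(- a) ^ Q1 = - (a ^ Q1)" for a :: "'a alg_closure" using \<open>odd Q1\<close> by simp
  \<comment> \<open>The relative trace y + y^Q1 lies in F1 and has character value (\<psi> y)^2. If
    \<psi> were trivial on F1, all these squares would be 1, and writing y as twice y/2 would make
    \<psi> trivial on F.\<close>
  have F1_nontrivial: "\<exists>a\<in>F1. \<psi> a \<noteq> 1"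
  proof (rule ccontr)
    assume *: "\<not> (\<exists>a\<in>F1. \<psi> a \<noteq> 1)"
    have sq: "\<psi> y * \<psi> y = 1" if "y \<in> F" for y
    proof -
      have "y + y ^ Q1 \<in> F1" using QQ[OF that] by (simp add: mem1 pw_add add.commute)
      hence "\<psi> (y + y ^ Q1) = 1" using * by blast
      thus ?thesis using that by (simp add: psi_add F_closed psi_Q1)
    qed
    have "\<psi> y = 1" if "y \<in> F" for y
    proof -
      have "y = y / 2 + y / 2" using two_nonzero by (simp add: field_simps)
      hence "\<psi> y = \<psi> (y / 2) * \<psi> (y / 2)" using that psi_add[of "y / 2" "y / 2"] F_divide[OF that F_numeral] by metis
      thus ?thesis using sq[of "y / 2"] that F_closed by simp
    qed
    thus False using psi_nontrivial by blast
  qed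
  interpret F1: character p\<^sub>0 l Q1 F1 \<psi>
    by unfold_locales (use prime_p0 CHAR_eq l sub psi_add psi_Frobenius F1_nontrivial norm_psi in
        \<open>auto simp: Q1_def F1_def\<close>)
  have "Q1 > 1" unfolding Q1_def using prime_gt_1_nat[OF prime_p0] l(3) by (intro one_less_power)
  define n where "n = Q1 - 1"
  have n: "Q1 = Suc n" "n > 0" using \<open>Q1 > 1\<close> by (simp_all add: n_def)
  \<comment> \<open>The map y to y^Q1 is the conjugation of F over F1. A (Q1 - 1)-th root of -1 is
    negated by it, so it lies in F but not in F1.\<close>
  obtain \<gamma> :: "'a alg_closure" where "\<gamma> ^ n = -1" using nth_root_exists[OF n(2)] by blast
  hence \<gamma>: "\<gamma> ^ Q1 = - \<gamma>" "\<gamma> \<noteq> 0" using n by (auto simp: power_0_left)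
  have \<gamma>F: "\<gamma> \<in> F" using \<gamma>(1) by (simp add: mem_F l(1) Power.power_add power_mult pw_minus flip: Q1_def)
  have bij: "bij_betw (\<lambda>(u, v). u + \<gamma> * v) (F1 \<times> F1) F"
  proof (rule bij_betw_byWitness[where f' = "\<lambda>y. ((y + y ^ Q1) / 2, (y - y ^ Q1) / (2 * \<gamma>))"])
    show "\<forall>uv\<in>F1 \<times> F1. (\<lambda>y. ((y + y ^ Q1) / 2, (y - y ^ Q1) / (2 * \<gamma>))) (case uv of (u, v) \<Rightarrow> u + \<gamma> * v) = uv"
      using two_nonzero \<gamma> by (auto simp: mem1 pw_add power_mult_distrib field_simps)
    show "\<forall>y\<in>F. (case ((y + y ^ Q1) / 2, (y - y ^ Q1) / (2 * \<gamma>)) of (u, v) \<Rightarrow> u + \<gamma> * v) = y"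
      using two_nonzero \<gamma> by (auto simp: field_simps)
    show "(\<lambda>(u, v). u + \<gamma> * v) ` (F1 \<times> F1) \<subseteq> F"
      using sub \<gamma>F by (auto intro!: F_add F_mult)
    show "(\<lambda>y. ((y + y ^ Q1) / 2, (y - y ^ Q1) / (2 * \<gamma>))) ` F \<subseteq> F1 \<times> F1"
    proof clarify
      fix y assume y: "y \<in> F"
      have "(y - y ^ Q1) ^ Q1 = - (y - y ^ Q1)" using QQ[OF y] by (simp add: pw_diff)
      moreover have "- ((y ^ Q1 - y) / (2 * \<gamma>)) = (y - y ^ Q1) / (2 * \<gamma>)" by (simp add: diff_divide_distrib)
      ultimately show "(y + y ^ Q1) / 2 \<in> F1 \<and> (y - y ^ Q1) / (2 * \<gamma>) \<in> F1"
        using QQ[OF y] \<gamma> by (simp add: mem1 power_divide pw_add two_pw power_mult_distrib add.commute)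
    qed
  qed
  define g1 where "g1 = (\<Sum>u\<in>F1. \<psi> (u ^ 2))"
  define g2 where "g2 = (\<Sum>v\<in>F1. \<psi> ((\<gamma> * v) ^ 2))"
  have "gauss 1 = (\<Sum>(u, v)\<in>F1 \<times> F1. \<psi> ((u + \<gamma> * v) ^ 2))"
    unfolding gauss_def using sum.reindex_bij_betw[OF bij, of "\<lambda>y. \<psi> (1 * y ^ 2)"]
    by (simp add: case_prod_unfold)
  also have "\<dots> = (\<Sum>u\<in>F1. \<Sum>v\<in>F1. \<psi> (u ^ 2) * \<psi> ((\<gamma> * v) ^ 2))"
    unfolding sum.cartesian_product[symmetric]
  proof (intro sum.cong refl)
    fix u v assume uv: "u \<in> F1" "v \<in> F1"
    \<comment> \<open>Half of the mixed term of the square. Conjugation sends t to -t and preserves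
      \<psi>, so the mixed term 2t has character value 1 and the double sum factors.\<close>
    define t where "t = \<gamma> * u * v"
    have tF: "t \<in> F" unfolding t_def using sub uv \<gamma>F by (intro F_mult) auto
    have "t ^ Q1 = - t" using uv \<gamma> by (simp add: t_def power_mult_distrib mem1)
    hence "\<psi> t = \<psi> (- t)" using psi_Q1[OF tF] by simp
    hence "\<psi> (t + t) = \<psi> (t + - t)" using tF by (simp only: psi_add F_closed)
    hence t: "\<psi> (t + t) = 1" by (simp add: psi_0)
    have "(u + \<gamma> * v) ^ 2 = u ^ 2 + ((\<gamma> * v) ^ 2 + (t + t))"
      by (simp add: t_def power2_eq_square algebra_simps)
    thus "\<psi> ((u + \<gamma> * v) ^ 2) = \<psi> (u ^ 2) * \<psi> ((\<gamma> * v) ^ 2)"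
      using uv[THEN sub] \<gamma>F tF t by (simp only: psi_add F_closed mult_1_right)
  qed
  also have "\<dots> = g1 * g2" by (simp add: g1_def g2_def sum_product)
  finally have prod: "gauss 1 = g1 * g2" .
  \<comment> \<open>A square root s of t is either fixed or negated by conjugation. In the first
    case s and -s lie in F1, in the second s/\<gamma> and -s/\<gamma> do; for s = 0 each of the two
    sets has one element.\<close>
  have fiber: "card {u\<in>F1. u ^ 2 = t} + card {v\<in>F1. (\<gamma> * v) ^ 2 = t} = 2" if t: "t \<in> F1" for t
  proof -
    obtain s where s: "s ^ 2 = t" using nth_root_exists[of 2 t] by auto
    have "(s ^ Q1) ^ 2 = t ^ Q1" by (simp add: s[symmetric] mult.commute flip: power_mult)
    hence "(s ^ Q1) ^ 2 = s ^ 2" using t s by (simp add: mem1)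
    hence cases: "s ^ Q1 = s \<or> s ^ Q1 = - s" by (simp add: power2_eq_iff)
    have roots: "y ^ 2 = t \<longleftrightarrow> y = s \<or> y = - s" for y using s by (auto simp: power2_eq_iff)
    have ne: "s \<noteq> - s" if "s \<noteq> 0"
      using that two_nonzero by (metis add.right_inverse mult_2 mult_eq_0_iff)
    show ?thesis
    proof (cases "s = 0")
      case True
      hence "{u\<in>F1. u ^ 2 = t} = {0}" "{v\<in>F1. (\<gamma> * v) ^ 2 = t} = {0}"
        using s \<gamma> F1.F_0 by auto
      thus ?thesis by simp
    next
      case False
      show ?thesis
      proof (cases "s ^ Q1 = s")
        case True
        hence e1: "{u\<in>F1. u ^ 2 = t} = {s, - s}" by (auto simp: roots mem1 pw_minus)
        have e2: "{v\<in>F1. (\<gamma> * v) ^ 2 = t} = {}"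
        proof (rule ccontr)
          assume "{v\<in>F1. (\<gamma> * v) ^ 2 = t} \<noteq> {}"
          then obtain v where v: "v \<in> F1" "(\<gamma> * v) ^ 2 = t" by blast
          hence "(\<gamma> * v) ^ Q1 = \<gamma> * v" using True unfolding roots by (auto simp: pw_minus)
          moreover have "(\<gamma> * v) ^ Q1 = - (\<gamma> * v)" using v(1) \<gamma> by (simp add: power_mult_distrib mem1)
          moreover have "\<gamma> * v = s \<or> \<gamma> * v = - s" using v(2) by (simp only: roots)
          ultimately show False using ne[OF False] by auto
        qed
        show ?thesis unfolding e1 e2 using ne[OF False] by simp
      next
        case neq: False
        hence sQ: "s ^ Q1 = - s" using cases by simp
        have e1: "{u\<in>F1. u ^ 2 = t} = {}"
          using neq sQ ne[OF False] by (auto simp: roots mem1 pw_minus)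
        have e2: "{v\<in>F1. (\<gamma> * v) ^ 2 = t} = {s / \<gamma>, - s / \<gamma>}"
        proof (rule Set.set_eqI)
          fix v
          have "(\<gamma> * v) ^ 2 = t \<longleftrightarrow> v = s / \<gamma> \<or> v = - s / \<gamma>"
            unfolding roots using \<gamma>(2) by (simp add: eq_divide_eq mult.commute del: divide_minus_left)
          moreover have "s / \<gamma> \<in> F1" "- s / \<gamma> \<in> F1"
            using \<gamma> sQ by (simp_all add: mem1 power_divide pw_minus)
          ultimately show "v \<in> {v\<in>F1. (\<gamma> * v) ^ 2 = t} \<longleftrightarrow> v \<in> {s / \<gamma>, - s / \<gamma>}"
            by blast
        qed
        have "s / \<gamma> \<noteq> - s / \<gamma>" using ne[OF False] \<gamma> by simp
        thus ?thesis unfolding e1 e2 by simp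
      qed
    qed
  qed
  have \<gamma>2: "(\<gamma> * v) ^ 2 \<in> F1" if "v \<in> F1" for v
  proof -
    have "(\<gamma> * v) ^ Q1 = - (\<gamma> * v)" using that \<gamma> by (simp add: power_mult_distrib mem1)
    hence "((\<gamma> * v) ^ Q1) ^ 2 = (\<gamma> * v) ^ 2" by simp
    thus ?thesis unfolding mem1 by (simp only: power_mult[symmetric] mult.commute)
  qed
  have "g1 = (\<Sum>t\<in>F1. \<Sum>u\<in>{u\<in>F1. u ^ 2 = t}. \<psi> (u ^ 2))"
    unfolding g1_def using F1.finite_F F1.F_power by (intro sum.group[symmetric]) auto
  also have "\<dots> = (\<Sum>t\<in>F1. of_nat (card {u\<in>F1. u ^ 2 = t}) * \<psi> t)" by (intro sum.cong) auto
  finally have 1: "g1 = \<dots>" .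
  have "g2 = (\<Sum>t\<in>F1. \<Sum>v\<in>{v\<in>F1. (\<gamma> * v) ^ 2 = t}. \<psi> ((\<gamma> * v) ^ 2))"
    unfolding g2_def using F1.finite_F \<gamma>2 by (intro sum.group[symmetric]) auto
  also have "\<dots> = (\<Sum>t\<in>F1. of_nat (card {v\<in>F1. (\<gamma> * v) ^ 2 = t}) * \<psi> t)" by (intro sum.cong) auto
  finally have 2: "g2 = \<dots>" .
  have "g1 + g2 = (\<Sum>t\<in>F1. of_nat (card {u\<in>F1. u ^ 2 = t} + card {v\<in>F1. (\<gamma> * v) ^ 2 = t}) * \<psi> t)"
    unfolding 1 2 by (simp add: sum.distrib distrib_right)
  also have "\<dots> = (\<Sum>t\<in>F1. 2 * \<psi> (1 * t))" by (intro sum.cong refl) (simp only: fiber, simp)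
  also have "\<dots> = 0" using F1.sum_psi_scale[OF F1.F_1] by (simp flip: sum_distrib_left)
  finally have "g2 = - g1" by (simp add: eq_neg_iff_add_eq_0 add.commute)
  \<comment> \<open>As l is even, -1 is a square in F1. The substitution of iu for u conjugates
    every summand of g1, which is therefore real.\<close>
  obtain i :: "'a alg_closure" where i: "i ^ 2 = -1" using nth_root_exists[of 2 "-1"] by auto
  have iF1: "i \<in> F1" "i \<noteq> 0" using sqrt_minus_one_mem[OF i l(2)] i by (auto simp: mem1 Q1_def)
  have "cnj g1 = (\<Sum>u\<in>F1. \<psi> ((i * u) ^ 2))"
    unfolding g1_def cnj_sum using sub i
    by (intro sum.cong refl) (simp add: psi_minus[symmetric] F_closed power_mult_distrib)
  also have "\<dots> = g1" unfolding g1_def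
    using sum.reindex_bij_betw[OF F1.bij_betw_scale[OF iF1], of "\<lambda>u. \<psi> (u ^ 2)"] .
  finally have "g1 = of_real (Re g1)" by (simp add: complex_eq_iff)
  hence "gauss 1 = of_real (- ((Re g1) ^ 2))"
    unfolding prod \<open>g2 = - g1\<close> by (metis mult_minus_right of_real_minus of_real_mult power2_eq_square)
  moreover from this have "norm (gauss 1) = (Re g1) ^ 2" by (simp only: norm_of_real) simp
  hence "(Re g1) ^ 2 = sqrt Q" using norm_gauss[OF F_1] by simp
  ultimately show ?thesis by simp
qed

end

section \<open>The sum S(1) and the number of affine points\<close>

context quadratic_character
begin

text \<open>If \<open>h\<^bsup>p\<^sup>2\<^esup> + h\<^sup>p + h\<close> has a nonzero root \<open>w\<close> in \<open>F\<close> and \<open>\<alpha> = w\<^bsup>p-1\<^esup>\<close>, \<open>a = - 1/\<alpha>\<close>, then \<open>f u\<close> and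
  \<open>a(u\<^sup>p - \<alpha>u)\<^sup>2\<close> have the same value under \<open>\<psi>\<close>, which reduces \<open>S 1\<close> to a Gauss sum.\<close>

lemma S_1_eq:
  assumes w: "w \<in> F" "w \<noteq> 0" "w + (w ^ (p ^ 2) + w ^ p) = 0"
  defines "\<alpha> \<equiv> w ^ (p - 1)"
  defines "a \<equiv> - inverse \<alpha>"
  shows "S 1 = gauss a * (\<Sum>b\<in>{b\<in>F. (\<alpha> * b) ^ p = b}. \<psi> (- (b ^ 2 / (4 * a))))"
proof -
  have \<alpha>F: "\<alpha> \<in> F" "\<alpha> \<noteq> 0" using w by (simp_all add: \<alpha>_def F_closed)
  have aF: "a \<in> F" "a \<noteq> 0" using \<alpha>F by (simp_all add: a_def F_closed)
  have "p = Suc (p - 1)" using p_gt_1 by simp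
  hence wp: "w ^ p = \<alpha> * w" unfolding \<alpha>_def by (metis power_Suc2)
  \<comment> \<open>In terms of \<alpha> the condition on w reads 1 + \<alpha> + \<alpha>^(p+1) = 0,
    which gives (1 + \<alpha>)^p = -1/\<alpha> = a.\<close>
  have "w ^ (p ^ 2) = (\<alpha> * w) ^ p" by (simp add: power2_eq_square power_mult wp)
  also have "\<dots> = \<alpha> ^ p * \<alpha> * w" by (simp add: power_mult_distrib wp)
  finally have "w * (1 + \<alpha> * (1 + \<alpha> ^ p)) = 0"
    using w(3) wp by (simp add: algebra_simps)
  hence "\<alpha> * (1 + \<alpha> ^ p) = - 1" using w(2) by (simp add: eq_neg_iff_add_eq_0 add.commute)
  moreover have a\<alpha>: "\<alpha> * a = - 1" using \<alpha>F(2) by (simp add: a_def)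
  ultimately have "\<alpha> * (1 + \<alpha> ^ p) = \<alpha> * a" by (simp only:)
  hence "1 + \<alpha> ^ p = a" using mult_left_cancel[OF \<alpha>F(2)] by blast
  hence a: "(1 + \<alpha>) ^ p = a" by (simp add: power_p_add)
  have a\<alpha>: "a * \<alpha> = - 1" using a\<alpha> by (simp only: mult.commute)
  define L where "L u = u ^ p - \<alpha> * u" for u
  have L: "L u \<in> F" if "u \<in> F" for u unfolding L_def using that \<alpha>F by (intro F_closed)
  \<comment> \<open>In the expanded square, a u^(2p) is the p-th power of (1 + \<alpha>)u^2, so
    \<psi> may drop that exponent; by a\<alpha> = -1 the other terms are 2u^(p+1) -
    \<alpha>u^2.\<close>
  have fL: "\<psi> (f u) = \<psi> (a * L u ^ 2)" if u: "u \<in> F" for u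
  proof -
    have "a * L u ^ 2 = a * (u ^ p) ^ 2 + (a * \<alpha>) * (\<alpha> * u ^ 2 - 2 * u ^ (p + 1))"
      by (simp add: L_def power2_eq_square algebra_simps)
    also have "a * (u ^ p) ^ 2 = ((1 + \<alpha>) * u ^ 2) ^ p"
      by (simp add: a power_mult_distrib mult.commute flip: power_mult)
    finally have "a * L u ^ 2 = ((1 + \<alpha>) * u ^ 2) ^ p + (2 * u ^ (p + 1) - \<alpha> * u ^ 2)"
      by (simp add: a\<alpha>)
    hence "\<psi> (a * L u ^ 2) = \<psi> (((1 + \<alpha>) * u ^ 2) ^ p) * \<psi> (2 * u ^ (p + 1) - \<alpha> * u ^ 2)"
      using u \<alpha>F by (simp only: psi_add F_closed)
    also have "\<psi> (((1 + \<alpha>) * u ^ 2) ^ p) = \<psi> ((1 + \<alpha>) * u ^ 2)"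
      using u \<alpha>F by (intro psi_power_p F_closed)
    also have "\<dots> * \<psi> (2 * u ^ (p + 1) - \<alpha> * u ^ 2) = \<psi> ((1 + \<alpha>) * u ^ 2 + (2 * u ^ (p + 1) - \<alpha> * u ^ 2))"
      using u \<alpha>F by (intro psi_add[symmetric] F_closed)
    also have "(1 + \<alpha>) * u ^ 2 + (2 * u ^ (p + 1) - \<alpha> * u ^ 2) = f u" by (simp add: f_def algebra_simps)
    finally show ?thesis ..
  qed
  \<comment> \<open>L is transposed under the pairing given by \<psi>: b annihilates the image of L
    exactly when (\<alpha>b)^p = b.\<close>
  have inner1: "(\<Sum>u\<in>F. \<psi> (b * L u)) = (if (\<alpha> * b) ^ p = b then of_nat Q else 0)" if b: "b \<in> F" for b
  proof -
    have "(\<Sum>u\<in>F. \<psi> (b * L u)) = (\<Sum>u\<in>F. \<psi> ((b - (\<alpha> * b) ^ p) * u ^ p))"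
    proof (intro sum.cong refl)
      fix u assume u: "u \<in> F"
      have "b * L u = b * u ^ p + - (\<alpha> * b * u)" by (simp add: L_def algebra_simps)
      hence "\<psi> (b * L u) = \<psi> (b * u ^ p) * \<psi> (- (\<alpha> * b * u))" using u b \<alpha>F by (simp only: psi_add F_closed)
      also have "\<psi> (- (\<alpha> * b * u)) = cnj (\<psi> (\<alpha> * b * u))" using u b \<alpha>F by (intro psi_minus F_closed)
      also have "\<psi> (\<alpha> * b * u) = \<psi> ((\<alpha> * b * u) ^ p)" using u b \<alpha>F by (intro psi_power_p[symmetric] F_closed)
      also have "cnj (\<psi> ((\<alpha> * b * u) ^ p)) = \<psi> (- ((\<alpha> * b * u) ^ p))"
        using u b \<alpha>F by (intro psi_minus[symmetric] F_closed)
      also have "\<psi> (b * u ^ p) * \<psi> (- ((\<alpha> * b * u) ^ p)) = \<psi> (b * u ^ p + - ((\<alpha> * b * u) ^ p))"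
        using u b \<alpha>F by (intro psi_add[symmetric] F_closed)
      finally show "\<psi> (b * L u) = \<psi> ((b - (\<alpha> * b) ^ p) * u ^ p)"
        by (simp add: power_mult_distrib algebra_simps)
    qed
    also have "\<dots> = (if b - (\<alpha> * b) ^ p = 0 then of_nat Q else 0)"
      unfolding p_eq using b \<alpha>F by (intro sum_psi_scale_Frobenius F_closed)
    finally show ?thesis by (auto split: if_splits)
  qed
  \<comment> \<open>Completing the square by the shift b/(2a).\<close>
  have inner2: "(\<Sum>y\<in>F. \<psi> (a * y ^ 2 - b * y)) = \<psi> (- (b ^ 2 / (4 * a))) * gauss a" if b: "b \<in> F" for b
  proof -
    have c: "b / (2 * a) \<in> F" using b aF by (intro F_closed)
    have "(\<Sum>y\<in>F. \<psi> (a * y ^ 2 - b * y)) =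
        (\<Sum>y\<in>F. \<psi> (a * (b / (2 * a) + y) ^ 2 - b * (b / (2 * a) + y)))"
      using sum.reindex_bij_betw[OF bij_betw_translate[OF c], of "\<lambda>y. \<psi> (a * y ^ 2 - b * y)"] by simp
    also have "\<dots> = (\<Sum>y\<in>F. \<psi> (- (b ^ 2 / (4 * a))) * \<psi> (a * y ^ 2))"
    proof (intro sum.cong refl)
      fix y assume y: "y \<in> F"
      define c where "c = b / (2 * a)"
      have bc: "b = 2 * a * c" using aF two_nonzero by (simp add: c_def)
      have "4 * a \<noteq> 0" using aF two_nonzero by (metis mult_2 mult_eq_0_iff numeral_Bit0)
      hence "b ^ 2 / (4 * a) = a * c ^ 2" unfolding bc by (simp add: divide_eq_eq power2_eq_square algebra_simps)
      hence "a * (c + y) ^ 2 - b * (c + y) = - (b ^ 2 / (4 * a)) + a * y ^ 2"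
        unfolding bc by (simp add: power2_eq_square algebra_simps)
      hence "\<psi> (a * (c + y) ^ 2 - b * (c + y)) = \<psi> (- (b ^ 2 / (4 * a)) + a * y ^ 2)" by simp
      also have "\<dots> = \<psi> (- (b ^ 2 / (4 * a))) * \<psi> (a * y ^ 2)"
        using b y aF by (intro psi_add F_closed)
      finally show "\<psi> (a * (b / (2 * a) + y) ^ 2 - b * (b / (2 * a) + y)) = \<psi> (- (b ^ 2 / (4 * a))) * \<psi> (a * y ^ 2)"
        unfolding c_def .
    qed
    finally show ?thesis by (simp add: gauss_def sum_distrib_left)
  qed
  \<comment> \<open>Orthogonality over b frees y from the constraint y = L u; then the sum over u is
    linear and the sum over y is a Gauss sum.\<close>
  have "of_nat Q * S 1 = (\<Sum>u\<in>F. of_nat Q * \<psi> (a * L u ^ 2))"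
    by (simp add: S_def sum_distrib_left fL)
  also have "\<dots> = (\<Sum>u\<in>F. \<Sum>y\<in>F. if L u - y = 0 then of_nat Q * \<psi> (a * y ^ 2) else 0)"
    using finite_F L by (intro sum.cong refl) simp
  also have "\<dots> = (\<Sum>u\<in>F. \<Sum>y\<in>F. \<Sum>b\<in>F. \<psi> (b * L u) * \<psi> (a * y ^ 2 - b * y))"
  proof (intro sum.cong refl)
    fix u y assume uy: "u \<in> F" "y \<in> F"
    hence "L u - y \<in> F" using L by (intro F_closed)
    note sum_psi_scale[OF this]
    hence "(if L u - y = 0 then of_nat Q * \<psi> (a * y ^ 2) else 0) = (\<Sum>b\<in>F. \<psi> ((L u - y) * b)) * \<psi> (a * y ^ 2)"
      by (auto split: if_splits)
    also have "\<dots> = (\<Sum>b\<in>F. \<psi> (b * L u) * \<psi> (a * y ^ 2 - b * y))"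
      unfolding sum_distrib_right
    proof (intro sum.cong refl)
      fix b assume b: "b \<in> F"
      have "\<psi> ((L u - y) * b) * \<psi> (a * y ^ 2) = \<psi> ((L u - y) * b + a * y ^ 2)"
        using uy b L aF by (intro psi_add[symmetric] F_closed)
      also have "(L u - y) * b + a * y ^ 2 = b * L u + (a * y ^ 2 - b * y)" by (simp add: algebra_simps)
      also have "\<psi> \<dots> = \<psi> (b * L u) * \<psi> (a * y ^ 2 - b * y)" using uy b L aF by (intro psi_add F_closed)
      finally show "\<psi> ((L u - y) * b) * \<psi> (a * y ^ 2) = \<psi> (b * L u) * \<psi> (a * y ^ 2 - b * y)" .
    qed
    finally show "(if L u - y = 0 then of_nat Q * \<psi> (a * y ^ 2) else 0) =
        (\<Sum>b\<in>F. \<psi> (b * L u) * \<psi> (a * y ^ 2 - b * y))" .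
  qed
  also have "\<dots> = (\<Sum>u\<in>F. \<Sum>b\<in>F. \<psi> (b * L u) * (\<Sum>y\<in>F. \<psi> (a * y ^ 2 - b * y)))"
    unfolding sum_distrib_left by (intro sum.cong refl sum.swap)
  also have "\<dots> = (\<Sum>b\<in>F. \<Sum>u\<in>F. \<psi> (b * L u) * (\<Sum>y\<in>F. \<psi> (a * y ^ 2 - b * y)))"
    by (rule sum.swap)
  also have "\<dots> = (\<Sum>b\<in>F. if (\<alpha> * b) ^ p = b then of_nat Q * (\<psi> (- (b ^ 2 / (4 * a))) * gauss a) else 0)"
    unfolding sum_distrib_right[symmetric] by (intro sum.cong refl) (simp only: inner1 inner2, simp)
  also have "\<dots> = of_nat Q * (gauss a * (\<Sum>b\<in>{b\<in>F. (\<alpha> * b) ^ p = b}. \<psi> (- (b ^ 2 / (4 * a)))))"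
    using finite_F by (simp add: sum.If_cases Int_def sum_distrib_left mult.commute)
  finally show ?thesis using Q_pos by simp
qed

lemma Re_S_1_less:
  assumes k: "4 dvd k"
  shows "Re (S 1) < p * sqrt Q"
proof (cases "W 1 \<subseteq> {0}")
  case True
  hence "card (W 1) \<le> card {0 :: 'a alg_closure}" by (intro card_mono) auto
  hence "Q * card (W 1) \<le> Q * 1" by (intro mult_le_mono2) simp
  hence "real (Q * card (W 1)) \<le> real Q" by (simp only: of_nat_le_iff mult_1_right)
  hence "norm (S 1) ^ 2 \<le> real Q" using norm_S_squared_le[OF F_1] by linarith
  hence "norm (S 1) ^ 2 \<le> (sqrt Q) ^ 2" by simp
  hence "norm (S 1) \<le> sqrt Q" by (rule power2_le_imp_le) simp
  moreover have "1 * sqrt Q < p * sqrt Q" using p_gt_1 Q_pos by (intro mult_strict_right_mono) simp_all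
  ultimately show ?thesis using complex_Re_le_cmod[of "S 1"] by simp
next
  case False
  then obtain w where w: "w \<in> F" "w \<noteq> 0" "w + (w ^ (p ^ 2) + w ^ p) = 0"
    by (auto simp: W_def)
  define \<alpha> where "\<alpha> = w ^ (p - 1)"
  define a where "a = - inverse \<alpha>"
  define D where "D = {b\<in>F. (\<alpha> * b) ^ p = b}"
  have \<alpha>: "\<alpha> \<noteq> 0" using w by (simp add: \<alpha>_def)
  have S1: "S 1 = gauss a * (\<Sum>b\<in>D. \<psi> (- (b ^ 2 / (4 * a))))"
    unfolding D_def a_def \<alpha>_def by (rule S_1_eq[OF w])
  obtain i :: "'a alg_closure" where i: "i ^ 2 = -1" using nth_root_exists[of 2 "-1"] by auto
  have "even k" using k by auto
  hence iF: "i \<in> F" "i \<noteq> 0" using sqrt_minus_one_mem[OF i] i by (auto simp: mem_F)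
  have "odd p\<^sub>0" using prime_p0 p0_odd prime_odd_nat prime_ge_2_nat by (metis le_neq_implies_less)
  hence "even (p - 1)" using p_gt_1 by (simp add: p_eq)
  then obtain s where s: "p - 1 = s * 2" by (metis evenE mult.commute)
  \<comment> \<open>A square root of a in F: p - 1 is even, and -1 is a square because k is even.
    Hence the Gauss sum for a is the one for 1.\<close>
  define d where "d = i * inverse (w ^ s)"
  have d: "d \<in> F" "d \<noteq> 0" using iF w by (simp_all add: d_def F_closed)
  have "a = d ^ 2"
    unfolding a_def \<alpha>_def s d_def power_mult_distrib i by (simp add: power_mult power_inverse)
  hence "gauss a = gauss 1" using gauss_square_scale[OF d] by simp
  hence ga: "gauss a = - of_real (sqrt Q)" using gauss_one[OF k] by simp
  have finD: "finite D" using finite_F by (simp add: D_def)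
  have zD: "0 \<in> D" using F_0 p_gt_1 by (simp add: D_def)
  have cardD: "card D \<le> p"
  proof -
    define g where "g = monom (\<alpha> ^ p) p + - monom 1 1"
    have lt: "degree (- monom (1 :: 'a alg_closure) 1) < degree (monom (\<alpha> ^ p) p)"
      using \<alpha> p_gt_1 by (simp add: degree_monom_eq)
    have deg: "degree g = p"
      unfolding g_def using degree_add_eq_left[OF lt] \<alpha> by (simp add: degree_monom_eq)
    hence "g \<noteq> 0" using p_gt_1 by auto
    have "D \<subseteq> {h. poly g h = 0}" by (auto simp: D_def g_def poly_monom power_mult_distrib)
    hence "card D \<le> card {h. poly g h = 0}" using \<open>g \<noteq> 0\<close> by (intro card_mono poly_roots_finite)
    also have "\<dots> \<le> p" using card_poly_roots_bound[OF \<open>g \<noteq> 0\<close>] deg by simp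
    finally show ?thesis .
  qed
  \<comment> \<open>The term b = 0 contributes 1 and the at most p - 1 others at least -1 each, so
    the real part stays above -p.\<close>
  have "Re (\<Sum>b\<in>D. \<psi> (- (b ^ 2 / (4 * a)))) = 1 + (\<Sum>b\<in>D - {0}. Re (\<psi> (- (b ^ 2 / (4 * a)))))"
    using finD zD by (subst sum.remove[of _ 0]) (simp_all add: psi_0)
  also have "\<dots> \<ge> 1 + (\<Sum>b\<in>D - {0}. - 1)"
  proof (intro add_left_mono sum_mono)
    fix b
    show "- 1 \<le> Re (\<psi> (- (b ^ 2 / (4 * a))))"
      using abs_Re_le_cmod[of "\<psi> (- (b ^ 2 / (4 * a)))"] by (simp add: norm_psi)
  qed
  finally have "Re (\<Sum>b\<in>D. \<psi> (- (b ^ 2 / (4 * a)))) \<ge> 1 - real (card (D - {0}))" by simp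
  moreover have "card (D - {0}) < p"
    using card_Diff_singleton[OF zD] cardD p_gt_1 by linarith
  ultimately have "- Re (\<Sum>b\<in>D. \<psi> (- (b ^ 2 / (4 * a)))) < p" by linarith
  hence "- Re (\<Sum>b\<in>D. \<psi> (- (b ^ 2 / (4 * a)))) * sqrt Q < p * sqrt Q"
    using Q_pos by (intro mult_strict_right_mono) simp_all
  thus ?thesis unfolding S1 ga by (simp add: mult.commute)
qed

lemma card_points_less:
  assumes q: "q = p\<^sub>0 ^ e" and e: "4 dvd e" "e > 0"
  shows "card {(a, b). a \<in> F \<and> b \<in> F \<and> b ^ q - b = f a} < Q + (real q - 1) * (p * sqrt Q)"
proof -
  define C where "C = {c\<in>F. c ^ q = c}"
  define B where "B = p * sqrt Q"
  have B: "B > 0" using p_gt_1 Q_pos by (simp add: B_def)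
  have finC: "finite C" using finite_F by (simp add: C_def)
  have "(0 :: 'a alg_closure) ^ q = 0" using prime_gt_0_nat[OF prime_p0] by (simp add: q power_0_left)
  hence C01: "0 \<in> C" "1 \<in> C" using F_0 F_1 by (simp_all add: C_def)
  have CFq: "C \<subseteq> Fq q" by (auto simp: C_def Fq_def)
  have Fq: "finite (Fq q :: 'a alg_closure set)" "card (Fq q :: 'a alg_closure set) = q"
    using card_Fq[where 'a = 'a and k = e] finite_Fq[where 'a = 'a and k = e] prime_p0 e(2)
    unfolding CHAR_eq q by blast+
  hence cardC: "card C \<le> q" using card_mono[OF Fq(1) CFq] by simp
  have bound: "Re (S c) \<le> B" if "c \<in> C - {0}" for c
    using that norm_S_le[of c] complex_Re_le_cmod[of "S c"] by (auto simp: C_def B_def)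
  have "real (card {(a, b). a \<in> F \<and> b \<in> F \<and> b ^ q - b = f a}) = Re (\<Sum>c\<in>C. S c)"
    using arg_cong[OF card_points_eq_sum[OF q], of Re] by (simp add: C_def)
  also have "\<dots> = Q + (\<Sum>c\<in>C - {0}. Re (S c))"
    using finC C01 by (subst sum.remove[of _ 0]) (simp_all add: S_0)
  also have "(\<Sum>c\<in>C - {0}. Re (S c)) < (real q - 1) * B"
  proof (cases "card C = q")
    case False
    hence "card C < q" using cardC by simp
    have "(\<Sum>c\<in>C - {0}. Re (S c)) \<le> real (card (C - {0})) * B"
      using sum_bounded_above[of "C - {0}", OF bound] by simp
    also have "real (card (C - {0})) < real q - 1"
    proof -
      have "card (C - {0}) = card C - 1" "card C > 0" using C01 finC by (auto simp: card_gt_0_iff)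
      thus ?thesis using \<open>card C < q\<close> by linarith
    qed
    hence "real (card (C - {0})) * B < (real q - 1) * B" using B by simp
    finally show ?thesis .
  next
    case True
    hence CF: "C = Fq q" using CFq Fq by (intro card_subset_eq) auto
    text \<open>Then the field with \<open>q\<close> elements is contained in \<open>F\<close>, so its degree \<open>e\<close> divides \<open>k\<close>.\<close>
    have "e dvd k"
    proof (rule ccontr)
      assume "\<not> e dvd k"
      \<comment> \<open>A positive remainder l would make all q elements roots of X^M - X with M =
        \<open>p\<^sub>0 ^ l\<close> below q.\<close>
      define l where "l = k mod e"
      have l: "l > 0" "l < e" using \<open>\<not> e dvd k\<close> e(2) by (auto simp: l_def mod_greater_zero_iff_not_dvd)
      have pw: "c ^ (p\<^sub>0 ^ (e * n)) = c" if "c \<in> Fq q" for c :: "'a alg_closure" and n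
      proof (induction n)
        case (Suc n)
        have "c ^ (p\<^sub>0 ^ (e * Suc n)) = (c ^ q) ^ (p\<^sub>0 ^ (e * n))"
          by (simp add: q Power.power_add flip: power_mult)
        thus ?case using Suc that by (simp add: Fq_def)
      qed simp
      have "(Fq q :: 'a alg_closure set) \<subseteq> Fq (p\<^sub>0 ^ l)"
      proof
        fix c :: "'a alg_closure" assume c: "c \<in> Fq q"
        have "k = e * (k div e) + l" by (simp add: l_def)
        hence "c ^ (p\<^sub>0 ^ k) = (c ^ (p\<^sub>0 ^ (e * (k div e)))) ^ (p\<^sub>0 ^ l)"
          by (metis Power.power_add power_mult)
        also have "\<dots> = c ^ (p\<^sub>0 ^ l)" by (simp only: pw[OF c])
        finally have "c ^ (p\<^sub>0 ^ k) = c ^ (p\<^sub>0 ^ l)" .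
        moreover have "c \<in> C" using c CF by simp
        hence "c ^ (p\<^sub>0 ^ k) = c" by (simp add: C_def mem_F)
        ultimately have "c ^ (p\<^sub>0 ^ l) = c" by simp
        thus "c \<in> Fq (p\<^sub>0 ^ l)" by (simp add: Fq_def)
      qed
      moreover have "finite (Fq (p\<^sub>0 ^ l) :: 'a alg_closure set)" "card (Fq (p\<^sub>0 ^ l) :: 'a alg_closure set) = p\<^sub>0 ^ l"
        using card_Fq[where 'a = 'a and k = l] finite_Fq[where 'a = 'a and k = l] prime_p0 l(1)
        unfolding CHAR_eq by blast+
      ultimately have "q \<le> p\<^sub>0 ^ l" using Fq(2) card_mono by metis
      moreover have "p\<^sub>0 ^ l < p\<^sub>0 ^ e" using l prime_gt_1_nat[OF prime_p0] by (intro power_strict_increasing)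
      ultimately show False by (simp add: q)
    qed
    hence "4 dvd k" using e(1) dvd_trans by blast
    hence "Re (S 1) < B" unfolding B_def by (rule Re_S_1_less)
    hence "(\<Sum>c\<in>C - {0}. Re (S c)) < (\<Sum>c\<in>C - {0}. B)"
      using finC C01 bound by (intro sum_strict_mono_ex1) auto
    also have "\<dots> = real (card (C - {0})) * B" by simp
    also have "card (C - {0}) = q - 1" using True C01 by (simp add: card_Diff_singleton)
    also have "real (q - 1) = real q - 1" using prime_gt_0_nat[OF prime_p0] by (simp add: q of_nat_diff Suc_le_eq)
    finally show ?thesis .
  qed
  finally show ?thesis by (simp add: B_def)
qed

end

text \<open>p is -1 modulo p + 1.\<close>

lemma Suc_dvd_even_power_minus_one:
  assumes "even n" "p > 0"
  shows "(p + 1) dvd (p ^ n - 1 :: nat)"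
proof -
  obtain h where h: "n = 2 * h" using assms(1) by (rule evenE)
  obtain s where s: "p = Suc s" using assms(2) gr0_conv_Suc by blast
  have "p ^ 2 = (p + 1) * s + 1" by (simp add: s power2_eq_square)
  hence "[p ^ 2 = 1] (mod (p + 1))" by (simp only: cong_def mod_mult_self4)
  hence "[(p ^ 2) ^ h = 1 ^ h] (mod (p + 1))" by (rule cong_pow)
  hence "[p ^ n = 1] (mod (p + 1))" by (simp add: h power_mult)
  thus ?thesis using assms(2) by (subst (asm) cong_altdef_nat) (simp_all add: Suc_le_eq)
qed

theorem theorem7p12:
  fixes p\<^sub>0 p m d\<^sub>1 d\<^sub>2 d r k :: nat
    and R :: "'a::field poly"
    and \<alpha> \<beta> \<xi> \<zeta> :: "'a alg_closure"
    and \<iota> :: "'a \<Rightarrow> 'k::field"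
    and x z :: 'k
  assumes "prime p\<^sub>0" and "odd p\<^sub>0" and "CARD('a) = p\<^sub>0"
    and "m \<ge> 1" and "p = p\<^sub>0 ^ m"
    and "R = monom 2 p + monom 1 1"
    and "\<alpha> \<in> Fq p - {0, -1}"
    and "\<beta> = - inverse (\<alpha> * (\<alpha> + 1))"
    and "d\<^sub>1 = mult_order \<alpha>" and "d\<^sub>2 = mult_order \<beta>" and "d = lcm d\<^sub>1 d\<^sub>2"
    and "\<xi> \<in> Fq (p ^ d) - {0}" and "\<zeta> \<in> Fq (p ^ d) - {0}"
    and "\<xi> ^ (p - 1) = \<alpha>" and "\<zeta> ^ (p - 1) = \<beta>"
    and "d mod 4 = 0" and "\<beta> ^ (d div 2) = -1"
    and "r \<ge> 1" and "d dvd r"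
    and "plane_curve_function_field \<iota> (artin_schreier_poly R (p ^ r)) x z"
    and "k \<ge> 1"
  shows "\<not> maximal_curve \<iota> (p\<^sub>0 ^ k)"
proof
  define q where "q = p ^ r"
  define Q where "Q = p\<^sub>0 ^ k"
  define F :: "'a poly" where "F = monom 2 (p + 1) + monom 1 2"
  have d4: "4 dvd r" using \<open>d mod 4 = 0\<close> \<open>d dvd r\<close> by (meson dvd_trans mod_0_imp_dvd)
  have p0_2: "p\<^sub>0 \<noteq> 2" using \<open>odd p\<^sub>0\<close> by auto
  have p: "p \<ge> 2"
  proof -
    have "p\<^sub>0 ^ m > 1" using prime_gt_1_nat[OF \<open>prime p\<^sub>0\<close>] \<open>m \<ge> 1\<close> by (intro one_less_power) simp_all
    thus ?thesis using \<open>p = p\<^sub>0 ^ m\<close> by simp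
  qed
  have CHAR: "CHAR('a) = p\<^sub>0" using \<open>CARD('a) = p\<^sub>0\<close> \<open>prime p\<^sub>0\<close> by (rule CHAR_eq_prime_CARD)
  have two: "(2 :: 'a) \<noteq> 0"
  proof
    assume "(2 :: 'a) = 0"
    hence "(of_nat 2 :: 'a) = 0" by simp
    hence "p\<^sub>0 dvd 2" by (simp only: of_nat_eq_0_iff_char_dvd CHAR)
    thus False using p0_2 prime_gt_1_nat[OF \<open>prime p\<^sub>0\<close>] by (auto dest!: dvd_imp_le)
  qed
  have "monom 1 1 * R = F"
    unfolding \<open>R = monom 2 p + monom 1 1\<close> F_def by (simp add: distrib_left mult_monom numeral_2_eq_2)
  hence curve: "plane_curve_function_field \<iota> (monom 1 q - monom 1 1 - [:F:]) x z"
    using \<open>plane_curve_function_field \<iota> (artin_schreier_poly R (p ^ r)) x z\<close>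
    by (simp only: artin_schreier_poly_def q_def)
  have q: "q = p\<^sub>0 ^ (m * r)" by (simp add: q_def \<open>p = p\<^sub>0 ^ m\<close> power_mult)
  have "(p + 1) dvd (q - 1)"
    unfolding q_def using d4 p by (intro Suc_dvd_even_power_minus_one) auto
  then interpret curve: quadratic_as_curve \<iota> p\<^sub>0 "m * r" q F x z p
    by unfold_locales (use assms curve q p two in \<open>auto simp: F_def\<close>)
  interpret char_p_closure p\<^sub>0 k Q "Fq Q :: 'a alg_closure set"
    by unfold_locales (use \<open>prime p\<^sub>0\<close> CHAR \<open>k \<ge> 1\<close> in \<open>auto simp: Q_def\<close>)
  obtain \<psi> :: "'a alg_closure \<Rightarrow> complex" where \<psi>:
    "\<forall>a\<in>Fq Q. \<forall>b\<in>Fq Q. \<psi> (a + b) = \<psi> a * \<psi> b" "\<forall>a. norm (\<psi> a) = 1"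
    "\<forall>a\<in>Fq Q. \<psi> (a ^ p\<^sub>0) = \<psi> a" "\<exists>a\<in>Fq Q. \<psi> a \<noteq> 1"
    using ex_character by blast
  interpret psi: character p\<^sub>0 k Q "Fq Q" \<psi>
    by unfold_locales (use \<psi> in blast)+
  interpret psi: quadratic_character p\<^sub>0 k Q "Fq Q" \<psi> p m
    by unfold_locales (use assms p0_2 in auto)
  have "eval_ac a F = psi.f a" for a
    by (simp add: F_def psi.f_def comm_hom.hom_add[OF comm_hom_eval_ac] eval_ac_monom)
  hence points: "curve.affine_points Q = {(a, b). a \<in> Fq Q \<and> b \<in> Fq Q \<and> b ^ q - b = psi.f a}"
    by (simp add: curve.affine_points_def)
  hence "curve.affine_points Q \<subseteq> Fq Q \<times> Fq Q" by auto
  hence "finite (curve.affine_points Q)" using finite_F finite_subset by blast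
  hence "card (rational_points \<iota> Q) \<le> card (curve.affine_points Q) + 1"
    by (rule curve.card_rational_points_le)
  moreover have "card (curve.affine_points Q) < Q + (real q - 1) * (p * sqrt Q)"
    unfolding points
  proof (rule psi.card_points_less[OF q])
    show "4 dvd m * r" using d4 by (rule dvd_mult)
    show "m * r > 0" using \<open>m \<ge> 1\<close> \<open>r \<ge> 1\<close> by simp
  qed
  moreover assume "maximal_curve \<iota> (p\<^sub>0 ^ k)"
  then obtain g where g: "genus \<iota> = enat g"
    "real (card (rational_points \<iota> Q)) = real Q + 1 + 2 * real g * sqrt (real Q)"
    unfolding maximal_curve_def Q_def by blast
  \<comment> \<open>By this bound maximality demands at least Q + 1 + (q - 1)p sqrt(Q) points,
    whereas the affine points number strictly fewer than Q + (q - 1)p sqrt(Q) and infinity adds at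
    most one.\<close>
  moreover have "(real q - 1) * (p * sqrt Q) \<le> 2 * real g * sqrt Q"
  proof -
    have "real ((q - 1) * p) \<le> real (2 * g)" using curve.genus_ge[OF g(1)] by (simp only: of_nat_le_iff)
    hence "(real q - 1) * p \<le> 2 * real g" using curve.q_gt_1 by (simp add: of_nat_diff)
    hence "((real q - 1) * p) * sqrt Q \<le> (2 * real g) * sqrt Q" by (intro mult_right_mono) simp_all
    thus ?thesis by (simp only: mult.assoc)
  qed
  ultimately show False by linarith
qed

end
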